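(* Let $f\in S_{k,m}(\mathrm{GL}_2(A))$ have an $A$-expansion with $A$-exponent $n$, with coefficients $c_a(f)$. Let $\mathfrak{p}$ be a nonzero prime ideal of $A$ with monic generator $\wp$. Suppose $f$ is an eigenform for $\mathbb{T}_\mathfrak{p}$ with eigenvalue $\lambda_\mathfrak{p}$. Then $\lambda_\mathfrak{p}=\wp^n$ and $c_\wp(f)=\wp^{k-n}c_1(f)$.
   Context: Let $p$ be a prime, $q=p^e$, $A=\mathbb{F}_q[T]$, and $A_+$ the monic elements of $A$. Let $\mathbb{C}_\infty$ be the completion of an algebraic closure of $K_\infty=\mathbb{F}_q((1/T))$, and let $\Omega=\mathbb{C}_\infty\setminus K_\infty$. Fix a Carlitz period $\widetilde{\pi}$ with Carlitz exponential $e_{\widetilde{\pi}A}(z)=z\prod_{0\neq\lambda\in\widetilde{\pi}A}(1-z/\lambda)$. Put $t(z)=1/e_{\widetilde{\pi}A}(\widetilde{\pi}z)$ and $t_a(z)=t(az)$. $G_n(X)$ is the $n$-th Goss polynomial of $\widetilde{\pi}A$: $G_n(t(z))=\sum_{b\in A}(\widetilde{\pi}z+\widetilde{\pi}b)^{-n}$. $M_{k,m}(\mathrm{GL}_2(A))$ is the space of Drinfeld modular forms of weight $k$ and type $m\in\mathbb{Z}/(q-1)$. These are rigid analytic $f:\Omega\to\mathbb{C}_\infty$ with $f(\gamma z)=(\det\gamma)^{-m}(cz+d)^kf(z)$ for all $\gamma=\begin{pmatrix}a&b\\c&d\end{pmatrix}\in\mathrm{GL}_2(A)$, having a $t$-expansion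 $\sum_{i\ge0}a_it^i$ near infinity. $S_{k,m}(\mathrm{GL}_2(A))$ is the subspace with $a_0=0$. A form $f\in M_{k,m}(\mathrm{GL}_2(A))$ has an $A$-expansion with $A$-exponent $n$ (a positive integer) if there are $c_0(f),c_a(f)\in\mathbb{C}_\infty$ ($a\in A_+$) such that $f=c_0(f)+\sum_{a\in A_+}c_a(f)G_n(t_a)$ as formal power series in $t$. Such coefficients are unique given $n$. For a nonzero prime $\mathfrak{p}=(\wp)$, $\wp$ monic, the Hecke operator is \[ \mathbb{T}_\mathfrak{p}f(z)=\wp^kf(\wp z)+\sum_{\beta\in A,\ \deg\beta<\deg\wp}f\!\left(\tfrac{z+\beta}{\wp}\right). \] $f$ is an eigenform for $\mathbb{T}_\mathfrak{p}$ with eigenvalue $\lambda_\mathfrak{p}$ if $f\neq0$ and $\mathbb{T}_\mathfrak{p}f=\lambda_\mathfrak{p}f$. *)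

theory Defs
  imports
    "HOL-Analysis.Analysis"
    "HOL-Computational_Algebra.Computational_Algebra"
begin

text \<open>
  Throughout, \<open>'a\<close> is the finite field with \<open>q = CARD('a)\<close> elements, \<open>A\<close> is the type \<open>'a poly\<close>,
  and the field of formal Laurent series in \<open>1/T\<close> is \<open>'a fls\<close>; so the library's \<open>fls_X\<close> is
  \<open>1/T\<close> and \<open>fls_X_inv\<close> is \<open>T\<close>.
  The completion of an algebraic closure of \<open>'a fls\<close> is a type \<open>'c\<close> together with an embedding
  \<open>\<iota> :: 'a fls \<Rightarrow> 'c\<close>; the absolute value on \<open>'c\<close> is \<open>\<lambda>x. dist x 0\<close>
  (real normed fields have characteristic 0, so that class is not applicable).
\<close>

definition algebraic_part :: "('a::{field,finite} fls \<Rightarrow> 'c::{field,complete_space}) \<Rightarrow> 'c set" where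
  "algebraic_part \<iota> = {y. \<exists>p. p \<noteq> 0 \<and> poly (map_poly \<iota> p) y = 0}"

text \<open>
  These conditions determine \<open>'c\<close> up to isometric isomorphism over \<open>'a fls\<close>: the elements algebraic over the
  image of \<open>\<iota>\<close> form an algebraic closure of it, they are dense, and \<open>'c\<close> is complete (by its class)
  for the multiplicative ultrametric absolute value that extends the one on \<open>'a fls\<close>
  normalised by \<open>\<bar>T\<bar> = q\<close>.
\<close>

definition C_infinity :: "('a::{field,finite} fls \<Rightarrow> 'c::{field,complete_space}) \<Rightarrow> bool" where
  "C_infinity \<iota> \<longleftrightarrow>
     (\<forall>x y. \<iota> (x + y) = \<iota> x + \<iota> y) \<and> (\<forall>x y. \<iota> (x * y) = \<iota> x * \<iota> y) \<and> \<iota> 1 = 1 \<and>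
     (\<forall>u v :: 'c. dist u v = dist (u - v) 0) \<and>
     (\<forall>u v :: 'c. dist (u * v) 0 = dist u 0 * dist v 0) \<and>
     (\<forall>u v :: 'c. dist (u + v) 0 \<le> max (dist u 0) (dist v 0)) \<and>
     (\<forall>x. x \<noteq> 0 \<longrightarrow> dist (\<iota> x) 0 = real CARD('a) powi (- fls_subdegree x)) \<and>
     (\<forall>p. degree p > 0 \<longrightarrow> (\<forall>i. coeff p i \<in> algebraic_part \<iota>) \<longrightarrow>
        (\<exists>y\<in>algebraic_part \<iota>. poly p y = 0)) \<and>
     closure (algebraic_part \<iota>) = UNIV"

definition emb_A :: "('a::{field,finite} fls \<Rightarrow> 'c::{field,complete_space}) \<Rightarrow> 'a poly \<Rightarrow> 'c" where
  "emb_A \<iota> a = \<iota> (poly (map_poly fls_const a) fls_X_inv)"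

definition Omega :: "('a::{field,finite} fls \<Rightarrow> 'c::{field,complete_space}) \<Rightarrow> 'c set" where
  "Omega \<iota> = UNIV - range \<iota>"

text \<open>The product is the unconditional one, i.e. the limit along the net of finite subsets.\<close>

definition lattice_exp :: "'c::{field,complete_space} set \<Rightarrow> 'c \<Rightarrow> 'c" where
  "lattice_exp L z =
     z * Lim (finite_subsets_at_top (L - {0})) (\<lambda>S. \<Prod>l\<in>S. 1 - z / l)"

definition carlitz_exp ::
    "('a::{field,finite} fls \<Rightarrow> 'c::{field,complete_space}) \<Rightarrow> 'c \<Rightarrow> 'c \<Rightarrow> 'c" where
  "carlitz_exp \<iota> per = lattice_exp (range (\<lambda>a. per * emb_A \<iota> a))"

text \<open>
  \<open>per\<close> is a Carlitz period if the rank one lattice \<open>per A\<close> is the one of the Carlitz module,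
  which is normalised as \<open>C\<^sub>T(X) = T X + X\<^sup>q\<close>.
\<close>

definition carlitz_period ::
    "('a::{field,finite} fls \<Rightarrow> 'c::{field,complete_space}) \<Rightarrow> 'c \<Rightarrow> bool" where
  "carlitz_period \<iota> per \<longleftrightarrow> per \<noteq> 0 \<and>
     (\<forall>z. carlitz_exp \<iota> per (\<iota> fls_X_inv * z) =
          \<iota> fls_X_inv * carlitz_exp \<iota> per z + carlitz_exp \<iota> per z ^ CARD('a))"

definition t_par ::
    "('a::{field,finite} fls \<Rightarrow> 'c::{field,complete_space}) \<Rightarrow> 'c \<Rightarrow> 'c \<Rightarrow> 'c" where
  "t_par \<iota> per z = 1 / carlitz_exp \<iota> per (per * z)"

definition goss_poly ::
    "('a::{field,finite} fls \<Rightarrow> 'c::{field,complete_space}) \<Rightarrow> 'c \<Rightarrow> nat \<Rightarrow> 'c poly" where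
  "goss_poly \<iota> per n = (THE G. \<forall>z\<in>Omega \<iota>.
     ((\<lambda>b. 1 / (per * z + per * emb_A \<iota> b) ^ n) has_sum poly G (t_par \<iota> per z)) UNIV)"

text \<open>
  The sets \<open>Omega_aff \<iota> 0 \<subseteq> Omega_aff \<iota> 1 \<subseteq> \<dots>\<close> are affinoid subdomains of the projective line and
  form an admissible covering of \<open>Omega \<iota>\<close>. A function on such an affinoid is rigid
  analytic iff it is a uniform limit of rational functions without poles on the affinoid.
\<close>

definition Omega_aff ::
    "('a::{field,finite} fls \<Rightarrow> 'c::{field,complete_space}) \<Rightarrow> nat \<Rightarrow> 'c set" where
  "Omega_aff \<iota> n =
     {z. dist z 0 \<le> real CARD('a) ^ n \<and> infdist z (range \<iota>) \<ge> 1 / real CARD('a) ^ n}"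

definition rigid_analytic ::
    "('a::{field,finite} fls \<Rightarrow> 'c::{field,complete_space}) \<Rightarrow> ('c \<Rightarrow> 'c) \<Rightarrow> bool" where
  "rigid_analytic \<iota> f \<longleftrightarrow> (\<forall>n. \<forall>\<epsilon>>0. \<exists>P Q. \<forall>z\<in>Omega_aff \<iota> n.
     poly Q z \<noteq> 0 \<and> dist (f z) (poly P z / poly Q z) < \<epsilon>)"

text \<open>
  Neighbourhoods of infinity are given by the imaginary part, the distance to the image of \<open>\<iota>\<close>.
\<close>

definition has_t_expansion ::
    "('a::{field,finite} fls \<Rightarrow> 'c::{field,complete_space}) \<Rightarrow> 'c \<Rightarrow> ('c \<Rightarrow> 'c) \<Rightarrow> 'c fps \<Rightarrow> bool" where
  "has_t_expansion \<iota> per f F \<longleftrightarrow> (\<exists>R>0. \<forall>z. infdist z (range \<iota>) \<ge> R \<longrightarrow>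
     (\<lambda>i. fps_nth F i * t_par \<iota> per z ^ i) sums f z)"

definition t_expansion ::
    "('a::{field,finite} fls \<Rightarrow> 'c::{field,complete_space}) \<Rightarrow> 'c \<Rightarrow> ('c \<Rightarrow> 'c) \<Rightarrow> 'c fps" where
  "t_expansion \<iota> per f = (THE F. has_t_expansion \<iota> per f F)"

text \<open>
  The group is that of the matrices invertible over \<open>'a poly\<close>, and the type \<open>m\<close> only matters modulo \<open>q - 1\<close>
  because determinants of such matrices are nonzero constants. Values of a form outside
  \<open>Omega \<iota>\<close> are irrelevant.
\<close>

definition modular_forms ::
    "('a::{field,finite} fls \<Rightarrow> 'c::{field,complete_space}) \<Rightarrow> 'c \<Rightarrow> int \<Rightarrow> int \<Rightarrow> ('c \<Rightarrow> 'c) set" where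
  "modular_forms \<iota> per k m = {f. rigid_analytic \<iota> f \<and>
     (\<forall>\<gamma> :: 'a poly ^ 2 ^ 2. \<forall>z\<in>Omega \<iota>. invertible \<gamma> \<longrightarrow>
        (let a = emb_A \<iota> (\<gamma> $ 1 $ 1); b = emb_A \<iota> (\<gamma> $ 1 $ 2);
             c = emb_A \<iota> (\<gamma> $ 2 $ 1); d = emb_A \<iota> (\<gamma> $ 2 $ 2)
         in f ((a * z + b) / (c * z + d)) =
              emb_A \<iota> (det \<gamma>) powi (- m) * (c * z + d) powi k * f z)) \<and>
     (\<exists>F. has_t_expansion \<iota> per f F)}"

definition cusp_forms ::
    "('a::{field,finite} fls \<Rightarrow> 'c::{field,complete_space}) \<Rightarrow> 'c \<Rightarrow> int \<Rightarrow> int \<Rightarrow> ('c \<Rightarrow> 'c) set" where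
  "cusp_forms \<iota> per k m =
     {f \<in> modular_forms \<iota> per k m. fps_nth (t_expansion \<iota> per f) 0 = 0}"

text \<open>
  The infinite sum is in the library topology on formal power series, the \<open>X\<close>-adic one with discrete
  coefficients. The power series of \<open>t\<^sub>a\<close> is the \<open>t\<close>-expansion of \<open>z \<mapsto> t(az)\<close>.
\<close>

definition has_A_expansion ::
    "('a::{field,finite} fls \<Rightarrow> 'c::{field,complete_space}) \<Rightarrow> 'c \<Rightarrow> ('c \<Rightarrow> 'c) \<Rightarrow> nat
      \<Rightarrow> 'c \<Rightarrow> ('a poly \<Rightarrow> 'c) \<Rightarrow> bool" where
  "has_A_expansion \<iota> per f n c0 c \<longleftrightarrow> n > 0 \<and>
     (\<exists>S. ((\<lambda>a. fps_const (c a) *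
              poly (map_poly fps_const (goss_poly \<iota> per n))
                   (t_expansion \<iota> per (\<lambda>z. t_par \<iota> per (emb_A \<iota> a * z))))
            has_sum S) {a. lead_coeff a = 1} \<and>
          t_expansion \<iota> per f = fps_const c0 + S)"

definition hecke ::
    "('a::{field,finite} fls \<Rightarrow> 'c::{field,complete_space}) \<Rightarrow> int \<Rightarrow> 'a poly
      \<Rightarrow> ('c \<Rightarrow> 'c) \<Rightarrow> 'c \<Rightarrow> 'c" where
  "hecke \<iota> k wp f z = emb_A \<iota> wp powi k * f (emb_A \<iota> wp * z) +
     (\<Sum>\<beta> | degree \<beta> < degree wp. f ((z + emb_A \<iota> \<beta>) / emb_A \<iota> wp))"

definition hecke_eigenform ::
    "('a::{field,finite} fls \<Rightarrow> 'c::{field,complete_space}) \<Rightarrow> int \<Rightarrow> 'a poly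
      \<Rightarrow> ('c \<Rightarrow> 'c) \<Rightarrow> 'c \<Rightarrow> bool" where
  "hecke_eigenform \<iota> k wp f ev \<longleftrightarrow>
     (\<exists>z\<in>Omega \<iota>. f z \<noteq> 0) \<and> (\<forall>z\<in>Omega \<iota>. hecke \<iota> k wp f z = ev * f z)"

end

theory Submission
  imports Defs
begin

text \<open>
  Write \<open>H\<^sub>a\<close> for the expansion of \<open>G\<^sub>n(t\<^sub>a)\<close> in \<open>t\<close>. The Hecke operator is \<open>wp\<^sup>k V + U\<close>, where \<open>V\<close> substitutes
  the expansion of \<open>t(wp z)\<close> for \<open>t\<close> and \<open>U\<close> is the trace over the \<open>wp\<close>-torsion of the Carlitz module; both make
  sense on formal power series. Rearranging the lattice sum for \<open>G\<^sub>n\<close> gives \<open>U H\<^sub>a = wp\<^sup>n H\<^sub>a\<close> when \<open>wp\<close> does not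
  divide \<open>a\<close>; otherwise all terms of the trace coincide, their number is \<open>0\<close> in characteristic \<open>p\<close>,
  and \<open>U H\<^sub>a = 0\<close>. The operator \<open>V\<close> multiplies the index of \<open>H\<^sub>a\<close> by \<open>wp\<close>.
  Applying \<open>U\<close> for all primes of degree at most \<open>D\<close> sieves out of a vanishing sum \<open>\<Sum> c\<^sub>a H\<^sub>a\<close> all \<open>a\<close> with
  \<open>1 \<le> deg a \<le> D\<close>, so \<open>c\<^sub>1 H\<^sub>1\<close> has arbitrarily high order and \<open>c\<^sub>1 = 0\<close>; the injectivity of \<open>V\<close> then gives
  \<open>c\<^sub>a = 0\<close> for all \<open>a\<close>. Comparing coefficients in the eigenvalue equation proves the theorem,
  once the expansion of \<open>f\<close> is known to be nonzero; this is an identity theorem for rigid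
  analytic functions, obtained from the log-convexity of Gauss norms on annuli.
\<close>

section \<open>Ultrametric absolute values\<close>

text \<open>A \<open>t\<close>-expansion describes a form only near infinity, while
  \<open>hecke_eigenform\<close> provides a nonvanishing point anywhere in \<open>Omega\<close>; the
  identity theorem closes this gap. Rigid analyticity is given as uniform approximation by rational
  functions, so norms are read off from zeros and poles. This needs \<open>'c\<close> algebraically
  closed, whereas \<open>C_infinity\<close> only provides roots of polynomials with coefficients in
  the dense set \<open>algebraic_part\<close>. The trace acts on formal power series because the
  trace of \<open>t^i\<close> is a polynomial in \<open>t\<close> whose terms \<open>t^m\<close> all
  satisfy \<open>i \<le> m * q^deg wp\<close>: each output coefficient is a finite sum, so the
  operator passes through infinite A-expansions. This and the existence of Goss polynomials have one
  source, a recursion for reciprocal power sums over a finite additive group, applied to the torsion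
  and to truncated period lattices respectively. Since \<open>t_expansion\<close> and
  \<open>goss_poly\<close> are definite descriptions, nothing can be said about them before
  uniqueness is known.\<close>

definition av :: "'c::{field,metric_space} \<Rightarrow> real" where "av x = dist x 0"

locale ultrametric_field =
  fixes ty :: "'c::{field,complete_space} itself"
  assumes dist_av: "\<And>x y :: 'c. dist x y = av (x - y)"
    and av_mult: "\<And>x y :: 'c. av (x * y) = av x * av y"
    and av_add: "\<And>x y :: 'c. av (x + y) \<le> max (av x) (av y)"
begin

lemma av_0 [simp]: "av (0::'c) = 0"
  by (simp add: av_def)

lemma av_eq_0_iff [simp]: "av (x::'c) = 0 \<longleftrightarrow> x = 0"
  by (simp add: av_def)

lemma av_nonneg [simp]: "0 \<le> av (x::'c)"
  by (simp add: av_def)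

lemma av_pos_iff [simp]: "0 < av (x::'c) \<longleftrightarrow> x \<noteq> 0"
  by (simp add: av_def)

lemma av_1 [simp]: "av (1::'c) = 1"
proof -
  have "av (1::'c) * av (1::'c) = av (1::'c)" using av_mult[of 1 1] by simp
  thus ?thesis by simp
qed

lemma av_minus [simp]: "av (- x) = av (x::'c)"
  using dist_av[of x 0] dist_av[of 0 x] by (simp add: dist_commute)

lemma av_minus_commute: "av (x - y) = av (y - (x::'c))"
  using av_minus[of "x - y"] by simp

lemma av_diff: "av (x - y) \<le> max (av x) (av (y::'c))"
  using av_add[of x "- y"] by simp

lemma av_power [simp]: "av ((x::'c) ^ n) = av x ^ n"
  by (induction n) (simp_all add: av_mult)

lemma av_inverse: "av (inverse (x::'c)) = inverse (av x)"
proof (cases "x = 0")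
  case False
  have "av (inverse x) * av x = 1" using False by (simp flip: av_mult)
  thus ?thesis by (simp add: inverse_eq_divide eq_divide_eq False)
qed simp

lemma av_divide: "av (x / y) = av x / av (y::'c)"
  by (simp add: divide_inverse av_mult av_inverse)

lemma av_prod: "av (prod f A) = (\<Prod>i\<in>A. av (f i :: 'c))"
  by (induction A rule: infinite_finite_induct) (simp_all add: av_mult)

lemma av_prod_list: "av (prod_list xs) = prod_list (map av (xs :: 'c list))"
  by (induction xs) (simp_all add: av_mult)

lemma av_add_le: "av x \<le> B \<Longrightarrow> av y \<le> B \<Longrightarrow> av (x + y :: 'c) \<le> B"
  using av_add[of x y] by simp

lemma av_diff_le: "av x \<le> B \<Longrightarrow> av y \<le> B \<Longrightarrow> av (x - y :: 'c) \<le> B"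
  using av_diff[of x y] by simp

lemma av_sum_le: "0 \<le> B \<Longrightarrow> (\<And>i. i \<in> A \<Longrightarrow> av (f i) \<le> B) \<Longrightarrow> av (\<Sum>i\<in>A. f i :: 'c) \<le> B"
  by (induction A rule: infinite_finite_induct) (auto intro: av_add_le)

lemma av_diff_lt: "av x < B \<Longrightarrow> av y < B \<Longrightarrow> av (x - y :: 'c) < B"
  using av_diff[of x y] by simp

lemma av_add_eq: "av y < av x \<Longrightarrow> av (x + y :: 'c) = av x"
  using av_add[of x y] av_diff[of "x + y" y] by (simp add: max_def split: if_splits)

lemma av_diff_eq: "av y < av x \<Longrightarrow> av (x - y :: 'c) = av x"
  using av_add_eq[of "-y" x] by simp

lemma av_diff_eq': "av x < av y \<Longrightarrow> av (x - y :: 'c) = av y"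
  using av_diff_eq[of x y] by (simp add: av_minus_commute)

lemma av_diff_neq: "av x \<noteq> av y \<Longrightarrow> av (x - y :: 'c) = max (av x) (av y)"
  by (cases "av x < av y") (simp_all add: av_diff_eq av_diff_eq' max_def)

lemma tendsto_av_iff: "(f \<longlongrightarrow> (l::'c)) F \<longleftrightarrow> ((\<lambda>x. av (f x - l)) \<longlongrightarrow> 0) F"
  by (subst tendsto_dist_iff) (simp add: dist_av)

lemma tendsto_av [tendsto_intros]: "(f \<longlongrightarrow> (l::'c)) F \<Longrightarrow> ((\<lambda>x. av (f x)) \<longlongrightarrow> av l) F"
  unfolding av_def by (intro tendsto_intros)

text \<open>The class of \<open>'c\<close> does not relate its metric to its arithmetic; the limit
  laws follow from \<open>dist_av\<close>, \<open>av_mult\<close> and \<open>av_add\<close> alone,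
  by domination with a real null function.\<close>

lemma lim_av_le:
  assumes "(g \<longlongrightarrow> 0) F" "\<And>x. av (f x - (l::'c)) \<le> g x" shows "(f \<longlongrightarrow> l) F"
  unfolding tendsto_av_iff by (rule Lim_null_comparison[OF _ assms(1)]) (use assms(2) in auto)

lemma lim_add:
  assumes "(f \<longlongrightarrow> (l::'c)) F" "(g \<longlongrightarrow> m) F" shows "((\<lambda>x. f x + g x) \<longlongrightarrow> l + m) F"
proof -
  have "((\<lambda>x. av (f x - l) + av (g x - m)) \<longlongrightarrow> 0 + 0) F"
    using assms by (intro tendsto_add) (simp_all add: tendsto_av_iff)
  moreover have "av (f x + g x - (l + m)) \<le> av (f x - l) + av (g x - m)" for x
    using av_add[of "f x - l" "g x - m"] av_nonneg[of "f x - l"] av_nonneg[of "g x - m"]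
    unfolding add_diff_add by linarith
  ultimately show ?thesis by (intro lim_av_le) auto
qed

lemma lim_mult:
  assumes "(f \<longlongrightarrow> (l::'c)) F" "(g \<longlongrightarrow> m) F" shows "((\<lambda>x. f x * g x) \<longlongrightarrow> l * m) F"
proof -
  have f: "((\<lambda>x. av (f x - l)) \<longlongrightarrow> 0) F" and g: "((\<lambda>x. av (g x - m)) \<longlongrightarrow> 0) F"
    using assms by (simp_all flip: tendsto_av_iff)
  have "((\<lambda>x. av (f x - l) * av (g x) + av l * av (g x - m)) \<longlongrightarrow> 0 * av m + av l * 0) F"
    using assms by (intro tendsto_intros f g)
  moreover have "av (f x * g x - l * m) \<le> av (f x - l) * av (g x) + av l * av (g x - m)" for x
  proof -
    have eq: "f x * g x - l * m = (f x - l) * g x + l * (g x - m)" by (simp add: algebra_simps)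
    have "av (f x * g x - l * m) \<le> max (av (f x - l) * av (g x)) (av l * av (g x - m))"
      unfolding eq using av_add[of "(f x - l) * g x" "l * (g x - m)"] by (simp add: av_mult)
    also have "\<dots> \<le> av (f x - l) * av (g x) + av l * av (g x - m)"
      by simp
    finally show ?thesis .
  qed
  ultimately show ?thesis by (intro lim_av_le) auto
qed

lemma lim_minus: "(f \<longlongrightarrow> (l::'c)) F \<Longrightarrow> ((\<lambda>x. - f x) \<longlongrightarrow> - l) F"
proof -
  have "av (- f x - - l) = av (f x - l)" for x using av_minus_commute[of "f x" l] by simp
  thus "(f \<longlongrightarrow> (l::'c)) F \<Longrightarrow> ((\<lambda>x. - f x) \<longlongrightarrow> - l) F"
    by (simp only: tendsto_av_iff)
qed

lemma lim_diff: "(f \<longlongrightarrow> (l::'c)) F \<Longrightarrow> (g \<longlongrightarrow> m) F \<Longrightarrow> ((\<lambda>x. f x - g x) \<longlongrightarrow> l - m) F"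
  using lim_add[of f l F "\<lambda>x. - g x" "- m"] lim_minus[of g m F] by simp

lemma lim_inverse:
  assumes "(f \<longlongrightarrow> (l::'c)) F" "l \<noteq> 0" shows "((\<lambda>x. inverse (f x)) \<longlongrightarrow> inverse l) F"
proof -
  have f: "((\<lambda>x. av (f x - l)) \<longlongrightarrow> 0) F"
    using assms by (simp flip: tendsto_av_iff)
  have "((\<lambda>x. av (f x - l) / (av (f x) * av l)) \<longlongrightarrow> 0 / (av l * av l)) F"
    using assms by (intro tendsto_intros f) auto
  moreover have "eventually (\<lambda>x. f x \<noteq> 0) F"
    using tendsto_imp_eventually_ne[OF assms(1), of 0] assms(2) by blast
  hence "eventually (\<lambda>x. av (f x - l) / (av (f x) * av l) = av (inverse (f x) - inverse l)) F"
  proof eventually_elim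
    case (elim x)
    have eq: "inverse (f x) - inverse l = - ((f x - l) / (f x * l))" using elim assms(2) by (simp add: field_simps)
    show ?case unfolding eq by (simp add: av_divide av_mult)
  qed
  ultimately show ?thesis unfolding tendsto_av_iff[of "\<lambda>x. inverse (f x)"]
    by (auto dest: Lim_transform_eventually)
qed

lemma lim_divide: "(f \<longlongrightarrow> (l::'c)) F \<Longrightarrow> (g \<longlongrightarrow> m) F \<Longrightarrow> m \<noteq> 0 \<Longrightarrow> ((\<lambda>x. f x / g x) \<longlongrightarrow> l / m) F"
  unfolding divide_inverse by (intro lim_mult lim_inverse)

lemma lim_sum: "(\<And>i. i \<in> A \<Longrightarrow> (f i \<longlongrightarrow> (l i::'c)) F) \<Longrightarrow> ((\<lambda>x. \<Sum>i\<in>A. f i x) \<longlongrightarrow> (\<Sum>i\<in>A. l i)) F"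
  by (induction A rule: infinite_finite_induct) (auto intro: lim_add)

lemma lim_poly: "(f \<longlongrightarrow> (l::'c)) F \<Longrightarrow> ((\<lambda>x. poly p (f x)) \<longlongrightarrow> poly p l) F"
  by (induction p) (auto intro!: lim_add lim_mult)

text \<open>Bounds uniform in \<open>m\<close> are natural here because an ultrametric sum is no
  larger than its largest term; they pass to the limit unchanged.\<close>

lemma cauchy_limit:
  fixes S :: "nat \<Rightarrow> 'c"
  assumes "\<And>m n. n \<le> m \<Longrightarrow> av (S m - S n) \<le> E n" "E \<longlonglongrightarrow> 0"
  obtains l where "S \<longlonglongrightarrow> l" "\<And>n. av (l - S n) \<le> E n"
proof -
  have "Cauchy S"
  proof (rule metric_CauchyI)
    fix e :: real assume "e > 0"
    then obtain N where N: "E N < e"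
      using assms(2) order_tendstoD(2)[of E 0 sequentially e] by (auto simp: eventually_sequentially)
    show "\<exists>M. \<forall>m\<ge>M. \<forall>n\<ge>M. dist (S m) (S n) < e"
    proof (intro exI[of _ N] allI impI)
      fix m n assume "N \<le> m" "N \<le> n"
      hence "av (S m - S N) \<le> E N" "av (S n - S N) \<le> E N" using assms(1) by auto
      hence "av ((S m - S N) - (S n - S N)) \<le> E N" by (rule av_diff_le)
      thus "dist (S m) (S n) < e" using N by (simp add: dist_av)
    qed
  qed
  then obtain l where l: "S \<longlonglongrightarrow> l" using Cauchy_convergent convergent_def by blast
  have "av (l - S n) \<le> E n" for n
  proof (rule tendsto_upperbound)
    show "(\<lambda>m. av (S m - S n)) \<longlonglongrightarrow> av (l - S n)"
      by (intro tendsto_intros lim_diff l)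
    show "eventually (\<lambda>m. av (S m - S n) \<le> E n) sequentially"
      using assms(1) by (auto simp: eventually_sequentially)
  qed simp
  with l show ?thesis by (rule that)
qed

lemma sums_exists:
  fixes a :: "nat \<Rightarrow> 'c"
  assumes "\<And>n. av (a n) \<le> K * r ^ n" "0 \<le> r" "r < 1" "0 \<le> K"
  obtains s where "a sums s"
proof (rule cauchy_limit[of "\<lambda>n. sum a {..<n}" "\<lambda>n. K * r ^ n"])
  fix m n :: nat assume mn: "n \<le> m"
  have eq: "sum a {..<m} - sum a {..<n} = sum a {n..<m}"
    using sum_diff_nat_ivl[of 0 n m a] mn by (simp add: atLeast0LessThan)
  show "av (sum a {..<m} - sum a {..<n}) \<le> K * r ^ n" unfolding eq
  proof (rule av_sum_le)
    fix i assume "i \<in> {n..<m}"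
    hence "r ^ i \<le> r ^ n" using assms by (intro power_decreasing) auto
    thus "av (a i) \<le> K * r ^ n" using assms(1)[of i] assms(4) by (meson mult_left_mono order_trans)
  qed (use assms in auto)
next
  have "(\<lambda>n. K * r ^ n) \<longlonglongrightarrow> K * 0" using assms
    by (intro tendsto_intros LIMSEQ_realpow_zero) auto
  thus "(\<lambda>n. K * r ^ n) \<longlonglongrightarrow> 0" by simp
qed (use that in \<open>auto simp: sums_def\<close>)

lemma sums_add_av: "f sums (a::'c) \<Longrightarrow> g sums b \<Longrightarrow> (\<lambda>n. f n + g n) sums (a + b)"
  unfolding sums_def by (simp add: sum.distrib lim_add)

lemma sums_mult_av: "f sums (a::'c) \<Longrightarrow> (\<lambda>n. c * f n) sums (c * a)"
  unfolding sums_def by (simp add: lim_mult flip: sum_distrib_left)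

lemma sums_terms_to_0:
  assumes "f sums (s::'c)" shows "(\<lambda>n. av (f n)) \<longlonglongrightarrow> 0"
proof -
  have "(\<lambda>n. sum f {..<Suc n} - sum f {..<n}) \<longlonglongrightarrow> s - s"
    using assms unfolding sums_def by (intro lim_diff LIMSEQ_Suc)
  thus ?thesis using tendsto_av by fastforce
qed

end

section \<open>The field of Laurent series and its completed algebraic closure\<close>

text \<open>Phrased by coefficients because \<open>degree 0 = 0\<close>: this way
  \<open>small_polys 0\<close> is \<open>{0}\<close> and every \<open>small_polys n\<close> is an
  additive group of order \<open>q^n\<close>.\<close>

definition small_polys :: "nat \<Rightarrow> 'a::{field,finite} poly set" where
  "small_polys n = {a. \<forall>i\<ge>n. coeff a i = 0}"

lemma small_polys_0: "small_polys 0 = {0}"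
  by (auto simp: small_polys_def poly_eq_iff)

lemma small_polys_Suc: "small_polys (Suc n) = (\<lambda>(c, p). pCons c p) ` (UNIV \<times> small_polys n)"
proof (intro equalityI subsetI)
  fix a :: "'a poly" assume a: "a \<in> small_polys (Suc n)"
  obtain c p where ap: "a = pCons c p" by (cases a)
  have "coeff p i = 0" if "i \<ge> n" for i
    using a that unfolding small_polys_def ap by (auto dest: spec[of _ "Suc i"])
  thus "a \<in> (\<lambda>(c, p). pCons c p) ` (UNIV \<times> small_polys n)"
    by (auto simp: ap small_polys_def)
qed (auto simp: small_polys_def coeff_pCons split: nat.splits)

lemma card_small_polys: "finite (small_polys n :: 'a::{field,finite} poly set) \<and>
    card (small_polys n :: 'a poly set) = CARD('a) ^ n"
proof (induction n)
  case (Suc n)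
  have "inj_on (\<lambda>(c, p). pCons c p) (UNIV \<times> small_polys n :: ('a \<times> 'a poly) set)"
    by (auto simp: inj_on_def)
  thus ?case using Suc by (simp add: small_polys_Suc card_image card_cartesian_product)
qed (simp add: small_polys_0)

lemma finite_small_polys [simp]: "finite (small_polys n :: 'a::{field,finite} poly set)"
  using card_small_polys by blast

lemma small_polys_eq_degree: "n > 0 \<Longrightarrow> small_polys n = {a :: 'a::{field,finite} poly. degree a < n}"
proof (intro equalityI subsetI)
  fix a :: "'a poly" assume "n > 0" "a \<in> small_polys n"
  thus "a \<in> {a. degree a < n}" 
    by (cases "a = 0") (force simp: small_polys_def not_less[symmetric])+
qed (auto simp: small_polys_def coeff_eq_0)

lemma small_polys_0_mem [simp]: "0 \<in> small_polys n"
  by (simp add: small_polys_def)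

lemma small_polys_add: "a \<in> small_polys n \<Longrightarrow> b \<in> small_polys n \<Longrightarrow> a + b \<in> small_polys n"
  by (simp add: small_polys_def)

lemma small_polys_diff: "a \<in> small_polys n \<Longrightarrow> b \<in> small_polys n \<Longrightarrow> a - b \<in> small_polys n"
  by (simp add: small_polys_def)

lemma small_polys_mono: "m \<le> n \<Longrightarrow> small_polys m \<subseteq> small_polys n"
  by (auto simp: small_polys_def)

lemma mem_small_polys: "a \<in> small_polys (Suc (degree a))"
  by (simp add: small_polys_eq_degree)

text \<open>Translation by 1 permutes the field, so the sum of all elements does not change when 1
  is added to each of them.\<close>

lemma of_nat_CARD_eq_0: "of_nat CARD('a::{field,finite}) = (0::'a)"
proof -
  have "(\<Sum>x\<in>UNIV. x) = (\<Sum>x\<in>(UNIV::'a set). x + 1)"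
    by (rule sum.reindex_bij_witness[of _ "\<lambda>x. x + 1" "\<lambda>x. x - 1"]) auto
  thus ?thesis by (simp add: sum.distrib)
qed

text \<open>\<open>q\<close> is a parameter because an abbreviation for \<open>real CARD('a)\<close> would depend on the type \<open>'a\<close> only.\<close>

locale C_inf =
  fixes \<iota> :: "'a::{field,finite} fls \<Rightarrow> 'c::{field,complete_space}"
    and q :: real
  assumes C_infinity: "C_infinity \<iota>" and q_eq: "q = real CARD('a)"
begin

sublocale ultrametric_field "TYPE('c)"
  using C_infinity unfolding C_infinity_def by unfold_locales (auto simp: av_def)

abbreviation A :: "'a poly \<Rightarrow> 'c" where "A \<equiv> emb_A \<iota>"
abbreviation T :: 'c where "T \<equiv> \<iota> fls_X_inv"
abbreviation K :: "'a \<Rightarrow> 'c" where "K c \<equiv> \<iota> (fls_const c)"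

definition im :: "'c \<Rightarrow> real" where "im z = infdist z (range \<iota>)"

lemma q_gt_1: "q > 1"
proof -
  have "card {0, 1 :: 'a} \<le> CARD('a)" by (intro card_mono) auto
  thus ?thesis by (simp add: q_eq)
qed

lemma q_pos [simp]: "q > 0" using q_gt_1 by linarith

lemma q_nonneg [simp]: "q \<ge> 0" using q_gt_1 by linarith

lemma q_nonzero [simp]: "q \<noteq> 0" using q_gt_1 by linarith

lemma iota_add: "\<iota> (x + y) = \<iota> x + \<iota> y"
  and iota_mult: "\<iota> (x * y) = \<iota> x * \<iota> y"
  and iota_1 [simp]: "\<iota> 1 = 1"
  and av_iota: "x \<noteq> 0 \<Longrightarrow> av (\<iota> x) = q powi (- fls_subdegree x)"
  using C_infinity unfolding C_infinity_def by (auto simp: av_def q_eq)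

lemma iota_0 [simp]: "\<iota> 0 = 0"
proof -
  have "\<iota> 0 = \<iota> 0 + \<iota> 0" using iota_add[of 0 0] by (simp only: add_0_left)
  thus ?thesis by (simp only: add_cancel_right_right)
qed

lemma iota_minus: "\<iota> (- x) = - \<iota> x"
  by (rule minus_unique[symmetric]) (simp flip: iota_add)

lemma iota_diff: "\<iota> (x - y) = \<iota> x - \<iota> y"
  using iota_add[of x "- y"] by (simp add: iota_minus)

lemma iota_eq_0_iff [simp]: "\<iota> x = 0 \<longleftrightarrow> x = 0"
  using av_iota[of x] by (metis av_0 iota_0 power_int_eq_0_iff q_pos less_irrefl)

lemma iota_eq_iff [simp]: "\<iota> x = \<iota> y \<longleftrightarrow> x = y"
  using iota_eq_0_iff[of "x - y"] by (simp add: iota_diff)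

lemma iota_inverse: "\<iota> (inverse x) = inverse (\<iota> x)"
proof (cases "x = 0")
  case False
  have "\<iota> (inverse x) * \<iota> x = 1" using False by (simp flip: iota_mult)
  thus ?thesis using False by (simp add: field_simps)
qed simp

lemma iota_divide: "\<iota> (x / y) = \<iota> x / \<iota> y"
  by (simp add: divide_inverse iota_mult iota_inverse)

lemma iota_power: "\<iota> (x ^ n) = \<iota> x ^ n"
  by (induction n) (simp_all add: iota_mult)

lemma K_add: "K (c + d) = K c + K d"
  and K_mult: "K (c * d) = K c * K d"
  by (simp_all add: fls_plus_const flip: iota_add iota_mult)

lemma av_K: "av (K c) = (if c = 0 then 0 else 1)"
  by (simp add: av_iota)

lemma av_T: "av T = q"
  by (simp add: av_iota)

lemma A_pCons: "A (pCons c p) = K c + T * A p"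
  by (simp add: emb_A_def map_poly_pCons iota_add iota_mult)

lemma A_0 [simp]: "A 0 = 0"
  by (simp add: emb_A_def)

lemma A_const: "A [:c:] = K c"
  by (simp add: A_pCons)

lemma A_1 [simp]: "A 1 = 1"
  unfolding one_pCons by (simp add: A_const)

lemma A_add: "A (a + b) = A a + A b"
  by (induction a b rule: poly_induct2) (simp_all add: A_pCons K_add algebra_simps)

lemma A_minus: "A (- a) = - A a"
  by (rule minus_unique[symmetric]) (simp flip: A_add)

lemma A_diff: "A (a - b) = A a - A b"
  using A_add[of a "- b"] by (simp add: A_minus)

lemma A_smult: "A (smult c a) = K c * A a"
  by (induction a) (simp_all add: A_pCons K_mult algebra_simps)

lemma A_mult: "A (a * b) = A a * A b"
  by (induction a) (simp_all add: A_pCons A_add A_smult algebra_simps)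

lemma av_A: "a \<noteq> 0 \<Longrightarrow> av (A a) = q ^ degree a"
proof (induction a)
  case (pCons c p)
  show ?case
  proof (cases "p = 0")
    case True thus ?thesis using pCons by (simp add: A_const av_K)
  next
    case False
    hence eq: "av (T * A p) = q ^ Suc (degree p)" using pCons by (simp add: av_mult av_T)
    moreover have "1 < q ^ Suc (degree p)" using q_gt_1 by (rule one_less_power) simp
    hence "av (K c) < av (T * A p)" unfolding eq by (auto simp: av_K)
    ultimately show ?thesis using False av_add_eq[of "K c" "T * A p"] by (simp add: A_pCons add.commute)
  qed
qed simp

lemma A_eq_0_iff [simp]: "A a = 0 \<longleftrightarrow> a = 0"
  using av_A[of a] by (metis A_0 av_0 power_eq_0_iff q_pos less_irrefl)

lemma A_eq_iff [simp]: "A a = A b \<longleftrightarrow> a = b"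
  using A_eq_0_iff[of "a - b"] by (simp add: A_diff)

lemma av_A_ge_1: "a \<noteq> 0 \<Longrightarrow> 1 \<le> av (A a)"
  using q_gt_1 by (simp add: av_A)

lemma of_nat_CARD_C: "of_nat CARD('a) = (0::'c)"
proof -
  have "\<iota> (of_nat n) = of_nat n" for n
    by (induction n) (simp_all add: iota_add)
  hence "(of_nat CARD('a) :: 'c) = \<iota> (fls_const (of_nat CARD('a)))"
    by (metis fls_of_nat)
  thus ?thesis by (simp add: of_nat_CARD_eq_0)
qed

lemma finite_A_ball: "\<exists>n. {a. av (A a) \<le> B} \<subseteq> small_polys n"
proof -
  obtain n where n: "B < q ^ n" using real_arch_pow[OF q_gt_1] by blast
  have "a \<in> small_polys n" if "av (A a) \<le> B" for a
  proof (cases "a = 0")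
    case False
    hence "q ^ degree a < q ^ n" using n that by (simp add: av_A)
    hence "degree a < n" using q_gt_1 by (simp add: power_strict_increasing_iff)
    thus ?thesis by (auto simp: small_polys_def coeff_eq_0)
  qed simp
  thus ?thesis by blast
qed

lemma le_im_iff: "R \<le> im z \<longleftrightarrow> (\<forall>x. R \<le> av (z - \<iota> x))"
proof
  assume "R \<le> im z"
  thus "\<forall>x. R \<le> av (z - \<iota> x)"
    using infdist_le[OF rangeI, of z \<iota>] unfolding im_def dist_av by (meson order_trans)
next
  assume "\<forall>x. R \<le> av (z - \<iota> x)"
  thus "R \<le> im z" unfolding im_def
    by (subst infdist_notempty) (auto intro!: cINF_greatest simp: dist_av)
qed

lemma im_le: "im z \<le> av (z - \<iota> x)"
  using le_im_iff[of "im z" z] by blast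

lemma im_le_av: "im z \<le> av z"
  using im_le[of z 0] by simp

lemma im_nonneg [simp]: "0 \<le> im z" by (simp add: le_im_iff)

lemma im_add_iota [simp]: "im (z + \<iota> x) = im z"
proof (intro antisym)
  have *: "im z \<le> im (z + \<iota> x)" for z x
    unfolding le_im_iff using im_le[of z] by (metis (no_types) add_diff_eq diff_diff_eq2 iota_diff)
  show "im z \<le> im (z + \<iota> x)" by (rule *)
  show "im (z + \<iota> x) \<le> im z" using *[of "z + \<iota> x" "- x"] by (simp add: iota_minus)
qed

lemma im_mult_iota: "im (\<iota> x * z) = av (\<iota> x) * im z"
proof (cases "x = 0")
  case True
  thus ?thesis using im_le_av[of 0] by (simp add: order_antisym)
next
  case False
  have *: "av (\<iota> x) * im z \<le> im (\<iota> x * z)" if "x \<noteq> 0" for x z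
  proof -
    have "av (\<iota> x) * im z \<le> av (\<iota> x * z - \<iota> y)" for y
    proof -
      have "\<iota> x * z - \<iota> y = \<iota> x * (z - \<iota> (y / x))" using that by (simp add: iota_divide field_simps)
      thus ?thesis by (simp add: av_mult mult_left_mono im_le)
    qed
    thus ?thesis by (simp add: le_im_iff)
  qed
  have "av (\<iota> (inverse x)) * im (\<iota> x * z) \<le> im z"
    using *[of "inverse x" "\<iota> x * z"] False by (simp add: iota_inverse flip: mult.assoc)
  hence "im (\<iota> x * z) \<le> av (\<iota> x) * im z"
    using False by (simp add: iota_inverse av_inverse inverse_eq_divide[of "av _"] pos_divide_le_eq mult.commute)
  with *[OF False, of z] show ?thesis by simp
qed

lemma im_add_A [simp]: "im (z + A b) = im z"
  by (simp add: emb_A_def)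

lemma im_mult_A: "im (A a * z) = av (A a) * im z"
  by (simp add: emb_A_def im_mult_iota)

lemma im_divide_A: "a \<noteq> 0 \<Longrightarrow> im (z / A a) = im z / av (A a)"
  using im_mult_A[of a "z / A a"] by (simp add: field_simps)

lemma in_Omega_if_im_pos: "im z > 0 \<Longrightarrow> z \<in> Omega \<iota>"
  unfolding Omega_def im_def by (auto dest!: infdist_zero)

text \<open>Removing the coefficient of \<open>T^n\<close> lowers the pole order; once only positive
  powers of \<open>1/T\<close> are left, 0 is a good approximation.\<close>

lemma iota_approx: "\<exists>a. av (\<iota> x - A a) < 1"
proof -
  have "\<exists>a. av (\<iota> x - A a) < 1" if "x \<noteq> 0 \<longrightarrow> - fls_subdegree x < int n" for n
    using that
  proof (induction n arbitrary: x)
    case 0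
    show ?case
    proof (cases "x = 0")
      case False
      hence "av (\<iota> x) = inverse q ^ nat (fls_subdegree x)" and "fls_subdegree x > 0"
        using 0 by (auto simp: av_iota power_int_def)
      hence "av (\<iota> x) < 1" using q_gt_1 by (simp add: power_less_one_iff inverse_less_1_iff)
      thus ?thesis by (intro exI[of _ 0]) simp
    qed (intro exI[of _ 0], simp)
  next
    case (Suc n)
    define c where "c = fls_nth x (- int n)"
    define y where "y = x - fls_const c * fls_X_inv ^ n"
    have "- fls_subdegree y < int n" if "y \<noteq> 0"
    proof -
      have "fls_nth y k = 0" if "k \<le> - int n" for k
      proof (cases "k = - int n")
        case True thus ?thesis by (simp add: y_def c_def)
      next
        case False
        hence "fls_nth x k = 0" using that Suc.prems by (cases "x = 0") (auto intro!: fls_eq0_below_subdegree)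
        thus ?thesis using False by (simp add: y_def)
      qed
      hence "fls_subdegree y > - int n" using that by (intro fls_subdegree_greaterI) auto
      thus ?thesis by simp
    qed
    then obtain a where a: "av (\<iota> y - A a) < 1" using Suc.IH by blast
    have "A (monom c n) = K c * T ^ n"
      by (simp add: emb_A_def map_poly_monom poly_monom iota_mult iota_power)
    hence "\<iota> x - A (a + monom c n) = \<iota> y - A a"
      by (simp add: y_def iota_diff iota_mult iota_power A_add)
    with a show ?case by metis
  qed
  from this[of "Suc (nat (- fls_subdegree x))"] show ?thesis by simp
qed

text \<open>Only finitely many \<open>b\<close> have \<open>av (A b) \<le> av z\<close>; any other
  has distance \<open>av (A b) > av z\<close> and loses to \<open>b = 0\<close>.\<close>

lemma closest_A: "\<exists>b. \<forall>b'. av (z - A b) \<le> av (z - A b')"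
proof -
  obtain n where n: "{a. av (A a) \<le> av z} \<subseteq> small_polys n" using finite_A_ball by blast
  define b where "b = arg_min_on (\<lambda>b. av (z - A b)) (small_polys n)"
  have b: "av (z - A b) \<le> av (z - A b')" if "b' \<in> small_polys n" for b'
    unfolding b_def by (rule arg_min_least) (use that in auto)
  have "av (z - A b) \<le> av (z - A b')" for b'
  proof (cases "b' \<in> small_polys n")
    case False
    hence "av z < av (A b')" using n by force
    hence "av (z - A b') = av (A b')" by (rule av_diff_eq')
    thus ?thesis using b[of 0] \<open>av z < av (A b')\<close> by simp
  qed (use b in auto)
  thus ?thesis by blast
qed

text \<open>After scaling by \<open>T^j\<close> the distance exceeds 1. Rounding an element of the
  image of \<open>\<iota>\<close> to a polynomial moves it by less than 1 and so keeps its distance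
  to \<open>w\<close>; a closest polynomial is therefore a closest point.\<close>

lemma closest_range:
  assumes "im z > 0" shows "\<exists>x. av (z - \<iota> x) = im z"
proof -
  obtain j where j: "inverse (im z) < q ^ j" using real_arch_pow[OF q_gt_1] by blast
  define w where "w = T ^ j * z"
  have wj: "T ^ j = \<iota> (fls_X_inv ^ j)" by (simp add: iota_power)
  have imw: "im w = q ^ j * im z" 
    using im_mult_iota[of "fls_X_inv ^ j" z] by (simp add: w_def iota_power av_T)
  hence imw1: "im w > 1" using j assms by (simp add: field_simps)
  obtain b where b: "\<And>b'. av (w - A b) \<le> av (w - A b')" using closest_A by blast
  have "av (w - A b) \<le> av (w - \<iota> y)" for y
  proof -
    obtain b' where b': "av (\<iota> y - A b') < 1" using iota_approx by blast
    have "av (w - \<iota> y) > 1" using im_le[of w y] imw1 by simp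
    hence "av (\<iota> y - A b') < av (w - \<iota> y)" using b' by linarith
    from av_add_eq[OF this] have "av (w - A b') = av (w - \<iota> y)" by simp
    thus ?thesis using b[of b'] by simp
  qed
  hence "av (w - A b) \<le> im w" by (simp add: le_im_iff)
  moreover obtain y where y: "A b = \<iota> y" by (auto simp: emb_A_def)
  ultimately have eq: "av (w - \<iota> y) = im w" using im_le[of w y] by simp
  have "w - \<iota> y = T ^ j * (z - \<iota> (y / fls_X_inv ^ j))"
    unfolding w_def using iota_divide[of y "fls_X_inv ^ j"] by (simp add: iota_power right_diff_distrib)
  hence "q ^ j * av (z - \<iota> (y / fls_X_inv ^ j)) = q ^ j * im z"
    using eq imw by (simp add: av_mult av_T)
  thus ?thesis by (intro exI[of _ "y / fls_X_inv ^ j"]) simp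
qed

lemma av_iota_less_imp_subdegree: "av (\<iota> x) < inverse (q ^ n) \<Longrightarrow> x \<noteq> 0 \<Longrightarrow> fls_subdegree x > int n"
proof (rule ccontr)
  assume *: "av (\<iota> x) < inverse (q ^ n)" "x \<noteq> 0" "\<not> fls_subdegree x > int n"
  have "q powi (- int n) \<le> q powi (- fls_subdegree x)"
    using * q_gt_1 by (intro power_int_increasing) auto
  thus False using * by (simp add: av_iota power_int_minus)
qed

lemma av_iota_le_of_subdegree: "(x \<noteq> 0 \<Longrightarrow> fls_subdegree x \<ge> int n) \<Longrightarrow> av (\<iota> x) \<le> inverse (q ^ n)"
proof (cases "x = 0")
  case False
  assume "x \<noteq> 0 \<Longrightarrow> fls_subdegree x \<ge> int n"
  hence "q powi (- fls_subdegree x) \<le> q powi (- int n)"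
    using False q_gt_1 by (intro power_int_increasing) auto
  thus ?thesis using False by (simp add: av_iota power_int_minus)
qed simp

lemma inverse_q_power_to_0: "(\<lambda>n. inverse (q ^ n)) \<longlonglongrightarrow> 0"
  using LIMSEQ_inverse_realpow_zero[OF q_gt_1] .

text \<open>The image of \<open>\<iota>\<close> is closed: approximations with error below
  \<open>q^-n\<close> share their coefficients up to index \<open>n\<close>, and the series of these
  common coefficients is the limit.\<close>

lemma im_pos_of_Omega:
  assumes "z \<in> Omega \<iota>" shows "im z > 0"
proof (rule ccontr)
  assume "\<not> im z > 0"
  hence im0: "im z = 0" using im_nonneg[of z] by linarith
  have "\<exists>x. av (z - \<iota> x) < inverse (q ^ n)" for n
    using le_im_iff[of "inverse (q ^ n)" z] im0 q_pos by (metis inverse_positive_iff_positive not_less zero_less_power)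
  then obtain x where x: "\<And>n. av (z - \<iota> (x n)) < inverse (q ^ n)" by metis
  have xx: "fls_nth (x m) k = fls_nth (x n) k" if "m \<le> n" "k \<le> int m" for m n k
  proof (cases "x m = x n")
    case False
    have "inverse (q ^ n) \<le> inverse (q ^ m)" using that q_gt_1 by (simp add: power_increasing)
    hence "av (z - \<iota> (x n)) < inverse (q ^ m)" using x[of n] by linarith
    hence "av (\<iota> (x m - x n)) < inverse (q ^ m)"
      using av_diff_lt[OF _ x[of m], of "z - \<iota> (x n)"] by (simp add: iota_diff)
    hence "fls_subdegree (x m - x n) > int m" using False by (intro av_iota_less_imp_subdegree) auto
    hence "fls_nth (x m - x n) k = 0" using that by (intro fls_eq0_below_subdegree) auto
    thus ?thesis by simp
  qed simp
  \<comment> \<open>For negative \<open>k\<close> the index \<open>nat k\<close> is 0, which is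
    precise enough: every \<open>x n\<close> agrees with \<open>x 0\<close> at indices up to
    0.\<close>
  define y where "y = Abs_fls (\<lambda>k. fls_nth (x (nat k)) k)"
  have "fls_nth y k = fls_nth (x (nat k)) k" for k
    unfolding y_def
  proof (rule nth_Abs_fls_lower_bound)
    show "\<forall>k<min 0 (fls_subdegree (x 0)). fls_nth (x (nat k)) k = 0" by auto
  qed
  hence yx: "fls_nth y k = fls_nth (x n) k" if "k \<le> int n" for k n
    using that xx[of "nat k" n k] by (cases "k \<ge> 0") auto
  have "av (z - \<iota> y) \<le> inverse (q ^ n)" for n
  proof -
    have "fls_subdegree (x n - y) \<ge> int n" if "x n - y \<noteq> 0"
      using that by (intro fls_subdegree_geI) (auto simp: yx[of _ n])
    hence "av (\<iota> (x n - y)) \<le> inverse (q ^ n)" by (rule av_iota_le_of_subdegree)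
    from av_add_le[OF less_imp_le[OF x[of n]] this] show ?thesis by (simp add: iota_diff)
  qed
  hence "av (z - \<iota> y) \<le> 0"
    using LIMSEQ_le_const[OF inverse_q_power_to_0] by blast
  hence "z = \<iota> y" using av_nonneg[of "z - \<iota> y"] by (simp add: order_antisym_conv)
  thus False using assms by (auto simp: Omega_def)
qed

lemma Omega_iff_im: "z \<in> Omega \<iota> \<longleftrightarrow> im z > 0"
  using im_pos_of_Omega in_Omega_if_im_pos by blast

lemma alg_root_exists:
  assumes "degree p > 0" "\<And>i. coeff p i \<in> algebraic_part \<iota>"
  shows "\<exists>y. poly p y = 0"
proof -
  have "\<forall>p. degree p > 0 \<longrightarrow> (\<forall>i. coeff p i \<in> algebraic_part \<iota>) \<longrightarrow>
        (\<exists>y\<in>algebraic_part \<iota>. poly p y = 0)"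
    using C_infinity unfolding C_infinity_def by (elim conjE)
  thus ?thesis using assms by blast
qed

lemma algebraic_part_iota [simp]: "\<iota> x \<in> algebraic_part \<iota>"
  unfolding algebraic_part_def
  by (intro CollectI exI[of _ "[:-x, 1:]"]) (simp add: map_poly_pCons iota_minus)

lemma nth_root_exists:
  assumes "n > 0" shows "\<exists>y. y ^ n = \<iota> x"
proof -
  define p where "p = monom (1::'c) n - [:\<iota> x:]"
  have "coeff p n \<noteq> 0" using assms by (simp add: p_def coeff_pCons split: nat.splits)
  hence "degree p > 0" using assms le_degree[of p n] by simp
  moreover have "coeff p i \<in> algebraic_part \<iota>" for i
  proof -
    have "coeff p i = \<iota> (coeff (monom 1 n - [:x:]) i)"
      by (auto simp: p_def coeff_pCons iota_diff iota_minus split: nat.splits)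
    thus ?thesis by simp
  qed
  ultimately obtain y where "poly p y = 0" using alg_root_exists by blast
  thus ?thesis by (intro exI[of _ y]) (simp add: p_def poly_monom)
qed

text \<open>A square root of \<open>T\<close> has absolute value \<open>q^(1/2)\<close>, which no
  element of the image of \<open>\<iota>\<close> attains, so nothing cancels in
  \<open>y - \<iota> x\<close>. Multiplication by powers of \<open>T\<close> then scales
  \<open>im\<close>.\<close>

lemma im_unbounded: "\<exists>z. im z \<ge> R"
proof -
  obtain y where y: "y ^ 2 = T" using nth_root_exists[of 2 fls_X_inv] by auto
  have avy: "av y ^ 2 = q" using y av_T by (metis av_power)
  have "1 \<le> av (y - \<iota> x)" for x
  proof -
    have "av y \<noteq> av (\<iota> x)"
    proof
      assume eq: "av y = av (\<iota> x)"
      hence "x \<noteq> 0" using avy q_pos by auto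
      hence "q powi (- fls_subdegree x * 2) = q powi 1"
        using eq avy by (simp add: av_iota power_int_mult[of q "- fls_subdegree x" 2] power_int_numeral del: mult_minus_left)
      moreover have "- fls_subdegree x * 2 < 1 \<or> - fls_subdegree x * 2 > 1" by presburger
      ultimately show False
        using power_int_strict_increasing[of _ _ q] q_gt_1 by (metis less_irrefl)
    qed
    hence "av (y - \<iota> x) = max (av y) (av (\<iota> x))" by (rule av_diff_neq)
    moreover have "1 < av y"
      using avy q_gt_1 by (metis av_nonneg power_le_one not_le)
    ultimately show ?thesis by simp
  qed
  hence imy: "1 \<le> im y" by (simp add: le_im_iff)
  obtain j where "R < q ^ j" using real_arch_pow[OF q_gt_1] by blast
  moreover have "im (A (monom 1 j) * y) = q ^ j * im y"
    by (simp add: im_mult_A av_A degree_monom_eq)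
  moreover have "q ^ j * 1 \<le> q ^ j * im y" using imy by (intro mult_left_mono) auto
  ultimately show ?thesis by (intro exI[of _ "A (monom 1 j) * y"]) linarith
qed

lemma has_t_expansion_iff:
  "has_t_expansion \<iota> per f F \<longleftrightarrow> (\<exists>R>0. \<forall>z. im z \<ge> R \<longrightarrow> (\<lambda>i. fps_nth F i * t_par \<iota> per z ^ i) sums f z)"
  by (simp add: has_t_expansion_def im_def)

end

section \<open>Finite additive subgroups and Goss polynomials\<close>

definition finite_subgroup :: "'b::field set \<Rightarrow> bool" where
  "finite_subgroup L \<longleftrightarrow> finite L \<and> 0 \<in> L \<and> (\<forall>x\<in>L. \<forall>y\<in>L. x - y \<in> L)"

definition root_poly :: "'b::field set \<Rightarrow> 'b poly" where
  "root_poly L = (\<Prod>l\<in>L. [:-l, 1:])"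

lemma poly_root_poly: "poly (root_poly L) x = (\<Prod>l\<in>L. x - l)"
  by (simp add: root_poly_def poly_prod)

lemma poly_root_poly_eq_0_iff: "finite L \<Longrightarrow> poly (root_poly L) x = 0 \<longleftrightarrow> x \<in> L"
  by (auto simp: poly_root_poly)

lemma degree_root_poly: "degree (root_poly L) = card L"
  and lead_coeff_root_poly: "coeff (root_poly L) (card L) = 1"
proof -
  show deg: "degree (root_poly L) = card L"
    unfolding root_poly_def by (subst degree_prod_eq_sum_degree) auto
  have "lead_coeff (root_poly L) = 1"
    unfolding root_poly_def by (simp add: lead_coeff_prod)
  thus "coeff (root_poly L) (card L) = 1" by (simp add: deg)
qed

lemma root_poly_eqI:
  assumes "finite L" "degree p = card L" "lead_coeff p = 1" "\<And>l. l \<in> L \<Longrightarrow> poly p l = 0"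
  shows "p = root_poly L"
  by (rule poly_eqI_degree_lead_coeff[of _ "card L" _ L])
     (use assms in \<open>auto simp: degree_root_poly lead_coeff_root_poly poly_root_poly_eq_0_iff\<close>)

lemma finite_subgroup_reindex:
  assumes "finite_subgroup L" "l \<in> L"
  shows "bij_betw (\<lambda>m. m - l) L L" "bij_betw (\<lambda>m. l - m) L L"
proof -
  have [simp]: "- x \<in> L" if "x \<in> L" for x
    using assms that unfolding finite_subgroup_def by (metis diff_0)
  have [simp]: "x + y \<in> L" if "x \<in> L" "y \<in> L" for x y
    using assms that \<open>\<And>x. x \<in> L \<Longrightarrow> - x \<in> L\<close> unfolding finite_subgroup_def by (metis diff_minus_eq_add)
  show "bij_betw (\<lambda>m. m - l) L L"
    by (rule bij_betwI[of _ _ _ "\<lambda>m. m + l"]) (use assms in \<open>auto simp: finite_subgroup_def\<close>)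
  show "bij_betw (\<lambda>m. l - m) L L"
    by (rule bij_betwI[of _ _ _ "\<lambda>m. l - m"]) (use assms in \<open>auto simp: finite_subgroup_def\<close>)
qed

lemma root_poly_translate:
  assumes "finite_subgroup L" "l \<in> L" shows "poly (root_poly L) (x - l) = poly (root_poly L) x"
proof -
  have "-l \<in> L" using assms unfolding finite_subgroup_def by (metis diff_0)
  from prod.reindex_bij_betw[OF finite_subgroup_reindex(1)[OF assms(1) this], of "\<lambda>m. x - m"]
  show ?thesis by (simp add: poly_root_poly algebra_simps)
qed

text \<open>As polynomials in \<open>x\<close>, both sides are monic of degree \<open>card L\<close>
  and agree at the \<open>card L\<close> points of \<open>L\<close>.\<close>

lemma root_poly_add:
  assumes L: "finite_subgroup L"
  shows "poly (root_poly L) (x + y) = poly (root_poly L) x + poly (root_poly L) y"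
proof -
  let ?P = "root_poly L"
  have fin: "finite L" and 0: "0 \<in> L" using L by (auto simp: finite_subgroup_def)
  define Q where "Q = ?P \<circ>\<^sub>p [:y, 1:]"
  define R where "R = ?P + [:poly ?P y:]"
  have card: "card L > 0" using fin 0 by (auto simp: card_gt_0_iff)
  have degQ: "degree Q = card L"
    unfolding Q_def by (simp add: degree_pcompose degree_root_poly)
  have "lead_coeff Q = 1"
    unfolding Q_def by (subst lead_coeff_comp) (simp_all add: degree_root_poly lead_coeff_root_poly)
  hence lcQ: "coeff Q (card L) = 1" by (simp add: degQ)
  have degR: "degree R = card L" unfolding R_def using card
    by (subst degree_add_eq_left) (auto simp: degree_root_poly)
  have lcR: "coeff R (card L) = 1" unfolding R_def using card
    by (auto simp: coeff_pCons lead_coeff_root_poly split: nat.splits)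
  have "Q = R"
  proof (rule poly_eqI_degree_lead_coeff[of _ "card L" _ L])
    fix l assume l: "l \<in> L"
    have "-l \<in> L" using L l unfolding finite_subgroup_def by (metis diff_0)
    from root_poly_translate[OF L this, of y] have "poly ?P (l + y) = poly ?P y"
      by (simp add: add.commute)
    thus "poly Q l = poly R l" using l fin
      by (simp add: Q_def R_def poly_pcompose poly_root_poly_eq_0_iff add.commute)
  qed (use lcQ degQ degR lcR in auto)
  hence "poly Q x = poly R x" by simp
  thus ?thesis by (simp add: Q_def R_def poly_pcompose add.commute)
qed

text \<open>By Lagrange interpolation of \<open>(x - X)\<^sup>i\<close> at the points of \<open>L\<close>: at each of them the
  derivative of \<open>root_poly L\<close> has the same value \<open>\<kappa>\<close>.\<close>

lemma finite_subgroup_power_sums: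
  assumes L: "finite_subgroup L"
  obtains k where "\<And>x i. Suc i < card L \<Longrightarrow> (\<Sum>l\<in>L. (x - l) ^ i) = 0"
    "\<And>x. (\<Sum>l\<in>L. (x - l) ^ (card L - 1)) = k"
proof -
  have fin: "finite L" and 0: "0 \<in> L" using L by (auto simp: finite_subgroup_def)
  have card: "card L > 0" using fin 0 by (auto simp: card_gt_0_iff)
  define \<kappa> where "\<kappa> = (\<Prod>m\<in>L-{0}. m)"
  have \<kappa>: "\<kappa> \<noteq> 0" using fin by (simp add: \<kappa>_def)
  define B where "B l = root_poly (L - {l})" for l
  have Bl: "poly (B l) l = \<kappa>" if "l \<in> L" for l
  proof -
    have "bij_betw (\<lambda>m. l - m) (L - {0}) (L - {l - 0})"
      by (rule bij_betw_DiffI[OF finite_subgroup_reindex(2)[OF L that]]) (use 0 that in auto)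
    from prod.reindex_bij_betw[OF this, of "\<lambda>m. l - m"] show ?thesis
      by (simp add: B_def poly_root_poly \<kappa>_def)
  qed
  have Bl0: "poly (B l) m = 0" if "m \<in> L" "m \<noteq> l" for l m
    using that fin by (simp add: B_def poly_root_poly_eq_0_iff)
  have cardl: "card (L - {l}) = card L - 1" if "l \<in> L" for l using that fin by simp
  \<comment> \<open>Each \<open>B l\<close> is monic of degree \<open>card L - 1\<close> and
    vanishes on \<open>L\<close> except at \<open>l\<close>, so interpolation recovers
    \<open>r\<close>; comparing top coefficients gives the formula.\<close>
  have main: "(\<Sum>l\<in>L. poly r l) = \<kappa> * coeff r (card L - 1)" if r: "degree r < card L" for r
  proof -
    define R where "R = (\<Sum>l\<in>L. smult (poly r l / \<kappa>) (B l))"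
    have "R = r"
    proof (rule poly_eqI_degree[of L])
      fix m assume m: "m \<in> L"
      have "poly R m = (\<Sum>l\<in>L. if l = m then poly r m else 0)"
        unfolding R_def poly_sum by (rule sum.cong) (use m \<kappa> in \<open>auto simp: Bl Bl0\<close>)
      thus "poly R m = poly r m" using m fin by simp
    next
      have "degree R \<le> card L - 1" unfolding R_def
        by (intro degree_sum_le fin order_trans[OF degree_smult_le])
           (auto simp: B_def degree_root_poly cardl)
      thus "degree R < card L" using card by linarith
    qed (use r in auto)
    moreover have "coeff R (card L - 1) = (\<Sum>l\<in>L. poly r l / \<kappa> * coeff (B l) (card L - 1))"
      by (simp add: R_def coeff_sum)
    ultimately have "coeff r (card L - 1) = (\<Sum>l\<in>L. poly r l / \<kappa> * coeff (B l) (card L - 1))"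
      by simp
    also have "\<dots> = (\<Sum>l\<in>L. poly r l / \<kappa>)"
      proof (rule sum.cong)
      fix l assume "l \<in> L"
      hence "coeff (B l) (card L - 1) = 1" using lead_coeff_root_poly[of "L - {l}"] by (simp add: B_def cardl)
      thus "poly r l / \<kappa> * coeff (B l) (card L - 1) = poly r l / \<kappa>" by simp
    qed simp
    finally show ?thesis using \<kappa> by (simp flip: sum_divide_distrib)
  qed
  have deg: "degree ([:x, -1:] ^ i) = i" for i and x :: 'a
    by (simp add: degree_power_eq)
  have eval: "poly ([:x, -1:] ^ i) l = (x - l) ^ i" for i and x l :: 'a
    by (simp add: poly_power)
  have "(\<Sum>l\<in>L. (x - l) ^ i) = 0" if "Suc i < card L" for x i
    using main[of "[:x, -1:] ^ i"] that by (simp add: deg eval coeff_eq_0)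
  moreover have "(\<Sum>l\<in>L. (x - l) ^ (card L - 1)) = \<kappa> * (-1) ^ (card L - 1)" for x
  proof -
    have "lead_coeff ([:x, -1:] ^ (card L - 1)) = (-1) ^ (card L - 1)"
      by (subst lead_coeff_power) simp
    thus ?thesis using main[of "[:x, -1:] ^ (card L - 1)"] card by (simp add: deg eval)
  qed
  ultimately show ?thesis using that by blast
qed

text \<open>The key point is \<open>poly (root_poly L) x = poly (root_poly L) (x - l)\<close>; expanding the right-hand
  side in powers of \<open>x - l\<close>, the nonnegative power sums vanish.\<close>

lemma finite_subgroup_reciprocal_sums:
  assumes L: "finite_subgroup L"
  obtains k where
    "\<And>x. x \<notin> L \<Longrightarrow> poly (root_poly L) x * (\<Sum>l\<in>L. 1 / (x - l)) = k"
    "\<And>x n. x \<notin> L \<Longrightarrow> 2 \<le> n \<Longrightarrow> poly (root_poly L) x * (\<Sum>l\<in>L. 1 / (x - l) ^ n) =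
       (\<Sum>j=1..<n. coeff (root_poly L) j * (\<Sum>l\<in>L. 1 / (x - l) ^ (n - j)))"
proof -
  let ?P = "root_poly L"
  have fin: "finite L" and 0: "0 \<in> L" using L by (auto simp: finite_subgroup_def)
  have card: "card L > 0" using fin 0 by (auto simp: card_gt_0_iff)
  obtain k where k: "\<And>x i. Suc i < card L \<Longrightarrow> (\<Sum>l\<in>L. (x - l) ^ i) = 0"
    "\<And>x. (\<Sum>l\<in>L. (x - l) ^ (card L - 1)) = k"
    using finite_subgroup_power_sums[OF L] by blast
  have "poly ?P 0 = 0" using fin 0 by (simp add: poly_root_poly_eq_0_iff)
  hence c0: "coeff ?P 0 = 0" by (simp add: poly_0_coeff_0)
  have expand: "poly ?P x * (\<Sum>l\<in>L. 1 / (x - l) ^ n) =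
     (\<Sum>j=1..<n. coeff ?P j * (\<Sum>l\<in>L. 1 / (x - l) ^ (n - j))) +
     (\<Sum>j=n..card L. coeff ?P j * (\<Sum>l\<in>L. (x - l) ^ (j - n)))" if x: "x \<notin> L" and n: "n \<ge> 1" for x n
  proof -
    have nz: "x - l \<noteq> 0" if "l \<in> L" for l using x that by auto
    define g where "g j = coeff ?P j * (\<Sum>l\<in>L. (x - l) ^ j / (x - l) ^ n)" for j
    have "poly ?P x * (\<Sum>l\<in>L. 1 / (x - l) ^ n) = (\<Sum>l\<in>L. poly ?P (x - l) / (x - l) ^ n)"
      by (simp add: sum_distrib_left root_poly_translate[OF L])
    also have "\<dots> = (\<Sum>l\<in>L. \<Sum>j\<le>card L. coeff ?P j * (x - l) ^ j / (x - l) ^ n)"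
      by (simp add: poly_altdef degree_root_poly sum_divide_distrib)
    also have "\<dots> = (\<Sum>j\<le>card L. g j)"
      by (subst sum.swap) (simp add: g_def sum_distrib_left)
    also have "\<dots> = (\<Sum>j\<in>{1..<n} \<union> {n..card L}. g j)"
    proof (rule sum.mono_neutral_cong)
      fix j assume "j \<in> {1..<n} \<union> {n..card L} - {..card L}"
      thus "g j = 0" by (auto simp: g_def coeff_eq_0 degree_root_poly)
    next
      fix j assume "j \<in> {..card L} - ({1..<n} \<union> {n..card L})"
      hence "j = 0" using n by auto
      thus "g j = 0" using c0 by (simp add: g_def)
    qed auto
    also have "\<dots> = (\<Sum>j=1..<n. g j) + (\<Sum>j=n..card L. g j)"
      by (rule sum.union_disjoint) auto
    also have "(\<Sum>j=1..<n. g j) = (\<Sum>j=1..<n. coeff ?P j * (\<Sum>l\<in>L. 1 / (x - l) ^ (n - j)))"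
    proof (intro sum.cong refl, unfold g_def, intro arg_cong2[of _ _ _ _ "(*)"] sum.cong refl)
      fix j l assume "j \<in> {1..<n}" "l \<in> L"
      thus "(x - l) ^ j / (x - l) ^ n = 1 / (x - l) ^ (n - j)"
        using nz by (simp add: power_diff field_simps)
    qed
    also have "(\<Sum>j=n..card L. g j) = (\<Sum>j=n..card L. coeff ?P j * (\<Sum>l\<in>L. (x - l) ^ (j - n)))"
    proof (intro sum.cong refl, unfold g_def, intro arg_cong2[of _ _ _ _ "(*)"] sum.cong refl)
      fix j l assume "j \<in> {n..card L}" "l \<in> L"
      thus "(x - l) ^ j / (x - l) ^ n = (x - l) ^ (j - n)"
        using nz by (simp add: power_diff)
    qed
    finally show ?thesis .
  qed
  have "poly ?P x * (\<Sum>l\<in>L. 1 / (x - l)) = k" if "x \<notin> L" for x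
  proof -
    have "poly ?P x * (\<Sum>l\<in>L. 1 / (x - l)) = (\<Sum>j=1..card L. coeff ?P j * (\<Sum>l\<in>L. (x - l) ^ (j - 1)))"
      using expand[OF that, of 1] by simp
    also have "\<dots> = (\<Sum>j\<in>{card L}. coeff ?P j * (\<Sum>l\<in>L. (x - l) ^ (j - 1)))"
      by (rule sum.mono_neutral_right) (use card k(1) in auto)
    finally show ?thesis using k(2) by (simp add: lead_coeff_root_poly)
  qed
  moreover have "poly ?P x * (\<Sum>l\<in>L. 1 / (x - l) ^ n) =
       (\<Sum>j=1..<n. coeff ?P j * (\<Sum>l\<in>L. 1 / (x - l) ^ (n - j)))" if "x \<notin> L" "2 \<le> n" for x n
  proof -
    have "(\<Sum>j=n..card L. coeff ?P j * (\<Sum>l\<in>L. (x - l) ^ (j - n))) = 0"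
      by (rule sum.neutral) (use that k(1) in auto)
    thus ?thesis using expand[OF that(1), of n] that(2) by simp
  qed
  ultimately show ?thesis using that by blast
qed

text \<open>With the range of summation as a premise, the termination proof of
  \<open>goss_rec\<close> knows \<open>1 \<le> j\<close>, hence \<open>n - j < n\<close>.\<close>

declare sum.cong [fundef_cong]

text \<open>The recursion of Goss polynomials: \<open>\<epsilon>\<close> lists the coefficients of
  the additive function whose zero set is the lattice, and \<open>k\<close> is its product with the
  sum of reciprocals. Arbitrary \<open>\<epsilon>\<close> and \<open>k\<close> let it serve both the
  period lattice and the torsion of the Carlitz module. The value 0 at \<open>n = 0\<close> fits the
  torsion, whose zeroth power sum is its cardinality, zero in \<open>'c\<close>.\<close>

fun goss_rec :: "(nat \<Rightarrow> 'b::field) \<Rightarrow> 'b \<Rightarrow> nat \<Rightarrow> 'b poly" where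
  "goss_rec \<epsilon> k n = (if n = 0 then 0 else if n = 1 then [:0, k:]
     else pCons 0 (\<Sum>j\<in>{1..<n}. smult (\<epsilon> j) (goss_rec \<epsilon> k (n - j))))"

declare goss_rec.simps [simp del]

lemma goss_rec_0: "goss_rec \<epsilon> k 0 = 0"
  by (simp add: goss_rec.simps)

lemma poly_goss_rec_unique:
  assumes "s 1 = t * k" "\<And>n. 2 \<le> n \<Longrightarrow> s n = t * (\<Sum>j=1..<n. \<epsilon> j * s (n - j))" "n > 0"
  shows "s n = poly (goss_rec \<epsilon> k n) t"
  using assms(3)
proof (induction n rule: less_induct)
  case (less n)
  show ?case
  proof (cases "n = 1")
    case False
    hence "s n = t * (\<Sum>j=1..<n. \<epsilon> j * poly (goss_rec \<epsilon> k (n - j)) t)"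
      using less assms(2)[of n] by simp
    thus ?thesis using False less.prems by (simp add: goss_rec.simps[of \<epsilon> k n] poly_sum)
  qed (use assms(1) in \<open>simp add: goss_rec.simps\<close>)
qed

text \<open>Each factor \<open>X\<close> in the recursion lowers the index by at most
  \<open>M\<close>, so a term of degree \<open>m\<close> comes from an index at most
  \<open>m * M\<close>. For the torsion this makes the trace meaningful on formal power
  series.\<close>

lemma coeff_goss_rec_low:
  assumes "M > 0" "\<And>j. j > M \<Longrightarrow> \<epsilon> j = 0" "m * M < n"
  shows "coeff (goss_rec \<epsilon> k n) m = 0"
  using assms(3)
proof (induction n arbitrary: m rule: less_induct)
  case (less n)
  show ?case
  proof (cases m)
    case (Suc m')
    have "\<epsilon> j * coeff (goss_rec \<epsilon> k (n - j)) m' = 0" if "j \<in> {1..<n}" for j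
    proof (cases "j > M")
      case False
      hence "m' * M < n - j" using less.prems Suc that by auto
      thus ?thesis using less.IH[of "n - j" m'] that by simp
    qed (use assms in auto)
    hence "(\<Sum>j=1..<n. \<epsilon> j * coeff (goss_rec \<epsilon> k (n - j)) m') = 0" by (intro sum.neutral ballI)
    hence "n \<noteq> 1 \<Longrightarrow> ?thesis" using Suc by (simp add: goss_rec.simps[of \<epsilon> k n] coeff_sum)
    moreover have "?thesis" if "n = 1"
      using less.prems Suc that assms(1) by (simp add: goss_rec.simps[of \<epsilon> k n] coeff_pCons split: nat.splits)
    ultimately show ?thesis by blast
  qed (simp add: goss_rec.simps[of \<epsilon> k n])
qed

lemma coeff_goss_rec_0: "coeff (goss_rec \<epsilon> k n) 0 = 0"
  by (simp add: goss_rec.simps)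

context ultrametric_field
begin

text \<open>Every unfolding spends one factor of size at most \<open>B\<close> and lowers the index
  by at least 1, so at most \<open>n\<close> factors occur.\<close>

lemma av_coeff_goss_rec:
  assumes "1 \<le> B" "av k \<le> B" "\<And>j. av (\<epsilon> j) \<le> B"
  shows "av (coeff (goss_rec \<epsilon> k n :: 'c poly) m) \<le> B ^ n"
proof (induction n arbitrary: m rule: less_induct)
  case (less n)
  have B0: "0 \<le> B ^ i" for i using assms(1) by simp
  show ?case
  proof (cases m)
    case (Suc m')
    consider "n = 0" | "n = 1" | "n \<ge> 2" by linarith
    thus ?thesis
    proof cases
      case 3
      have "av (\<Sum>j=1..<n. \<epsilon> j * coeff (goss_rec \<epsilon> k (n - j)) m') \<le> B ^ n"
      proof (rule av_sum_le)
        fix j assume j: "j \<in> {1..<n}"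
        have "av (\<epsilon> j * coeff (goss_rec \<epsilon> k (n - j)) m') \<le> B * B ^ (n - j)"
          unfolding av_mult using less.IH[of "n - j" m'] j assms by (intro mult_mono) auto
        also have "\<dots> = B ^ Suc (n - j)" by simp
        also have "\<dots> \<le> B ^ n" using j assms(1) by (intro power_increasing) auto
        finally show "av (\<epsilon> j * coeff (goss_rec \<epsilon> k (n - j)) m') \<le> B ^ n" .
      qed (rule B0)
      thus ?thesis using 3 Suc by (simp add: goss_rec.simps[of \<epsilon> k n] coeff_sum)
    qed (use assms Suc in \<open>auto simp: goss_rec.simps coeff_pCons split: nat.splits\<close>)
  qed (use B0 in \<open>simp add: coeff_goss_rec_0\<close>)
qed

end

section \<open>The Carlitz exponential\<close>

locale carlitz = C_inf \<iota> q for \<iota> :: "'a::{field,finite} fls \<Rightarrow> 'c::{field,complete_space}" and q +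
  fixes per :: 'c
  assumes carlitz_period: "carlitz_period \<iota> per"
begin

abbreviation ex :: "'c \<Rightarrow> 'c" where "ex \<equiv> carlitz_exp \<iota> per"
abbreviation tp :: "'c \<Rightarrow> 'c" where "tp \<equiv> t_par \<iota> per"
abbreviation S :: "nat \<Rightarrow> 'a poly set" where "S \<equiv> small_polys"

lemma per_nonzero [simp]: "per \<noteq> 0"
  and ex_T: "ex (T * z) = T * ex z + ex z ^ CARD('a)"
  using carlitz_period unfolding carlitz_period_def by auto

definition ex_trunc :: "nat \<Rightarrow> 'c \<Rightarrow> 'c" where
  "ex_trunc d z = z * (\<Prod>a\<in>S d - {0}. 1 - z / (per * A a))"

lemma av_lattice_outside: "a \<notin> S d \<Longrightarrow> q ^ d * av per \<le> av (per * A a)"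
proof -
  assume a: "a \<notin> S d"
  hence "a \<noteq> 0" by auto
  moreover have "d \<le> degree a" using a by (auto simp: small_polys_def intro: order_trans[OF _ le_degree])
  ultimately show ?thesis using q_gt_1
    by (simp add: av_mult av_A mult.commute power_increasing mult_left_mono)
qed

lemma av_prod_minus_1:
  assumes "0 \<le> e" "e \<le> 1" "\<And>i. i \<in> X \<Longrightarrow> av (f i - 1) \<le> e"
  shows "av (prod f X - 1 :: 'c) \<le> e"
  using assms(3)
proof (induction X rule: infinite_finite_induct)
  case (insert i X)
  have eq: "prod f (insert i X) - 1 = f i * (prod f X - 1) + (f i - 1)"
    using insert by (simp add: algebra_simps)
  have "av (f i) \<le> 1"
    using av_add_le[of "f i - 1" 1 1] insert.prems[of i] assms(2) by simp
  hence "av (f i * (prod f X - 1)) \<le> 1 * e" unfolding av_mult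
    using insert by (intro mult_mono) auto
  thus ?case unfolding eq using insert.prems by (intro av_add_le) auto
qed (use assms in auto)

lemma lattice_prod_stable:
  assumes "av z < q ^ d * av per" "finite X" "X \<inter> S d = {}"
  shows "av ((\<Prod>a\<in>X. 1 - z / (per * A a)) - 1) \<le> av z / (q ^ d * av per)"
proof (rule av_prod_minus_1)
  show "av z / (q ^ d * av per) \<le> 1" using assms(1) by (intro divide_le_eq_1_pos[THEN iffD2]) auto
  fix a assume "a \<in> X"
  hence "q ^ d * av per \<le> av (per * A a)" using assms(3) av_lattice_outside by blast
  thus "av (1 - z / (per * A a) - 1) \<le> av z / (q ^ d * av per)"
    by (auto simp: av_divide intro!: divide_left_mono mult_pos_pos)
       (metis av_0 av_pos_iff mult_le_0_iff not_le per_nonzero q_pos zero_less_power mult_eq_0_iff)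
qed (simp add: divide_nonneg_nonneg)

text \<open>Factors outside \<open>S n\<close> have absolute value 1, so the size of the product is
  settled at \<open>S n\<close>; the factors beyond \<open>S d\<close> multiply it by something
  within \<open>av z / (q^d * av per)\<close> of 1. Keeping the size of the product in the bound
  makes the error relative.\<close>

lemma ex_trunc_step:
  assumes "av z < q ^ n * av per" "n \<le> d" "finite X" "S d - {0} \<subseteq> X" "0 \<notin> X"
  shows "av ((\<Prod>a\<in>X. 1 - z / (per * A a)) - (\<Prod>a\<in>S d - {0}. 1 - z / (per * A a)))
      \<le> av (\<Prod>a\<in>S n - {0}. 1 - z / (per * A a)) * (av z / (q ^ d * av per))"
proof -
  let ?f = "\<lambda>a. 1 - z / (per * A a)"
  have qnd: "q ^ n * av per \<le> q ^ d * av per" using assms(2) q_gt_1 by (simp add: power_increasing)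
  have f1: "av (?f a) = 1" if "a \<notin> S n" for a
  proof -
    have "av z < av (per * A a)" using av_lattice_outside[OF that] assms(1) by linarith
    moreover from this have "per * A a \<noteq> 0" using av_nonneg[of z] by force
    ultimately have "av (z / (per * A a)) < 1" by (simp add: av_divide)
    thus ?thesis using av_diff_eq[of "z / (per * A a)" 1] by simp
  qed
  have "prod ?f (S d - {0}) = prod ?f (S n - {0}) * prod ?f (S d - S n)"
    using small_polys_mono[OF assms(2)] by (subst prod.union_disjoint[symmetric]) (auto intro!: prod.cong)
  hence M: "av (prod ?f (S d - {0})) = av (prod ?f (S n - {0}))"
    by (simp add: av_mult av_prod f1)
  have "prod ?f X = prod ?f (S d - {0}) * prod ?f (X - S d)"
    using assms by (subst prod.union_disjoint[symmetric]) (auto intro!: prod.cong)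
  hence "prod ?f X - prod ?f (S d - {0}) = prod ?f (S d - {0}) * (prod ?f (X - S d) - 1)"
    by (simp add: algebra_simps)
  moreover have "av (prod ?f (X - S d) - 1) \<le> av z / (q ^ d * av per)"
    by (rule lattice_prod_stable) (use less_le_trans[OF assms(1) qnd] assms in auto)
  ultimately show ?thesis by (simp only: av_mult M) (intro mult_left_mono av_nonneg)
qed

text \<open>The truncations along \<open>S d\<close> and the net of finite subsets have the same
  limit. A relative error below 1 yields the exact absolute value of \<open>ex z\<close>, from which
  its zeros and its growth are obtained.\<close>

lemma ex_lim_av:
  shows "(\<lambda>d. ex_trunc d z) \<longlonglongrightarrow> ex z"
    and "av z < q ^ n * av per \<Longrightarrow> av (ex z) = av (ex_trunc n z)"
proof -
  let ?f = "\<lambda>a. 1 - z / (per * A a)"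
  let ?L = "range (\<lambda>a. per * A a)"
  have *: "(\<lambda>d. ex_trunc d z) \<longlonglongrightarrow> ex z \<and> av (ex z) = av (ex_trunc n z)" if n: "av z < q ^ n * av per" for n
  proof -
    define M where "M = av (prod ?f (S n - {0}))"
    define E where "E d = M * (av z / (q ^ d * av per))" for d
    have E0: "E \<longlonglongrightarrow> 0"
    proof -
      have "(\<lambda>d. M * (av z / av per) * inverse (q ^ d)) \<longlonglongrightarrow> M * (av z / av per) * 0"
        by (intro tendsto_intros inverse_q_power_to_0)
      moreover have "E = (\<lambda>d. M * (av z / av per) * inverse (q ^ d))" by (rule ext) (simp add: E_def field_simps)
      ultimately show ?thesis by simp
    qed
    have step: "av (prod ?f X - prod ?f (S d - {0})) \<le> E d" 
      if "n \<le> d" "finite X" "S d - {0} \<subseteq> X" "0 \<notin> X" for d X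
      unfolding E_def M_def by (rule ex_trunc_step[OF n]) (use that in auto)
    obtain l where l: "(\<lambda>d. prod ?f (S (d + n) - {0})) \<longlonglongrightarrow> l"
      "\<And>d. av (l - prod ?f (S (d + n) - {0})) \<le> E (d + n)"
    proof (rule cauchy_limit[of "\<lambda>d. prod ?f (S (d + n) - {0})" "\<lambda>d. E (d + n)"])
      fix m k :: nat assume "k \<le> m"
      hence "S (k + n) \<subseteq> S (m + n)" by (intro small_polys_mono) auto
      thus "av (prod ?f (S (m + n) - {0}) - prod ?f (S (k + n) - {0})) \<le> E (k + n)"
        by (intro step) auto
    qed (use LIMSEQ_ignore_initial_segment[OF E0, of n] in auto)
    have "((\<lambda>X. \<Prod>l\<in>X. 1 - z / l) \<longlongrightarrow> l) (finite_subsets_at_top (?L - {0}))"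
    proof (rule tendstoI)
      fix e :: real assume "e > 0"
      then obtain d where d: "E (d + n) < e"
        using order_tendstoD(2)[OF LIMSEQ_ignore_initial_segment[OF E0, of n], of e]
        by (auto simp: eventually_sequentially)
      let ?X0 = "(\<lambda>a. per * A a) ` (S (d + n) - {0})"
      show "eventually (\<lambda>X. dist (\<Prod>l\<in>X. 1 - z / l) l < e) (finite_subsets_at_top (?L - {0}))"
        unfolding eventually_finite_subsets_at_top
      proof (intro exI[of _ ?X0] conjI allI impI)
        fix X assume X: "finite X \<and> ?X0 \<subseteq> X \<and> X \<subseteq> ?L - {0}"
        define Y where "Y = (\<lambda>a. per * A a) -` X"
        have inj: "inj (\<lambda>a. per * A a)" by (simp add: inj_def)
        have XY: "X = (\<lambda>a. per * A a) ` Y" using X by (auto simp: Y_def)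
        have Y: "finite Y" "S (d + n) - {0} \<subseteq> Y" "0 \<notin> Y"
          using X inj unfolding Y_def by (auto intro: finite_vimageI)
        have "(\<Prod>l\<in>X. 1 - z / l) = prod ?f Y"
          unfolding XY by (subst prod.reindex) (auto simp: inj_on_def)
        moreover have "av (prod ?f Y - prod ?f (S (d + n) - {0})) \<le> E (d + n)"
          using Y by (intro step) auto
        hence "av ((prod ?f Y - prod ?f (S (d + n) - {0})) - (l - prod ?f (S (d + n) - {0}))) \<le> E (d + n)"
          using l(2) by (rule av_diff_le)
        ultimately show "dist (\<Prod>l\<in>X. 1 - z / l) l < e" using d by (simp add: dist_av)
      qed auto
    qed
    hence "Lim (finite_subsets_at_top (?L - {0})) (\<lambda>X. \<Prod>l\<in>X. 1 - z / l) = l"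
      by (intro tendsto_Lim) auto
    hence exz: "ex z = z * l" by (simp add: carlitz_exp_def lattice_exp_def)
    have "(\<lambda>d. ex_trunc (d + n) z) \<longlonglongrightarrow> ex z"
      unfolding exz ex_trunc_def by (intro lim_mult tendsto_const l(1))
    hence lim: "(\<lambda>d. ex_trunc d z) \<longlonglongrightarrow> ex z" by (rule LIMSEQ_offset)
    have lM: "av (l - prod ?f (S n - {0})) \<le> M * (av z / (q ^ n * av per))"
      using l(2)[of 0] by (simp add: E_def)
    have "av l = M"
    proof (cases "M = 0")
      case True
      hence "av (l - prod ?f (S n - {0})) \<le> 0" using lM by simp
      hence "av (l - prod ?f (S n - {0})) = 0" by (intro order_antisym av_nonneg)
      thus ?thesis unfolding M_def av_eq_0_iff by simp
    next
      case False
      hence "M > 0" using av_nonneg by (simp add: M_def)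
      moreover have "av z / (q ^ n * av per) < 1" using n by simp
      ultimately have "M * (av z / (q ^ n * av per)) < M * 1" by (rule mult_strict_left_mono[rotated])
      hence "av (l - prod ?f (S n - {0})) < av (prod ?f (S n - {0}))" using lM by (simp add: M_def)
      from av_add_eq[OF this] show ?thesis by (simp add: M_def)
    qed
    with lim show ?thesis by (simp add: exz ex_trunc_def av_mult M_def)
  qed
  obtain n0 where "av z / av per < q ^ n0" using real_arch_pow[OF q_gt_1] by blast
  hence "av z < q ^ n0 * av per" by (simp add: field_simps)
  thus "(\<lambda>d. ex_trunc d z) \<longlonglongrightarrow> ex z" using * by blast
  show "av z < q ^ n * av per \<Longrightarrow> av (ex z) = av (ex_trunc n z)" using * by blast
qed

lemma ex_lim: "(\<lambda>d. ex_trunc d z) \<longlonglongrightarrow> ex z"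
  by (rule ex_lim_av)

lemma lattice_threshold: "\<exists>n. av z < q ^ n * av per"
proof -
  obtain n0 where "av z / av per < q ^ n0" using real_arch_pow[OF q_gt_1] by blast
  hence "av z < q ^ n0 * av per" by (simp add: field_simps)
  thus ?thesis by blast
qed

lemma ex_eq_0_iff: "ex z = 0 \<longleftrightarrow> (\<exists>a. z = per * A a)"
proof
  assume "ex z = 0"
  moreover obtain n where "av z < q ^ n * av per" using lattice_threshold by blast
  ultimately have "ex_trunc n z = 0" using ex_lim_av(2) by (metis av_eq_0_iff)
  thus "\<exists>a. z = per * A a" by (auto simp: ex_trunc_def intro: exI[of _ 0])
next
  assume "\<exists>a. z = per * A a"
  then obtain a where a: "z = per * A a" by blast
  have "ex_trunc d z = 0" if "d \<ge> Suc (degree a)" for d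
    using that mem_small_polys[of a] small_polys_mono[OF that] by (auto simp: ex_trunc_def a)
  hence "eventually (\<lambda>d. ex_trunc d z = 0) sequentially" unfolding eventually_sequentially by blast
  hence "(\<lambda>d. ex_trunc d z) \<longlonglongrightarrow> 0" by (rule tendsto_eventually)
  thus "ex z = 0" using ex_lim LIMSEQ_unique by blast
qed

section \<open>Additivity of the exponential and the Carlitz action\<close>

definition lat :: "nat \<Rightarrow> 'c set" where "lat d = (\<lambda>a. per * A a) ` S d"
text \<open>The scalar replaces the monic normalisation by linear coefficient 1, to match
  \<open>ex_trunc\<close>.\<close>

definition epoly :: "nat \<Rightarrow> 'c poly" where
  "epoly d = smult (\<Prod>a\<in>S d - {0}. - 1 / (per * A a)) (root_poly (lat d))"

lemma inj_lattice: "inj_on (\<lambda>a. per * A a) X"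
  by (simp add: inj_on_def)

lemma finite_subgroup_lat: "finite_subgroup (lat d)"
  unfolding finite_subgroup_def lat_def
proof (intro conjI ballI)
  show "0 \<in> (\<lambda>a. per * A a) ` S d" by (rule image_eqI[of _ _ 0]) auto
  fix x y assume "x \<in> (\<lambda>a. per * A a) ` S d" "y \<in> (\<lambda>a. per * A a) ` S d"
  then obtain a b where "x = per * A a" "y = per * A b" "a \<in> S d" "b \<in> S d" by blast
  thus "x - y \<in> (\<lambda>a. per * A a) ` S d"
    by (intro image_eqI[of _ _ "a - b"]) (auto simp: A_diff right_diff_distrib small_polys_diff)
qed simp

lemma ex_trunc_eq_poly: "ex_trunc d z = poly (epoly d) z"
proof -
  have "poly (root_poly (lat d)) z = (\<Prod>a\<in>S d. z - per * A a)"
    by (simp add: poly_root_poly lat_def prod.reindex[OF inj_lattice])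
  also have "\<dots> = z * (\<Prod>a\<in>S d - {0}. z - per * A a)"
    by (subst prod.remove[of _ 0]) auto
  finally have "poly (epoly d) z = z * (\<Prod>a\<in>S d - {0}. (- 1 / (per * A a)) * (z - per * A a))"
    by (simp only: epoly_def prod.distrib poly_smult mult.left_commute)
  also have "(\<Prod>a\<in>S d - {0}. (- 1 / (per * A a)) * (z - per * A a)) = (\<Prod>a\<in>S d - {0}. 1 - z / (per * A a))"
    by (rule prod.cong) (auto simp: field_simps)
  finally show ?thesis by (simp add: ex_trunc_def)
qed

lemma ex_add: "ex (x + y) = ex x + ex y"
proof -
  have "ex_trunc d (x + y) = ex_trunc d x + ex_trunc d y" for d
    by (simp add: ex_trunc_eq_poly epoly_def root_poly_add[OF finite_subgroup_lat] distrib_left)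
  hence "(\<lambda>d. ex_trunc d (x + y)) \<longlonglongrightarrow> ex x + ex y" by (simp add: lim_add ex_lim)
  thus ?thesis using ex_lim LIMSEQ_unique by blast
qed

lemma ex_0 [simp]: "ex 0 = 0"
  by (auto simp: ex_eq_0_iff intro: exI[of _ 0])

lemma ex_minus: "ex (- x) = - ex x"
  by (rule minus_unique[symmetric]) (simp flip: ex_add)

lemma ex_diff: "ex (x - y) = ex x - ex y"
  using ex_add[of x "- y"] by (simp add: ex_minus)

lemma ex_K: "ex (K c * z) = K c * ex z"
proof (cases "c = 0")
  case False
  have "ex_trunc d (K c * z) = K c * ex_trunc d z" for d
  proof -
    have "(\<Prod>a\<in>S d - {0}. 1 - K c * z / (per * A a)) = (\<Prod>a\<in>S d - {0}. 1 - z / (per * A a))"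
    proof (rule prod.reindex_bij_witness[of _ "smult c" "smult (inverse c)"])
      fix a assume "a \<in> S d - {0}"
      have "K c \<noteq> 0" using False by simp
      have "smult c (smult (inverse c) a) = a" using False by simp
      hence "A a = K c * A (smult (inverse c) a)" by (metis A_smult)
      thus "1 - z / (per * A (smult (inverse c) a)) = 1 - K c * z / (per * A a)"
        using \<open>K c \<noteq> 0\<close> by (simp add: mult.left_commute[of per])
    qed (use False in \<open>auto simp: small_polys_def\<close>)
    thus ?thesis by (simp add: ex_trunc_def)
  qed
  hence "(\<lambda>d. ex_trunc d (K c * z)) \<longlonglongrightarrow> K c * ex z" by (simp add: lim_mult ex_lim)
  thus ?thesis using ex_lim LIMSEQ_unique by blast
qed simp

lemma ex_lattice [simp]: "ex (per * A a) = 0"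
  by (auto simp: ex_eq_0_iff)

lemma ex_eq_iff: "ex x = ex y \<longleftrightarrow> (\<exists>a. x - y = per * A a)"
  using ex_eq_0_iff[of "x - y"] by (simp add: ex_diff)

text \<open>These are the polynomials of the Carlitz module, built by Horner's scheme from
  \<open>ex_T\<close>. The leading term comes from the \<open>CARD('a)\<close>-th power, whose
  degree exceeds that of \<open>T * P\<close> because \<open>CARD('a) > 1\<close>.\<close>

lemma carlitz_poly_exists:
  "lead_coeff a = 1 \<Longrightarrow>
     \<exists>P. degree P = CARD('a) ^ degree a \<and> lead_coeff P = 1 \<and> coeff P 0 = 0 \<and> (\<forall>z. ex (A a * z) = poly P (ex z))"
proof (induction a)
  case (pCons c a)
  show ?case
  proof (cases "a = 0")
    case True
    thus ?thesis using pCons.prems by (intro exI[of _ "[:0, 1:]"]) (simp add: A_const)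
  next
    case False
    then obtain P where P: "degree P = CARD('a) ^ degree a" "lead_coeff P = 1" "coeff P 0 = 0"
      "\<And>z. ex (A a * z) = poly P (ex z)" using pCons by auto
    have C: "CARD('a) > 1" using q_gt_1 q_eq by simp
    define R where "R = smult T P + [:0, K c:]"
    define Q where "Q = P ^ CARD('a)"
    have dQ: "degree Q = CARD('a) ^ Suc (degree a)"
      using P by (simp add: Q_def degree_power_eq mult.commute flip: leading_coeff_0_iff)
    have 1: "CARD('a) ^ degree a < CARD('a) ^ Suc (degree a)" using C by simp
    have 2: "1 < CARD('a) ^ Suc (degree a)" using C by (intro one_less_power) auto
    have dR: "degree R < degree Q" unfolding R_def dQ
      by (rule degree_add_less) (use P 1 2 in \<open>auto intro: le_less_trans[OF degree_smult_le]\<close>)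
    show ?thesis
    proof (intro exI[of _ "R + Q"] conjI allI)
      show "degree (R + Q) = CARD('a) ^ degree (pCons c a)"
        using dR dQ False by (simp add: degree_add_eq_right)
      show "lead_coeff (R + Q) = 1"
        using dR P(2) by (simp add: degree_add_eq_right coeff_eq_0) (simp add: Q_def lead_coeff_power)
      show "coeff (R + Q) 0 = 0"
        using P(3) by (simp add: R_def Q_def coeff_0_power)
      show "ex (A (pCons c a) * z) = poly (R + Q) (ex z)" for z
      proof -
        have "A (pCons c a) * z = K c * z + T * (A a * z)" by (simp add: A_pCons algebra_simps)
        thus ?thesis by (simp only: ex_add ex_K ex_T P(4)) (simp add: R_def Q_def poly_power)
      qed
    qed
  qed
qed simp

text \<open>Translate \<open>z\<close> by a closest polynomial. Then 0 is a lattice point closest to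
  \<open>per * w\<close>, so every factor of the product has absolute value at least 1 and
  \<open>av (per * w)\<close> remains as a lower bound. This is why \<open>tp\<close> tends to 0 at
  infinity.\<close>

lemma av_ex_ge: "av per * im z \<le> av (ex (per * z))"
proof -
  obtain b where b: "\<And>b'. av (z - A b) \<le> av (z - A b')" using closest_A by blast
  define w where "w = z - A b"
  have ew: "ex (per * w) = ex (per * z)"
    by (simp add: w_def right_diff_distrib ex_diff)
  obtain n where n: "av (per * w) < q ^ n * av per" using lattice_threshold by blast
  have "1 \<le> av (1 - per * w / (per * A a))" if "a \<noteq> 0" for a
  proof -
    have "av w \<le> av (w - A a)" using b[of "b + a"] by (simp add: w_def A_add algebra_simps)
    hence "av (A a) \<le> av (w - A a)"
      using av_diff[of w "w - A a"] by simp
    moreover have "1 - per * w / (per * A a) = (A a - w) / A a" using that by (simp add: field_simps)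
    ultimately show ?thesis using that by (simp add: av_divide av_minus_commute[of w])
  qed
  hence "1 \<le> (\<Prod>a\<in>S n - {0}. av (1 - per * w / (per * A a)))" by (intro prod_ge_1) auto
  hence "av (per * w) * 1 \<le> av (ex_trunc n (per * w))"
    unfolding ex_trunc_def av_mult[of "per * w"] av_prod by (intro mult_left_mono) auto
  also have "\<dots> = av (ex (per * z))" using ex_lim_av(2)[OF n] ew by simp
  finally have "av per * av w \<le> av (ex (per * z))" by (simp add: av_mult)
  moreover have "im z \<le> av w" unfolding w_def using im_add_A[of w b] im_le_av[of w] by (simp add: w_def)
  ultimately show ?thesis by (meson av_nonneg mult_left_mono order_trans)
qed

lemma ex_nonzero: "im z > 0 \<Longrightarrow> ex (per * z) \<noteq> 0"
  using av_ex_ge[of z] by (metis av_0 av_pos_iff mult_pos_pos not_le per_nonzero)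

lemma tp_eq: "tp z = 1 / ex (per * z)"
  by (simp add: t_par_def)

lemma tp_nonzero: "im z > 0 \<Longrightarrow> tp z \<noteq> 0"
  by (simp add: tp_eq ex_nonzero)

lemma av_tp_le: "im z > 0 \<Longrightarrow> av (tp z) \<le> 1 / (av per * im z)"
  using av_ex_ge[of z] by (simp add: tp_eq av_divide frac_le)

lemma tp_add_A [simp]: "tp (z + A b) = tp z"
  by (simp add: tp_eq distrib_left ex_add)

lemma av_tp_small:
  assumes "e > 0" shows "\<exists>R>0. \<forall>z. im z \<ge> R \<longrightarrow> av (tp z) \<le> e"
proof (intro exI[of _ "1 / (av per * e)"] conjI allI impI)
  show p: "1 / (av per * e) > 0" using assms by simp
  fix z assume z: "im z \<ge> 1 / (av per * e)"
  hence "1 \<le> im z * (av per * e)" using assms by (simp add: divide_le_eq)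
  moreover have imz: "im z > 0" using z p by linarith
  ultimately have "1 / (av per * im z) \<le> e" by (subst pos_divide_le_eq) (auto simp: mult_ac)
  moreover note imz
  ultimately show "av (tp z) \<le> e" using av_tp_le[of z] by linarith
qed

end

section \<open>Calculus of expansions in the parameter at infinity\<close>

context ultrametric_field
begin

lemma sums_tail_le:
  assumes "f sums (s::'c)" "\<And>m. av (f m) \<le> K * r ^ m" "0 \<le> K" "0 \<le> r" "r \<le> 1"
  shows "av (s - sum f {..<N}) \<le> K * r ^ N"
proof (rule tendsto_upperbound)
  show "(\<lambda>n. av (sum f {..<n} - sum f {..<N})) \<longlonglongrightarrow> av (s - sum f {..<N})"
    using assms(1) unfolding sums_def by (intro tendsto_av lim_diff tendsto_const)
  have "av (sum f {..<n} - sum f {..<N}) \<le> K * r ^ N" if "N \<le> n" for n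
  proof -
    have eq: "sum f {..<n} - sum f {..<N} = sum f {N..<n}"
      using sum_diff_nat_ivl[of 0 N n f] that by (simp add: atLeast0LessThan)
    show ?thesis unfolding eq
    proof (rule av_sum_le)
      fix i assume "i \<in> {N..<n}"
      hence "r ^ i \<le> r ^ N" using assms by (intro power_decreasing) auto
      thus "av (f i) \<le> K * r ^ N" using assms(2)[of i] assms(3) by (meson mult_left_mono order_trans)
    qed (use assms in auto)
  qed
  thus "eventually (\<lambda>n. av (sum f {..<n} - sum f {..<N}) \<le> K * r ^ N) sequentially"
    by (auto simp: eventually_sequentially)
qed simp

text \<open>Interchange of summation: \<open>H i m\<close> is the coefficient of \<open>x^m\<close>
  in the \<open>i\<close>-th inner series. As nonzero entries satisfy \<open>i \<le> m * M\<close>,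
  output coefficients are finite sums and \<open>B^i \<le> B^(m * M)\<close>, which is where the
  exponent \<open>M + 1\<close> in the smallness condition comes from.\<close>

lemma double_series:
  fixes F :: "nat \<Rightarrow> 'c" and H :: "nat \<Rightarrow> nat \<Rightarrow> 'c"
  assumes H0: "\<And>i m. m * M < i \<Longrightarrow> H i m = 0"
    and bound: "\<And>i m. av (F i * H i m) \<le> K * (B ^ i * B ^ m)" "1 \<le> B" "0 \<le> K" "B ^ (M + 1) * av x < 1"
    and rows: "\<And>i. (\<lambda>m. H i m * x ^ m) sums h i"
    and total: "(\<lambda>i. F i * h i) sums s"
  shows "(\<lambda>m. (\<Sum>i\<le>m * M. F i * H i m) * x ^ m) sums s"
proof -
  define r where "r = B ^ (M + 1) * av x"
  define a where "a i m = F i * (H i m * x ^ m)" for i m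
  have r: "0 \<le> r" "r \<le> 1" using bound by (auto simp: r_def)
  have a_le: "av (a i m) \<le> K * r ^ m" for i m
  proof (cases "m * M < i")
    case True thus ?thesis using H0 r bound by (simp add: a_def)
  next
    case False
    have "av (a i m) = av (F i * H i m) * av x ^ m" by (simp add: a_def av_mult)
    also have "\<dots> \<le> K * (B ^ i * B ^ m) * av x ^ m"
      by (intro mult_right_mono bound(1)) simp
    also have "\<dots> \<le> K * (B ^ (m * M) * B ^ m) * av x ^ m"
      using False bound by (intro mult_right_mono mult_left_mono power_increasing) auto
    also have "\<dots> = K * r ^ m"
      by (simp add: r_def power_mult_distrib power_mult[symmetric] power_add algebra_simps)
    finally show ?thesis .
  qed
  have row: "av (F i * h i - (\<Sum>m<N. a i m)) \<le> K * r ^ N" for i N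
    by (rule sums_tail_le) (use a_le r bound rows sums_mult_av in \<open>auto simp: a_def\<close>)
  define c where "c m = (\<Sum>i\<le>m * M. F i * H i m) * x ^ m" for m
  have col: "av (s - (\<Sum>m<N. c m)) \<le> K * r ^ N" for N
  proof (rule tendsto_upperbound)
    show "(\<lambda>I. av ((\<Sum>i<I. F i * h i) - (\<Sum>m<N. c m))) \<longlonglongrightarrow> av (s - (\<Sum>m<N. c m))"
      using total unfolding sums_def by (intro tendsto_av lim_diff tendsto_const)
    have "av ((\<Sum>i<I. F i * h i) - (\<Sum>m<N. c m)) \<le> K * r ^ N" if I: "N * M < I" for I
    proof -
      have "c m = (\<Sum>i<I. a i m)" if "m < N" for m
      proof -
        have "m * M \<le> N * M" using that by simp
        hence "m * M < I" using I by linarith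
        hence "(\<Sum>i\<le>m * M. a i m) = (\<Sum>i<I. a i m)"
          by (intro sum.mono_neutral_left) (auto simp: a_def H0)
        thus ?thesis by (simp add: c_def a_def sum_distrib_right mult.assoc)
      qed
      hence "(\<Sum>m<N. c m) = (\<Sum>i<I. \<Sum>m<N. a i m)" by (subst sum.swap) simp
      hence eq: "(\<Sum>i<I. F i * h i) - (\<Sum>m<N. c m) = (\<Sum>i<I. F i * h i - (\<Sum>m<N. a i m))"
        by (simp add: sum_subtractf)
      show ?thesis unfolding eq by (rule av_sum_le) (use row r bound in auto)
    qed
    thus "eventually (\<lambda>I. av ((\<Sum>i<I. F i * h i) - (\<Sum>m<N. c m)) \<le> K * r ^ N) sequentially"
      unfolding eventually_sequentially by (intro exI[of _ "Suc (N * M)"]) auto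
  qed simp
  have "(\<lambda>N. K * r ^ N) \<longlonglongrightarrow> K * 0"
    using r bound(4) by (intro tendsto_intros LIMSEQ_realpow_zero) (auto simp: r_def)
  hence "(\<lambda>N. \<Sum>m<N. c m) \<longlonglongrightarrow> s"
    by (intro lim_av_le[of "\<lambda>N. K * r ^ N"]) (use col in \<open>auto simp: av_minus_commute[of _ s]\<close>)
  thus ?thesis by (simp add: sums_def c_def)
qed

lemma sums_shift_mult:
  assumes "(\<lambda>m. G m * x ^ m) sums (g::'c)"
  shows "(\<lambda>m. (if m < i then 0 else G (m - i)) * x ^ m) sums (x ^ i * g)"
proof -
  have "(\<Sum>m<n + i. (if m < i then 0 else G (m - i)) * x ^ m) = x ^ i * (\<Sum>m<n. G m * x ^ m)" for n
  proof -
    have "(\<Sum>m<n + i. (if m < i then 0 else G (m - i)) * x ^ m) = (\<Sum>m\<in>{i..<n + i}. G (m - i) * x ^ m)"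
      by (rule sum.mono_neutral_cong_right) auto
    also have "\<dots> = (\<Sum>m<n. G m * x ^ (m + i))"
      by (rule sum.reindex_bij_witness[of _ "\<lambda>m. m + i" "\<lambda>m. m - i"]) auto
    finally show ?thesis by (simp add: sum_distrib_left power_add algebra_simps)
  qed
  moreover have "(\<lambda>n. x ^ i * (\<Sum>m<n. G m * x ^ m)) \<longlonglongrightarrow> x ^ i * g"
    using assms unfolding sums_def by (intro lim_mult tendsto_const)
  ultimately have "(\<lambda>n. \<Sum>m<n + i. (if m < i then 0 else G (m - i)) * x ^ m) \<longlonglongrightarrow> x ^ i * g"
    by simp
  thus ?thesis unfolding sums_def by (rule LIMSEQ_offset)
qed

end

context carlitz
begin

abbreviation hte :: "('c \<Rightarrow> 'c) \<Rightarrow> 'c fps \<Rightarrow> bool" where "hte \<equiv> has_t_expansion \<iota> per"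

lemma hteE:
  assumes "hte f F"
  obtains R where "R > 0" "\<And>z. im z \<ge> R \<Longrightarrow> (\<lambda>i. fps_nth F i * tp z ^ i) sums f z"
  using assms unfolding has_t_expansion_iff by blast

text \<open>Positive radius of convergence; the exponent \<open>Suc i\<close> absorbs a constant
  factor into \<open>B\<close>.\<close>

definition tame :: "(nat \<Rightarrow> 'c) \<Rightarrow> bool" where
  "tame F \<longleftrightarrow> (\<exists>B\<ge>1. \<forall>i. av (F i) \<le> B ^ Suc i)"

lemma tp_tiny:
  assumes "e > 0" shows "\<exists>z. im z \<ge> R \<and> im z > 0 \<and> av (tp z) \<le> e"
proof -
  obtain R' where R': "R' > 0" "\<And>z. im z \<ge> R' \<Longrightarrow> av (tp z) \<le> e" using av_tp_small[OF assms] by blast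
  obtain z where "im z \<ge> max R R'" using im_unbounded by blast
  thus ?thesis using R' by (intro exI[of _ z]) force
qed

lemma hte_cong:
  assumes "hte f F" "\<And>z. im z \<ge> R \<Longrightarrow> f z = g z" shows "hte g F"
proof -
  obtain R' where R': "R' > 0" "\<And>z. im z \<ge> R' \<Longrightarrow> (\<lambda>i. fps_nth F i * tp z ^ i) sums f z"
    using hteE[OF assms(1)] by blast
  show ?thesis unfolding has_t_expansion_iff
  proof (intro exI[of _ "max R R'"] conjI allI impI)
    fix z assume "max R R' \<le> im z"
    thus "(\<lambda>i. fps_nth F i * tp z ^ i) sums g z" using R'(2)[of z] assms(2)[of z] by simp
  qed (use R' in simp)
qed

lemma hte_tame:
  assumes "hte f F" shows "tame (fps_nth F)"
proof -
  obtain R where R: "R > 0" "\<And>z. im z \<ge> R \<Longrightarrow> (\<lambda>i. fps_nth F i * tp z ^ i) sums f z"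
    using hteE[OF assms] by blast
  obtain z where z: "im z \<ge> R" using im_unbounded by blast
  define x where "x = tp z"
  have x: "x \<noteq> 0" using z R by (auto simp: x_def tp_nonzero)
  have "(\<lambda>i. av (fps_nth F i * x ^ i)) \<longlonglongrightarrow> 0"
    using R(2)[OF z] by (auto simp: x_def intro: sums_terms_to_0)
  hence "Bseq (\<lambda>i. av (fps_nth F i * x ^ i))" by (intro convergent_imp_Bseq) (auto simp: convergent_def)
  then obtain C where C: "\<And>i. av (fps_nth F i * x ^ i) \<le> C" unfolding Bseq_def by auto
  define B where "B = max 1 (max C (1 / av x))"
  have "av (fps_nth F i) \<le> B ^ Suc i" for i
  proof -
    have "av (fps_nth F i) = av (fps_nth F i * x ^ i) * (1 / av x) ^ i"
      using x by (simp add: av_mult power_divide)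
    also have "\<dots> \<le> B * B ^ i" using C[of i]
      by (intro mult_mono power_mono) (auto simp: B_def)
    finally show ?thesis by simp
  qed
  thus ?thesis unfolding tame_def by (intro exI[of _ B]) (auto simp: B_def)
qed

text \<open>Near infinity \<open>tp\<close> is small and nonzero, and there the lowest nonzero term
  outweighs all later ones.\<close>

lemma hte_zero_unique:
  assumes "hte (\<lambda>_. 0) F" shows "F = 0"
proof (rule ccontr)
  assume "F \<noteq> 0"
  define N where "N = subdegree F"
  have FN: "fps_nth F N \<noteq> 0" using \<open>F \<noteq> 0\<close> by (simp add: N_def)
  obtain B where B: "B \<ge> 1" "\<And>i. av (fps_nth F i) \<le> B ^ Suc i"
    using hte_tame[OF assms] unfolding tame_def by blast
  obtain R where R: "R > 0" "\<And>z. im z \<ge> R \<Longrightarrow> (\<lambda>i. fps_nth F i * tp z ^ i) sums 0"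
    using hteE[OF assms] by blast
  \<comment> \<open>The first bound gives \<open>B * av x \<le> 1\<close>, as the tail estimate
    requires; the second keeps the tail at most half of the term of index \<open>N\<close>.\<close>
  define e where "e = min (1 / B) (av (fps_nth F N) / (2 * B ^ (N + 2)))"
  have "e > 0" using B FN by (simp add: e_def)
  then obtain z where z: "im z \<ge> R" "im z > 0" "av (tp z) \<le> e" using tp_tiny by blast
  define x where "x = tp z"
  have x0: "x \<noteq> 0" using z tp_nonzero by (simp add: x_def)
  have xB: "B * av x \<le> 1" using z B by (simp add: x_def e_def field_simps)
  have "av (0 - (\<Sum>i<Suc N. fps_nth F i * x ^ i)) \<le> B * (B * av x) ^ Suc N"
  proof (rule sums_tail_le)
    show "(\<lambda>i. fps_nth F i * x ^ i) sums 0" using R(2)[OF z(1)] by (simp add: x_def)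
    show "av (fps_nth F m * x ^ m) \<le> B * (B * av x) ^ m" for m
      using mult_right_mono[OF B(2)[of m], of "av x ^ m"] by (simp add: av_mult power_mult_distrib mult.assoc)
  qed (use B xB in auto)
  moreover have "(\<Sum>i<Suc N. fps_nth F i * x ^ i) = fps_nth F N * x ^ N"
  proof -
    have "(\<Sum>i<N. fps_nth F i * x ^ i) = 0"
    proof (intro sum.neutral ballI)
      fix i assume "i \<in> {..<N}"
      hence "i < subdegree F" unfolding N_def lessThan_iff .
      hence "fps_nth F i = 0" by (rule nth_less_subdegree_zero)
      thus "fps_nth F i * x ^ i = 0" by (simp only: mult_zero_left)
    qed
    thus ?thesis by (simp only: sum.lessThan_Suc add_0_left)
  qed
  ultimately have "av (fps_nth F N) * av x ^ N \<le> (B ^ (N + 2) * av x) * av x ^ N"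
    by (simp add: av_mult power_mult_distrib mult_ac)
  hence "av (fps_nth F N) \<le> B ^ (N + 2) * av x" using x0 by simp
  also have "\<dots> \<le> B ^ (N + 2) * (av (fps_nth F N) / (2 * B ^ (N + 2)))"
    using z B by (intro mult_left_mono) (auto simp: x_def e_def)
  also have "\<dots> = av (fps_nth F N) / 2" using B by simp
  finally show False using FN by (simp flip: av_pos_iff)
qed

lemma hte_add:
  assumes "hte f F" "hte g G" shows "hte (\<lambda>z. f z + g z) (F + G)"
proof -
  obtain R where R: "R > 0" "\<And>z. im z \<ge> R \<Longrightarrow> (\<lambda>i. fps_nth F i * tp z ^ i) sums f z"
    using hteE[OF assms(1)] by blast
  obtain R' where R': "R' > 0" "\<And>z. im z \<ge> R' \<Longrightarrow> (\<lambda>i. fps_nth G i * tp z ^ i) sums g z"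
    using hteE[OF assms(2)] by blast
  show ?thesis unfolding has_t_expansion_iff
  proof (intro exI[of _ "max R R'"] conjI allI impI)
    fix z assume "max R R' \<le> im z"
    thus "(\<lambda>i. fps_nth (F + G) i * tp z ^ i) sums (f z + g z)"
      using sums_add_av[OF R(2)[of z] R'(2)[of z]] by (simp add: distrib_right)
  qed (use R in simp)
qed

lemma hte_cmult:
  assumes "hte f F" shows "hte (\<lambda>z. c * f z) (fps_const c * F)"
proof -
  obtain R where R: "R > 0" "\<And>z. im z \<ge> R \<Longrightarrow> (\<lambda>i. fps_nth F i * tp z ^ i) sums f z"
    using hteE[OF assms(1)] by blast
  show ?thesis unfolding has_t_expansion_iff
    using R(1) sums_mult_av[OF R(2), of _ c] by (intro exI[of _ R]) (auto simp: mult.assoc)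
qed

lemma hte_unique:
  assumes "hte f F" "hte f G" shows "F = G"
proof -
  have "hte (\<lambda>z. f z + (-1) * f z) (F + fps_const (-1) * G)"
    by (intro hte_add hte_cmult assms)
  hence "hte (\<lambda>_. 0) (F + fps_const (-1) * G)" by simp
  from hte_zero_unique[OF this] show ?thesis
    by (simp add: fps_const_neg[symmetric] del: fps_const_neg)
qed

lemma t_expansion_eqI: "hte f F \<Longrightarrow> t_expansion \<iota> per f = F"
  unfolding t_expansion_def by (rule the_equality) (auto intro: hte_unique)

lemma sums_single:
  fixes f :: "nat \<Rightarrow> 'c" assumes "\<And>i. i \<noteq> k \<Longrightarrow> f i = 0" shows "f sums f k"
proof -
  have "sum f {..<n} = f k" if "n \<ge> Suc k" for n
    using that assms by (subst sum.mono_neutral_right[of _ "{k}"]) auto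
  hence "eventually (\<lambda>n. sum f {..<n} = f k) sequentially"
    unfolding eventually_sequentially by blast
  thus ?thesis unfolding sums_def by (rule tendsto_eventually)
qed

lemma hte_const: "hte (\<lambda>_. c) (fps_const c)"
proof -
  have "(\<lambda>i. fps_nth (fps_const c) i * x ^ i) sums c" for x
    using sums_single[of 0 "\<lambda>i. fps_nth (fps_const c) i * x ^ i"] by simp
  thus ?thesis unfolding has_t_expansion_iff by (intro exI[of _ 1]) auto
qed

lemma hte_tp: "hte tp fps_X"
proof -
  have "(\<lambda>i. fps_nth fps_X i * x ^ i) sums x" for x :: 'c
    using sums_single[of 1 "\<lambda>i. fps_nth fps_X i * x ^ i"] by simp
  thus ?thesis unfolding has_t_expansion_iff by (intro exI[of _ 1]) auto
qed

text \<open>Common engine for products, for substitution of \<open>tau p\<close> and for the trace;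
  they differ in \<open>H\<close> and in the slope \<open>M\<close>, which is 1 for the first two
  and \<open>qdeg p\<close> for the trace.\<close>

lemma hte_double_series:
  assumes f: "hte f F"
    and H0: "\<And>i m. m * M < i \<Longrightarrow> H i m = 0"
    and H_bound: "1 \<le> C" "\<And>i m. av (H i m) \<le> C ^ Suc (i + m)"
    and rows: "\<And>z i. im z \<ge> R \<Longrightarrow> (\<lambda>m. H i m * tp z ^ m) sums h i z"
    and total: "\<And>z. im z \<ge> R \<Longrightarrow> (\<lambda>i. fps_nth F i * h i z) sums g z"
  shows "hte g (Abs_fps (\<lambda>m. \<Sum>i\<le>m * M. fps_nth F i * H i m))"
proof -
  obtain B where B: "B \<ge> 1" "\<And>i. av (fps_nth F i) \<le> B ^ Suc i"
    using hte_tame[OF f] unfolding tame_def by blast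
  define D where "D = B * C"
  have D: "D \<ge> 1" using B(1) H_bound(1) mult_mono[of 1 B 1 C] by (simp add: D_def)
  have bound: "av (fps_nth F i * H i m) \<le> D * (D ^ i * D ^ m)" for i m
  proof -
    have "av (fps_nth F i * H i m) \<le> B ^ Suc i * C ^ Suc (i + m)"
      unfolding av_mult using B H_bound by (intro mult_mono) auto
    also have "\<dots> \<le> B ^ Suc (i + m) * C ^ Suc (i + m)"
      using B H_bound by (intro mult_right_mono power_increasing) auto
    also have "\<dots> = D * (D ^ i * D ^ m)" by (simp add: D_def power_add power_mult_distrib mult_ac)
    finally show ?thesis .
  qed
  have "1 / (2 * D ^ (M + 1)) > 0" using D by simp
  then obtain R' where R': "R' > 0" "\<And>z. im z \<ge> R' \<Longrightarrow> av (tp z) \<le> 1 / (2 * D ^ (M + 1))"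
    using av_tp_small by blast
  show ?thesis unfolding has_t_expansion_iff
  proof (intro exI[of _ "max R R'"] conjI allI impI)
    fix z assume z: "max R R' \<le> im z"
    have "D ^ (M + 1) * av (tp z) \<le> D ^ (M + 1) * (1 / (2 * D ^ (M + 1)))"
      using z R' D by (intro mult_left_mono) auto
    also have "\<dots> < 1" using D by simp
    finally have "D ^ (M + 1) * av (tp z) < 1" .
    from double_series[OF H0 bound D _ this rows total] D z
    show "(\<lambda>m. fps_nth (Abs_fps (\<lambda>m. \<Sum>i\<le>m * M. fps_nth F i * H i m)) m * tp z ^ m) sums g z"
      by simp
  qed (use R' in simp)
qed

lemma hte_mult:
  assumes f: "hte f F" and g: "hte g G" shows "hte (\<lambda>z. f z * g z) (F * G)"
proof -
  obtain B where B: "B \<ge> 1" "\<And>i. av (fps_nth G i) \<le> B ^ Suc i"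
    using hte_tame[OF g] unfolding tame_def by blast
  obtain R1 where R1: "R1 > 0" "\<And>z. im z \<ge> R1 \<Longrightarrow> (\<lambda>i. fps_nth F i * tp z ^ i) sums f z"
    using hteE[OF f] by blast
  obtain R2 where R2: "R2 > 0" "\<And>z. im z \<ge> R2 \<Longrightarrow> (\<lambda>i. fps_nth G i * tp z ^ i) sums g z"
    using hteE[OF g] by blast
  define H where "H i m = (if m < i then 0 else fps_nth G (m - i))" for i m
  have "hte (\<lambda>z. f z * g z) (Abs_fps (\<lambda>m. \<Sum>i\<le>m * 1. fps_nth F i * H i m))"
  proof (rule hte_double_series[OF f, where C = B and R = "max R1 R2" and h = "\<lambda>i z. tp z ^ i * g z"])
    show "av (H i m) \<le> B ^ Suc (i + m)" for i m
    proof -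
      have "av (fps_nth G (m - i)) \<le> B ^ Suc (i + m)"
        using B(2)[of "m - i"] power_increasing[of "Suc (m - i)" "Suc (i + m)" B] B(1) by linarith
      moreover have "0 \<le> B ^ Suc (i + m)" using B by simp
      ultimately show ?thesis unfolding H_def by (cases "m < i") simp_all
    qed
    fix z assume z: "max R1 R2 \<le> im z"
    show "(\<lambda>m. H i m * tp z ^ m) sums (tp z ^ i * g z)" for i
      unfolding H_def using sums_shift_mult R2(2) z by simp
    have "(\<lambda>i. g z * (fps_nth F i * tp z ^ i)) sums (g z * f z)"
      using R1(2) z by (intro sums_mult_av) auto
    thus "(\<lambda>i. fps_nth F i * (tp z ^ i * g z)) sums (f z * g z)" by (simp add: mult_ac)
  qed (use B in \<open>auto simp: H_def\<close>)
  moreover have "Abs_fps (\<lambda>m. \<Sum>i\<le>m * 1. fps_nth F i * H i m) = F * G"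
    by (rule fps_ext) (simp add: fps_mult_nth H_def atMost_atLeast0)
  ultimately show ?thesis by simp
qed

lemma hte_power: "hte f F \<Longrightarrow> hte (\<lambda>z. f z ^ n) (F ^ n)"
proof (induction n)
  case 0 show ?case using hte_const[of 1] by simp
qed (auto intro: hte_mult)

lemma hte_poly: "hte f F \<Longrightarrow> hte (\<lambda>z. poly p (f z)) (poly (map_poly fps_const p) F)"
proof (induction p)
  case 0 show ?case using hte_const[of 0] by simp
next
  case (pCons c p)
  have "hte (\<lambda>z. c + f z * poly p (f z)) (fps_const c + F * poly (map_poly fps_const p) F)"
    using pCons by (intro hte_add hte_const hte_mult) auto
  thus ?case by (simp add: map_poly_pCons)
qed

lemma tame_inverse:
  assumes "tame (fps_nth G)" "fps_nth G 0 \<noteq> 0" shows "tame (fps_nth (inverse G))"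
proof -
  obtain B where B: "B \<ge> 1" "\<And>i. av (fps_nth G i) \<le> B ^ Suc i"
    using assms(1) unfolding tame_def by blast
  define g where "g = 1 / av (fps_nth G 0)"
  \<comment> \<open>\<open>E\<close> is chosen so that \<open>g * B^(i + 1) \<le> E^i\<close> for
    \<open>i \<ge> 1\<close>; the square of \<open>B\<close> accounts for
    \<open>i + 1 \<le> 2 * i\<close>.\<close>
  define E where "E = max 1 g * B ^ 2"
  have mg: "max 1 g \<ge> 1" by simp
  have B2: "B ^ 2 \<ge> 1" using B by simp
  have E1: "E \<ge> 1" unfolding E_def using mult_mono[OF mg B2] by simp
  have Ei: "g * B ^ Suc i \<le> E ^ i" if "i \<ge> 1" for i
  proof -
    have "g * B ^ Suc i \<le> max 1 g ^ 1 * B ^ (2 * i)"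
      using that B by (intro mult_mono power_increasing) auto
    also have "\<dots> \<le> max 1 g ^ i * B ^ (2 * i)"
      using that B by (intro mult_right_mono power_increasing) auto
    also have "\<dots> = E ^ i" by (simp add: E_def power_mult_distrib power_mult)
    finally show ?thesis .
  qed
  define H where "H = inverse G"
  have g0: "g \<ge> 0" by (simp add: g_def)
  have "av (fps_nth H m) \<le> g * E ^ m" for m
  proof (induction m rule: less_induct)
    case (less m)
    show ?case
    proof (cases "m = 0")
      case True thus ?thesis by (simp add: H_def g_def av_divide inverse_eq_divide)
    next
      case False
      have "fps_nth (G * H) m = 0" using assms(2) False
        unfolding H_def by (subst mult.commute, subst inverse_mult_eq_1) auto
      hence "fps_nth G 0 * fps_nth H m = - (\<Sum>i=1..m. fps_nth G i * fps_nth H (m - i))"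
        by (simp add: fps_mult_nth sum.atLeast_Suc_atMost eq_neg_iff_add_eq_0)
      hence "fps_nth H m = - (\<Sum>i=1..m. fps_nth G i * fps_nth H (m - i)) / fps_nth G 0"
        using assms(2) by (simp add: field_simps)
      hence "av (fps_nth H m) = av (\<Sum>i=1..m. fps_nth G i * fps_nth H (m - i)) * g"
        by (simp add: av_divide g_def)
      also have "\<dots> \<le> E ^ m * g"
      proof (intro mult_right_mono g0 av_sum_le)
        fix i assume i: "i \<in> {1..m}"
        have "av (fps_nth G i * fps_nth H (m - i)) \<le> B ^ Suc i * (g * E ^ (m - i))"
          unfolding av_mult using i B less.IH[of "m - i"] by (intro mult_mono) auto
        also have "\<dots> = (g * B ^ Suc i) * E ^ (m - i)" by simp
        also have "\<dots> \<le> E ^ i * E ^ (m - i)"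
          using Ei[of i] i E1 by (intro mult_right_mono) auto
        also have "\<dots> = E ^ m" using i by (simp flip: power_add)
        finally show "av (fps_nth G i * fps_nth H (m - i)) \<le> E ^ m" .
      qed (use E1 in simp)
      finally show ?thesis by (simp add: mult.commute)
    qed
  qed
  moreover have "g * E ^ m \<le> E ^ Suc m" for m
  proof -
    have "g * 1 \<le> max 1 g * B ^ 2" using B2 by (intro mult_mono) auto
    hence "g \<le> E" by (simp add: E_def)
    thus ?thesis using E1 by (simp add: mult_right_mono)
  qed
  ultimately have "\<forall>m. av (fps_nth H m) \<le> E ^ Suc m" using order_trans by blast
  thus ?thesis unfolding tame_def H_def using E1 by blast
qed

lemma hte_of_tame:
  assumes "tame (fps_nth H)" shows "\<exists>h. hte h H"
proof -
  obtain B where B: "B \<ge> 1" "\<And>i. av (fps_nth H i) \<le> B ^ Suc i"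
    using assms(1) unfolding tame_def by blast
  have "1 / (2 * B) > 0" using B by simp
  then obtain R where R: "R > 0" "\<And>z. im z \<ge> R \<Longrightarrow> av (tp z) \<le> 1 / (2 * B)"
    using av_tp_small by blast
  have "\<exists>s. (\<lambda>i. fps_nth H i * tp z ^ i) sums s" if "im z \<ge> R" for z
  proof (rule sums_exists)
    show "av (fps_nth H i * tp z ^ i) \<le> B * (B * av (tp z)) ^ i" for i
      using mult_right_mono[OF B(2)[of i], of "av (tp z) ^ i"] by (simp add: av_mult power_mult_distrib mult.assoc)
    have "B * av (tp z) \<le> B * (1 / (2 * B))" using R(2)[OF that] B by (intro mult_left_mono) auto
    thus "B * av (tp z) < 1" using B by simp
  qed (use B in auto)
  then obtain h where "\<And>z. im z \<ge> R \<Longrightarrow> (\<lambda>i. fps_nth H i * tp z ^ i) sums h z" by metis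
  thus ?thesis unfolding has_t_expansion_iff using R by blast
qed

text \<open>The formal inverse converges to some \<open>h\<close>. The product \<open>h * g\<close>
  has the expansion 1, hence equals 1 near infinity.\<close>

lemma hte_inverse:
  assumes g: "hte g G" and G0: "fps_nth G 0 \<noteq> 0" shows "hte (\<lambda>z. 1 / g z) (inverse G)"
proof -
  obtain h where h: "hte h (inverse G)"
    using hte_of_tame tame_inverse hte_tame[OF g] G0 by blast
  have "hte (\<lambda>z. h z * g z) (inverse G * G)" by (intro hte_mult g h)
  hence "hte (\<lambda>z. h z * g z) (fps_const 1)" using G0 by (simp add: inverse_mult_eq_1)
  then obtain R where R: "\<And>z. im z \<ge> R \<Longrightarrow> (\<lambda>i. fps_nth (fps_const 1) i * tp z ^ i) sums (h z * g z)"
    unfolding has_t_expansion_iff by blast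
  have "h z = 1 / g z" if "im z \<ge> R" for z
  proof -
    have "(\<lambda>i. fps_nth (fps_const 1) i * tp z ^ i) sums 1"
      using sums_single[of 0 "\<lambda>i. fps_nth (fps_const 1) i * tp z ^ i"] by simp
    hence "h z * g z = 1" using R[OF that] sums_unique2 by blast
    thus ?thesis by (metis mult_eq_0_iff nonzero_eq_divide_eq zero_neq_one)
  qed
  thus ?thesis by (rule hte_cong[OF h])
qed

definition tau :: "'a poly \<Rightarrow> 'c fps" where
  "tau a = t_expansion \<iota> per (\<lambda>z. tp (A a * z))"

text \<open>For the Carlitz polynomial \<open>P\<close> of \<open>a\<close>, \<open>t(az)\<close> is
  \<open>t^(degree P)\<close> divided by the value of \<open>reflect_poly P\<close> at
  \<open>t\<close>. The denominator has constant term 1 because \<open>P\<close> is monic.\<close>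

lemma tau:
  assumes "lead_coeff a = 1"
  obtains W where "hte (\<lambda>z. tp (A a * z)) (tau a)" "tau a = fps_X ^ (CARD('a) ^ degree a) * W" "fps_nth W 0 = 1"
proof -
  obtain P where P: "degree P = CARD('a) ^ degree a" "lead_coeff P = 1"
    "\<And>z. ex (A a * z) = poly P (ex z)" using carlitz_poly_exists[OF assms] by blast
  define G where "G = poly (map_poly fps_const (reflect_poly P)) fps_X"
  have P0: "coeff (reflect_poly P) 0 = 1" using P by simp
  have nth0: "fps_nth (poly (map_poly fps_const p) fps_X) 0 = coeff p 0" for p :: "'c poly"
    by (induction p) (simp_all add: map_poly_pCons)
  have G0: "fps_nth G 0 = 1" by (simp add: G_def nth0 P(2))
  have hW: "hte (\<lambda>z. 1 / poly (reflect_poly P) (tp z)) (inverse G)"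
    unfolding G_def using G0 by (intro hte_inverse hte_poly hte_tp) (simp add: G_def)
  have "hte (\<lambda>z. tp z ^ degree P * (1 / poly (reflect_poly P) (tp z))) (fps_X ^ degree P * inverse G)"
    by (intro hte_mult hte_power hte_tp hW)
  moreover have "tp z ^ degree P * (1 / poly (reflect_poly P) (tp z)) = tp (A a * z)" if z: "im z \<ge> 1" for z
  proof -
    have t0: "tp z \<noteq> 0" using z by (intro tp_nonzero) auto
    have "poly (reflect_poly P) (tp z) = tp z ^ degree P * poly P (ex (per * z))"
      using poly_reflect_poly_nz[OF t0, of P] by (simp add: tp_eq)
    also have "poly P (ex (per * z)) = ex (per * (A a * z))" using P(3)[of "per * z"] by (simp add: mult_ac)
    finally show ?thesis using t0 by (simp add: tp_eq)
  qed
  ultimately have hte: "hte (\<lambda>z. tp (A a * z)) (fps_X ^ degree P * inverse G)"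
    by (rule hte_cong)
  hence eq: "tau a = fps_X ^ degree P * inverse G" unfolding tau_def by (rule t_expansion_eqI)
  show ?thesis
    by (rule that[of "inverse G"]) (use hte eq P(1) G0 in simp_all)
qed

lemma tau_1: "tau 1 = fps_X"
  unfolding tau_def by (rule t_expansion_eqI) (use hte_tp in simp)

end

section \<open>Goss polynomials of the Carlitz lattice\<close>

context ultrametric_field
begin

lemma sums_poly: "(\<lambda>m. coeff p m * x ^ m) sums poly p (x::'c)"
proof -
  have "(\<Sum>m<n. coeff p m * x ^ m) = poly p x" if "n \<ge> Suc (degree p)" for n
    using that unfolding poly_altdef
    by (intro sum.mono_neutral_right) (auto simp: coeff_eq_0)
  hence "eventually (\<lambda>n. (\<Sum>m<n. coeff p m * x ^ m) = poly p x) sequentially"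
    unfolding eventually_sequentially by blast
  thus ?thesis unfolding sums_def by (rule tendsto_eventually)
qed

lemma av_coeff_fps_power:
  fixes F :: "'c fps"
  assumes "1 \<le> B" "\<And>m. av (fps_nth F m) \<le> B ^ Suc m"
  shows "av (fps_nth (F ^ i) m) \<le> B ^ (i + m)"
proof (induction i arbitrary: m)
  case (Suc i)
  have "av (\<Sum>j=0..m. fps_nth F j * fps_nth (F ^ i) (m - j)) \<le> B ^ (Suc i + m)"
  proof (rule av_sum_le)
    fix j assume j: "j \<in> {0..m}"
    have "av (fps_nth F j * fps_nth (F ^ i) (m - j)) \<le> B ^ Suc j * B ^ (i + (m - j))"
      unfolding av_mult using assms Suc by (intro mult_mono) auto
    also have "\<dots> = B ^ (Suc i + m)" using j by (simp flip: power_add power_Suc)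
    finally show "av (fps_nth F j * fps_nth (F ^ i) (m - j)) \<le> B ^ (Suc i + m)" .
  qed (use assms in auto)
  thus ?case by (simp add: fps_mult_nth)
qed (use assms in simp)

text \<open>The condition on \<open>x\<close> is the same for all \<open>i\<close>, as substitution
  into a series requires; repeated use of \<open>hte_mult\<close> would give a radius depending on
  \<open>i\<close>.\<close>

lemma sums_fps_power:
  fixes F :: "'c fps"
  assumes "1 \<le> B" "\<And>m. av (fps_nth F m) \<le> B ^ Suc m" "B ^ 2 * av x < 1"
    and F: "(\<lambda>m. fps_nth F m * x ^ m) sums a"
  shows "(\<lambda>m. fps_nth (F ^ i) m * x ^ m) sums (a ^ i)"
proof (induction i)
  case 0
  have eq: "fps_nth (F ^ 0) m = coeff 1 m" for m by simp
  show ?case unfolding eq using sums_poly[of 1 x] by simp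
next
  case (Suc i)
  define H where "H j m = (if m < j then 0 else fps_nth (F ^ i) (m - j))" for j m
  have "(\<lambda>m. (\<Sum>j\<le>m * 1. fps_nth F j * H j m) * x ^ m) sums (a * a ^ i)"
  proof (rule double_series[where B = B and K = "B ^ Suc i"])
    fix j m
    show "av (fps_nth F j * H j m) \<le> B ^ Suc i * (B ^ j * B ^ m)"
    proof (cases "m < j")
      case False
      have "av (fps_nth F j * H j m) \<le> B ^ Suc j * B ^ (i + (m - j))"
        unfolding av_mult using assms av_coeff_fps_power[OF assms(1,2), of i "m - j"] False
        by (intro mult_mono) (simp_all add: H_def)
      also have "\<dots> \<le> B ^ Suc j * B ^ (i + m)"
        using assms by (intro mult_left_mono power_increasing) auto
      finally show ?thesis by (simp add: power_add mult_ac)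
    qed (use assms in \<open>simp add: H_def\<close>)
    show "(\<lambda>m. H j m * x ^ m) sums (x ^ j * a ^ i)"
      unfolding H_def by (rule sums_shift_mult) (rule Suc.IH)
  next
    show "(\<lambda>j. fps_nth F j * (x ^ j * a ^ i)) sums (a * a ^ i)"
      using sums_mult_av[OF F, of "a ^ i"] by (simp add: mult_ac)
  qed (use assms in \<open>auto simp: H_def power2_eq_square\<close>)
  moreover have "(\<Sum>j\<le>m * 1. fps_nth F j * H j m) = fps_nth (F ^ Suc i) m" for m
    by (simp add: fps_mult_nth H_def atMost_atLeast0)
  ultimately show ?case by simp
qed

lemma sums_sum_av:
  "(\<And>i. i \<in> X \<Longrightarrow> f i sums (s i :: 'c)) \<Longrightarrow> (\<lambda>n. \<Sum>i\<in>X. f i n) sums (\<Sum>i\<in>X. s i)"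
  by (induction X rule: infinite_finite_induct) (auto intro: sums_add_av)

end

context C_inf
begin

text \<open>The unconditional sum and the limit along the finite groups \<open>small_polys d\<close>
  are obtained together: the definition of \<open>goss_poly\<close> speaks of the former, the
  algebra takes place on the latter.\<close>

lemma has_sum_polys:
  fixes f :: "'a poly \<Rightarrow> 'c"
  assumes E: "E \<longlonglongrightarrow> 0" and f: "\<And>d b. d \<ge> N \<Longrightarrow> b \<notin> small_polys d \<Longrightarrow> av (f b) \<le> E d"
    "\<And>d. d \<ge> N \<Longrightarrow> 0 \<le> E d"
  obtains s where "(f has_sum s) UNIV" "(\<lambda>d. sum f (small_polys d)) \<longlonglongrightarrow> s"
proof -
  have step: "av (sum f X - sum f (small_polys d)) \<le> E d"
    if "N \<le> d" "finite X" "small_polys d \<subseteq> X" for d X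
  proof -
    have eq: "sum f X - sum f (small_polys d) = sum f (X - small_polys d)"
      using that by (simp add: sum_diff)
    show ?thesis unfolding eq by (rule av_sum_le) (use f that in auto)
  qed
  have E': "(\<lambda>d. E (d + N)) \<longlonglongrightarrow> 0" using E by (rule LIMSEQ_ignore_initial_segment)
  obtain s where s: "(\<lambda>d. sum f (small_polys (d + N))) \<longlonglongrightarrow> s"
    "\<And>d. av (s - sum f (small_polys (d + N))) \<le> E (d + N)"
    by (rule cauchy_limit[of "\<lambda>d. sum f (small_polys (d + N))", OF step E'])
       (use small_polys_mono[of "_ + N" "_ + N"] in auto)
  have "(f has_sum s) UNIV" unfolding has_sum_def
  proof (rule tendstoI)
    fix e :: real assume "e > 0"
    then obtain d where d: "E (d + N) < e"
      using order_tendstoD(2)[OF E', of e] by (auto simp: eventually_sequentially)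
    show "eventually (\<lambda>X. dist (sum f X) s < e) (finite_subsets_at_top UNIV)"
      unfolding eventually_finite_subsets_at_top
    proof (intro exI[of _ "small_polys (d + N)"] conjI allI impI)
      fix X assume X: "finite X \<and> small_polys (d + N) \<subseteq> X \<and> X \<subseteq> (UNIV :: 'a poly set)"
      have "av ((sum f X - sum f (small_polys (d + N))) - (s - sum f (small_polys (d + N)))) \<le> E (d + N)"
        by (rule av_diff_le[OF step s(2)]) (use X in auto)
      thus "dist (sum f X) s < e" using d by (simp add: dist_av)
    qed auto
  qed
  moreover have "(\<lambda>d. sum f (small_polys d)) \<longlonglongrightarrow> s" using s(1) by (rule LIMSEQ_offset)
  ultimately show ?thesis by (rule that)
qed

end

context carlitz
begin

definition psum :: "nat \<Rightarrow> nat \<Rightarrow> 'c \<Rightarrow> 'c" where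
  "psum n d z = (\<Sum>b\<in>S d. 1 / (per * z + per * A b) ^ n)"

lemma psum_lattice: "psum n d z = (\<Sum>l\<in>lat d. 1 / (per * z - l) ^ n)"
  unfolding psum_def lat_def sum.reindex[OF inj_lattice] o_def
  by (rule sum.reindex_bij_witness[of _ uminus uminus]) (auto simp: A_minus small_polys_def)

lemma lattice_has_sum:
  assumes "n > 0"
  obtains s where "((\<lambda>b. 1 / (per * z + per * A b) ^ n) has_sum s) UNIV" "(\<lambda>d. psum n d z) \<longlonglongrightarrow> s"
proof -
  obtain N where N: "av (per * z) < q ^ N * av per" using lattice_threshold by blast
  define E where "E d = (inverse (q ^ d) * (1 / av per)) ^ n" for d
  have "E \<longlonglongrightarrow> (0 * (1 / av per)) ^ n"
    unfolding E_def by (intro tendsto_intros inverse_q_power_to_0)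
  hence E0: "E \<longlonglongrightarrow> 0" using assms by (simp add: power_0_left)
  show ?thesis
  proof (rule has_sum_polys[OF E0, of N])
    fix d b assume d: "d \<ge> N" and b: "b \<notin> S d"
    have "q ^ N * av per \<le> q ^ d * av per" using d q_gt_1 by (simp add: power_increasing)
    moreover have b': "q ^ d * av per \<le> av (per * A b)" using b by (rule av_lattice_outside)
    ultimately have "av (per * z) < av (per * A b)" using N by linarith
    hence "av (per * z + per * A b) = av (per * A b)"
      using av_add_eq[of "per * z" "per * A b"] by (simp add: add.commute)
    moreover have "1 / av (per * A b) \<le> 1 / (q ^ d * av per)"
    proof -
      have "0 < q ^ d * av per" by simp
      moreover from this have "0 < av (per * A b)" using b' by linarith
      ultimately show ?thesis using b' by (intro divide_left_mono mult_pos_pos) simp_all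
    qed
    ultimately show "av (1 / (per * z + per * A b) ^ n) \<le> E d"
    proof -
      assume 1: "av (per * z + per * A b) = av (per * A b)" "1 / av (per * A b) \<le> 1 / (q ^ d * av per)"
      have "av (1 / (per * z + per * A b) ^ n) = (1 / av (per * A b)) ^ n"
        by (simp add: av_divide 1(1) power_one_over)
      also have "\<dots> \<le> (1 / (q ^ d * av per)) ^ n" using 1(2) by (rule power_mono) simp
      also have "\<dots> = E d" by (simp add: E_def inverse_eq_divide)
      finally show ?thesis .
    qed
  qed (use that in \<open>auto simp: E_def psum_def[abs_def]\<close>)
qed

text \<open>For \<open>av z < 1\<close> the term at \<open>b = 0\<close> is strictly larger than all
  others. The exact size, independent of \<open>d\<close>, makes partial sums and their limits
  nonzero.\<close>

lemma av_psum_small: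
  assumes "z \<noteq> 0" "av z < 1" "n > 0" shows "av (psum n d z) = 1 / av (per * z) ^ n"
proof -
  have "av (\<Sum>b\<in>S d - {0}. 1 / (per * z + per * A b) ^ n) \<le> 1 / av per ^ n"
  proof (rule av_sum_le)
    fix b assume "b \<in> S d - {0}"
    hence b: "1 \<le> av (A b)" by (auto intro: av_A_ge_1)
    hence "av (z + A b) = av (A b)" using av_add_eq[of z "A b"] assms by (simp add: add.commute)
    hence "av per * 1 \<le> av (per * z + per * A b)"
      using b by (simp only: av_mult mult_left_mono av_nonneg flip: distrib_left)
    thus "av (1 / (per * z + per * A b) ^ n) \<le> 1 / av per ^ n"
      by (simp add: av_divide frac_le power_mono)
  qed simp
  also have "1 / av per ^ n < 1 / av (per * z) ^ n"
    using assms by (intro divide_strict_left_mono power_strict_mono mult_pos_pos)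
      (auto simp: av_mult)
  also have "1 / av (per * z) ^ n = av (1 / (per * z + per * A 0) ^ n)" by (simp add: av_divide)
  finally have less: "av (\<Sum>b\<in>S d - {0}. 1 / (per * z + per * A b) ^ n) < av (1 / (per * z + per * A 0) ^ n)" .
  have "psum n d z = 1 / (per * z + per * A 0) ^ n + (\<Sum>b\<in>S d - {0}. 1 / (per * z + per * A b) ^ n)"
    unfolding psum_def by (subst sum.remove[of _ 0]) auto
  thus ?thesis using av_add_eq[OF less] by (simp add: av_divide)
qed

lemma exists_small: "\<exists>z. im z > 0 \<and> av z < 1"
proof -
  obtain z where z: "im z \<ge> 1" using im_unbounded by blast
  obtain j where j: "av z < q ^ j" using real_arch_pow[OF q_gt_1] by blast
  have nz: "monom (1::'a) j \<noteq> 0" by (simp add: monom_eq_0_iff)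
  show ?thesis using z j im_divide_A[OF nz, of z]
    by (intro exI[of _ "z / A (monom 1 j)"]) (simp add: av_divide av_A nz degree_monom_eq)
qed

lemma not_in_lat: "im z > 0 \<Longrightarrow> per * z \<notin> lat d"
  using ex_nonzero[of z] by (auto simp: lat_def)

text \<open>The recursion for finite lattices shows that convergence of the power sums at a single
  point forces the coefficients of \<open>epoly d\<close> to converge.\<close>

lemma goss_recursion_limit:
  obtains \<epsilon> k where
    "\<And>z n s. im z > 0 \<Longrightarrow> n > 0 \<Longrightarrow> (\<lambda>d. psum n d z) \<longlonglongrightarrow> s \<Longrightarrow> s = poly (goss_rec \<epsilon> k n) (tp z)"
proof -
  define c where "c d = (\<Prod>a\<in>S d - {0}. - 1 / (per * A a))" for d
  have epoly: "epoly d = smult (c d) (root_poly (lat d))" for d by (simp add: epoly_def c_def)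
  define Q where "Q d k \<longleftrightarrow> (\<forall>z. im z > 0 \<longrightarrow> ex_trunc d (per * z) * psum 1 d z = k \<and>
      (\<forall>n\<ge>2. ex_trunc d (per * z) * psum n d z = (\<Sum>j=1..<n. coeff (epoly d) j * psum (n - j) d z)))" for d k
  have "\<exists>k. Q d k" for d
  proof -
    obtain k where k: "\<And>x. x \<notin> lat d \<Longrightarrow> poly (root_poly (lat d)) x * (\<Sum>l\<in>lat d. 1 / (x - l)) = k"
      "\<And>x n. x \<notin> lat d \<Longrightarrow> 2 \<le> n \<Longrightarrow> poly (root_poly (lat d)) x * (\<Sum>l\<in>lat d. 1 / (x - l) ^ n) =
        (\<Sum>j=1..<n. coeff (root_poly (lat d)) j * (\<Sum>l\<in>lat d. 1 / (x - l) ^ (n - j)))"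
      using finite_subgroup_reciprocal_sums[OF finite_subgroup_lat[of d]] by blast
    show ?thesis unfolding Q_def
    proof (intro exI[of _ "c d * k"] allI impI conjI)
      fix z assume z: "im z > 0"
      show "ex_trunc d (per * z) * psum 1 d z = c d * k"
        using k(1)[OF not_in_lat[OF z]] by (simp add: psum_lattice ex_trunc_eq_poly epoly mult.assoc del: sum_distrib_left)
      fix n :: nat assume n: "2 \<le> n"
      have "ex_trunc d (per * z) * psum n d z = c d * (poly (root_poly (lat d)) (per * z) * (\<Sum>l\<in>lat d. 1 / (per * z - l) ^ n))"
        by (simp only: psum_lattice ex_trunc_eq_poly epoly poly_smult mult.assoc)
      also have "\<dots> = (\<Sum>j=1..<n. coeff (epoly d) j * psum (n - j) d z)"
        unfolding k(2)[OF not_in_lat[OF z] n]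
        by (simp only: psum_lattice epoly coeff_smult mult.assoc sum_distrib_left[of "c d"])
      finally show "ex_trunc d (per * z) * psum n d z = (\<Sum>j=1..<n. coeff (epoly d) j * psum (n - j) d z)" .
    qed
  qed
  then obtain k where "\<And>d. Q d (k d)" by metis
  hence k1: "\<And>d z. im z > 0 \<Longrightarrow> ex_trunc d (per * z) * psum 1 d z = k d"
    and kn: "\<And>d z n. im z > 0 \<Longrightarrow> n \<ge> 2 \<Longrightarrow>
       ex_trunc d (per * z) * psum n d z = (\<Sum>j=1..<n. coeff (epoly d) j * psum (n - j) d z)"
    unfolding Q_def by blast+
  \<comment> \<open>At \<open>z0\<close> neither \<open>psum 1 d z0\<close> nor its limit vanishes,
    so the recursion can be solved for the coefficients of \<open>epoly d\<close>.\<close>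
  obtain z0 where z0: "im z0 > 0" "av z0 < 1" using exists_small by blast
  have z00: "z0 \<noteq> 0" using z0 im_le_av[of z0] by auto
  have "\<exists>s. \<forall>n>0. (\<lambda>d. psum n d z) \<longlonglongrightarrow> s n" for z
  proof -
    have "\<forall>n. \<exists>s. n > 0 \<longrightarrow> (\<lambda>d. psum n d z) \<longlonglongrightarrow> s" using lattice_has_sum by metis
    thus ?thesis by metis
  qed
  then obtain s where s: "\<And>z n. n > 0 \<Longrightarrow> (\<lambda>d. psum n d z) \<longlonglongrightarrow> s z n" by metis
  have psum1: "psum 1 d z0 \<noteq> 0" for d using av_psum_small[OF z00 z0(2), of 1 d] z00 by auto
  have s1: "s z0 1 \<noteq> 0"
  proof -
    have "(\<lambda>d. av (psum 1 d z0)) \<longlonglongrightarrow> av (s z0 1)" by (intro tendsto_av s) simp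
    moreover have "(\<lambda>d. av (psum 1 d z0)) = (\<lambda>d. 1 / av (per * z0) ^ 1)"
      using av_psum_small[OF z00 z0(2), of 1] by (intro ext) simp
    ultimately have "av (s z0 1) = 1 / av (per * z0) ^ 1" using LIMSEQ_unique tendsto_const by metis
    thus ?thesis using z00 by auto
  qed
  have klim: "k \<longlonglongrightarrow> ex (per * z0) * s z0 1"
    using lim_mult[OF ex_lim[of "per * z0"] s[of 1 z0]] k1[OF z0(1)] by simp
  have "\<exists>e. (\<lambda>d. coeff (epoly d) j) \<longlonglongrightarrow> e" if "j \<ge> 1" for j
    using that
  proof (induction j rule: less_induct)
    case (less j)
    have "\<forall>i. \<exists>e. i \<in> {1..<j} \<longrightarrow> (\<lambda>d. coeff (epoly d) i) \<longlonglongrightarrow> e" using less by auto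
    then obtain e where e: "\<And>i. i \<in> {1..<j} \<Longrightarrow> (\<lambda>d. coeff (epoly d) i) \<longlonglongrightarrow> e i" by metis
    \<comment> \<open>This is the instance \<open>n = Suc j\<close> of the recursion, in whose last
      summand the coefficient of index \<open>j\<close> multiplies \<open>psum 1\<close>.\<close>
    have "coeff (epoly d) j = (ex_trunc d (per * z0) * psum (Suc j) d z0 -
        (\<Sum>i=1..<j. coeff (epoly d) i * psum (Suc j - i) d z0)) / psum 1 d z0" for d
      using kn[OF z0(1), of "Suc j" d] less.prems psum1[of d] by (simp add: field_simps)
    moreover have "(\<lambda>d. (ex_trunc d (per * z0) * psum (Suc j) d z0 -
        (\<Sum>i=1..<j. coeff (epoly d) i * psum (Suc j - i) d z0)) / psum 1 d z0) \<longlonglongrightarrow>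
        (ex (per * z0) * s z0 (Suc j) - (\<Sum>i=1..<j. e i * s z0 (Suc j - i))) / s z0 1"
      by (intro lim_divide lim_diff lim_mult lim_sum ex_lim s e s1) auto
    ultimately show ?case by auto
  qed
  then obtain \<epsilon> where \<epsilon>: "\<And>j. j \<ge> 1 \<Longrightarrow> (\<lambda>d. coeff (epoly d) j) \<longlonglongrightarrow> \<epsilon> j" by metis
  show ?thesis
  proof (rule that[of "\<epsilon>" "ex (per * z0) * s z0 1"])
    fix z n s' assume z: "im z > 0" and n: "n > (0::nat)" and s': "(\<lambda>d. psum n d z) \<longlonglongrightarrow> s'"
    have "s' = s z n" using s[OF n] s' LIMSEQ_unique by blast
    also have "s z n = poly (goss_rec \<epsilon> (ex (per * z0) * s z0 1) n) (tp z)"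
    proof (rule poly_goss_rec_unique[OF _ _ n])
      have "(\<lambda>d. ex_trunc d (per * z) * psum 1 d z) \<longlonglongrightarrow> ex (per * z) * s z 1" by (intro lim_mult ex_lim s) simp
      hence "ex (per * z) * s z 1 = ex (per * z0) * s z0 1" using k1[OF z] klim LIMSEQ_unique by force
      thus "s z 1 = tp z * (ex (per * z0) * s z0 1)" using ex_nonzero[OF z] by (simp add: tp_eq field_simps)
      fix m :: nat assume m: "2 \<le> m"
      have "(\<lambda>d. ex_trunc d (per * z) * psum m d z) \<longlonglongrightarrow> ex (per * z) * s z m"
        using m by (intro lim_mult ex_lim s) simp
      moreover have "(\<lambda>d. \<Sum>j=1..<m. coeff (epoly d) j * psum (m - j) d z) \<longlonglongrightarrow> (\<Sum>j=1..<m. \<epsilon> j * s z (m - j))"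
        by (intro lim_sum lim_mult \<epsilon> s) auto
      ultimately have "ex (per * z) * s z m = (\<Sum>j=1..<m. \<epsilon> j * s z (m - j))"
        using kn[OF z m] LIMSEQ_unique by force
      thus "s z m = tp z * (\<Sum>j=1..<m. \<epsilon> j * s z (m - j))"
        using ex_nonzero[OF z] by (simp add: tp_eq field_simps)
    qed
    finally show "s' = poly (goss_rec \<epsilon> (ex (per * z0) * s z0 1) n) (tp z)" .
  qed
qed

lemma fps_nth_poly_fps_X: "fps_nth (poly (map_poly fps_const p) fps_X) i = coeff (p :: 'c poly) i"
  by (induction p arbitrary: i) (auto simp: map_poly_pCons coeff_pCons split: nat.splits)

text \<open>A polynomial is its own expansion in \<open>tp\<close>, and expansions are
  unique.\<close>

lemma poly_eqI_tp:
  assumes "\<And>z. im z > 0 \<Longrightarrow> poly P (tp z) = poly Q (tp z)" shows "P = Q"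
proof -
  have "hte (\<lambda>z. poly P (tp z)) (poly (map_poly fps_const P) fps_X)"
    by (intro hte_poly hte_tp)
  hence "hte (\<lambda>z. poly Q (tp z)) (poly (map_poly fps_const P) fps_X)"
    by (rule hte_cong[of _ _ 1]) (auto intro: assms)
  moreover have "hte (\<lambda>z. poly Q (tp z)) (poly (map_poly fps_const Q) fps_X)"
    by (intro hte_poly hte_tp)
  ultimately have "poly (map_poly fps_const P) fps_X = poly (map_poly fps_const Q) fps_X"
    by (rule hte_unique)
  thus ?thesis by (metis fps_nth_poly_fps_X poly_eq_iff)
qed

text \<open>Discharges the definite description: the recursion gives existence,
  \<open>poly_eqI_tp\<close> uniqueness. The polynomial is nonzero because the lattice sum has a
  known nonzero size at a point with \<open>av z0 < 1\<close>.\<close>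

lemma goss_poly:
  assumes n: "n > 0"
  shows goss_poly_limit: "im z > 0 \<Longrightarrow> (\<lambda>d. psum n d z) \<longlonglongrightarrow> poly (goss_poly \<iota> per n) (tp z)"
    and goss_poly_coeff_0: "coeff (goss_poly \<iota> per n) 0 = 0"
    and goss_poly_nonzero: "goss_poly \<iota> per n \<noteq> 0"
proof -
  obtain \<epsilon> k where ek: "\<And>z n s. im z > 0 \<Longrightarrow> n > 0 \<Longrightarrow> (\<lambda>d. psum n d z) \<longlonglongrightarrow> s \<Longrightarrow>
      s = poly (goss_rec \<epsilon> k n) (tp z)"
    using goss_recursion_limit by blast
  have *: "((\<lambda>b. 1 / (per * z + per * A b) ^ n) has_sum poly (goss_rec \<epsilon> k n) (tp z)) UNIV \<and>
      (\<lambda>d. psum n d z) \<longlonglongrightarrow> poly (goss_rec \<epsilon> k n) (tp z)" if z: "im z > 0" for z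
  proof -
    obtain s where "((\<lambda>b. 1 / (per * z + per * A b) ^ n) has_sum s) UNIV" "(\<lambda>d. psum n d z) \<longlonglongrightarrow> s"
      using lattice_has_sum[OF n] by blast
    thus ?thesis using ek[OF z n] by blast
  qed
  have eq: "goss_poly \<iota> per n = goss_rec \<epsilon> k n"
    unfolding goss_poly_def
  proof (rule the_equality)
    fix G assume G: "\<forall>z\<in>Omega \<iota>. ((\<lambda>b. 1 / (per * z + per * A b) ^ n) has_sum poly G (tp z)) UNIV"
    show "G = goss_rec \<epsilon> k n"
    proof (rule poly_eqI_tp)
      fix z assume z: "im z > 0"
      hence "((\<lambda>b. 1 / (per * z + per * A b) ^ n) has_sum poly G (tp z)) UNIV"
        using G by (simp add: Omega_iff_im)
      thus "poly G (tp z) = poly (goss_rec \<epsilon> k n) (tp z)"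
        using *[OF z] unfolding has_sum_def by (metis tendsto_unique finite_subsets_at_top_neq_bot)
    qed
  qed (use * in \<open>auto simp: Omega_iff_im\<close>)
  show lim: "im z > 0 \<Longrightarrow> (\<lambda>d. psum n d z) \<longlonglongrightarrow> poly (goss_poly \<iota> per n) (tp z)" for z
    using * by (simp add: eq)
  show "coeff (goss_poly \<iota> per n) 0 = 0" by (simp add: eq coeff_goss_rec_0)
  obtain z0 where z0: "im z0 > 0" "av z0 < 1" using exists_small by blast
  have z00: "z0 \<noteq> 0" using z0 im_le_av[of z0] by auto
  have "(\<lambda>d. av (psum n d z0)) \<longlonglongrightarrow> av (poly (goss_poly \<iota> per n) (tp z0))"
    by (intro tendsto_av lim z0)
  moreover have "(\<lambda>d. av (psum n d z0)) = (\<lambda>d. 1 / av (per * z0) ^ n)"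
    using av_psum_small[OF z00 z0(2) n] by (intro ext) simp
  ultimately have "av (poly (goss_poly \<iota> per n) (tp z0)) = 1 / av (per * z0) ^ n"
    using LIMSEQ_unique tendsto_const by metis
  thus "goss_poly \<iota> per n \<noteq> 0" using z00 by auto
qed

end

section \<open>The two parts of the Hecke operator\<close>

context carlitz
begin

definition qdeg :: "'a poly \<Rightarrow> nat" where "qdeg a = CARD('a) ^ degree a"

lemma qdeg_pos [simp]: "qdeg a > 0"
  by (simp add: qdeg_def)

lemma degree_less_qdeg: "degree a < qdeg a"
proof -
  have "1 < CARD('a)" using q_gt_1 q_eq by simp
  thus ?thesis unfolding qdeg_def by (intro power_gt_expt) simp
qed

definition monic_prime :: "'a poly \<Rightarrow> bool" where
  "monic_prime p \<longleftrightarrow> prime_elem p \<and> lead_coeff p = 1"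

lemma monic_primeD:
  assumes "monic_prime p"
  shows "p \<noteq> 0" "A p \<noteq> 0" "degree p > 0" "lead_coeff p = 1"
    "p dvd a * b \<Longrightarrow> p dvd a \<or> p dvd b" "of_nat (qdeg p) = (0::'c)"
proof -
  show 0: "p \<noteq> 0" and "A p \<noteq> 0" "lead_coeff p = 1" using assms by (auto simp: monic_prime_def)
  show 1: "degree p > 0" using assms 0 by (auto simp: monic_prime_def prime_elem_def is_unit_iff_degree)
  show "p dvd a * b \<Longrightarrow> p dvd a \<or> p dvd b" 
    using assms by (auto simp: monic_prime_def prime_elem_dvd_mult_iff)
  show "of_nat (qdeg p) = (0::'c)" using 1 of_nat_CARD_C by (simp add: qdeg_def power_0_left)
qed

text \<open>\<open>c i m\<close> is the coefficient of \<open>t^m\<close> in the trace of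
  \<open>t^i\<close>. The three conditions are those that \<open>hte_double_series\<close> asks of
  \<open>H\<close>, with \<open>M = qdeg p\<close>.\<close>

definition trace_spec :: "'a poly \<Rightarrow> (nat \<Rightarrow> nat \<Rightarrow> 'c) \<Rightarrow> bool" where
  "trace_spec p c \<longleftrightarrow> (\<forall>i m. m * qdeg p < i \<longrightarrow> c i m = 0) \<and>
     (\<exists>B\<ge>1. \<forall>i m. av (c i m) \<le> B ^ Suc (i + m)) \<and>
     (\<forall>z. im z > 0 \<longrightarrow> (\<forall>i. (\<lambda>m. c i m * tp z ^ m) sums (\<Sum>\<beta>\<in>S (degree p). tp ((z + A \<beta>) / A p) ^ i)))"

definition torsion :: "'a poly \<Rightarrow> 'c set" where
  "torsion p = (\<lambda>\<beta>. ex (per * A \<beta> / A p)) ` S (degree p)"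

lemma inj_torsion: "p \<noteq> 0 \<Longrightarrow> inj_on (\<lambda>\<beta>. ex (per * A \<beta> / A p)) (S (degree p))"
proof (rule inj_onI)
  fix x y assume p: "p \<noteq> 0" and xy: "x \<in> S (degree p)" "y \<in> S (degree p)"
    and "ex (per * A x / A p) = ex (per * A y / A p)"
  then obtain a where a: "per * A x / A p - per * A y / A p = per * A a"
    unfolding ex_eq_iff by blast
  have "per * (A x - A y) = per * (A a * A p)" using a p by (simp add: field_simps)
  hence "A (x - y) = A (a * p)" by (simp add: A_diff A_mult)
  hence eq: "x - y = a * p" by simp
  have mem: "x - y \<in> S (degree p)" using xy by (rule small_polys_diff)
  show "x = y"
  proof (rule ccontr)
    assume "x \<noteq> y"
    hence "a \<noteq> 0" using eq by auto
    hence "degree p \<le> degree (x - y)" using p by (simp add: eq degree_mult_eq)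
    hence "lead_coeff (x - y) = 0" using mem unfolding small_polys_def by blast
    thus False using \<open>x \<noteq> y\<close> by (metis leading_coeff_0_iff right_minus_eq)
  qed
qed

lemma finite_subgroup_torsion: "finite_subgroup (torsion p)"
  unfolding finite_subgroup_def torsion_def
proof (intro conjI ballI)
  show "0 \<in> (\<lambda>\<beta>. ex (per * A \<beta> / A p)) ` S (degree p)" by (rule image_eqI[of _ _ 0]) auto
  fix x y assume "x \<in> (\<lambda>\<beta>. ex (per * A \<beta> / A p)) ` S (degree p)" "y \<in> (\<lambda>\<beta>. ex (per * A \<beta> / A p)) ` S (degree p)"
  then obtain a b where "x = ex (per * A a / A p)" "y = ex (per * A b / A p)" "a \<in> S (degree p)" "b \<in> S (degree p)"
    by blast
  thus "x - y \<in> (\<lambda>\<beta>. ex (per * A \<beta> / A p)) ` S (degree p)"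
    by (intro image_eqI[of _ _ "a - b"])
       (auto simp: A_diff right_diff_distrib small_polys_diff diff_divide_distrib ex_diff)
qed simp

lemma card_torsion: "p \<noteq> 0 \<Longrightarrow> card (torsion p) = qdeg p"
  unfolding torsion_def qdeg_def using inj_torsion[of p] card_small_polys[of "degree p", where 'a = 'a]
  by (simp add: card_image)

text \<open>The Carlitz polynomial of \<open>p\<close> is monic and vanishes on the torsion, whose
  cardinality is its degree; hence it is \<open>root_poly (torsion p)\<close>.\<close>

lemma root_poly_torsion:
  assumes "lead_coeff p = 1" shows "poly (root_poly (torsion p)) (ex (z / A p)) = ex z"
proof -
  have p0: "p \<noteq> 0" using assms by auto
  obtain P where P: "degree P = qdeg p" "lead_coeff P = 1" "coeff P 0 = 0" "\<And>z. ex (A p * z) = poly P (ex z)"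
    using carlitz_poly_exists[OF assms] unfolding qdeg_def by blast
  have "P = root_poly (torsion p)"
  proof (rule root_poly_eqI)
    show "finite (torsion p)" by (simp add: torsion_def)
    show "degree P = card (torsion p)" using P p0 by (simp add: card_torsion)
    fix l assume "l \<in> torsion p"
    then obtain \<beta> where "l = ex (per * A \<beta> / A p)" unfolding torsion_def by blast
    thus "poly P l = 0" using p0 by (simp flip: P(4))
  qed (rule P)
  thus ?thesis using P(4)[of "z / A p"] p0 by simp
qed

text \<open>With \<open>x = ex (per * z / A p)\<close> the values
  \<open>tp ((z + A \<beta>) / A p)\<close> are the reciprocals of the translates of
  \<open>x\<close> by torsion points, and \<open>root_poly_torsion\<close> turns the factor in front
  of their power sums into \<open>1 / tp z\<close>. So
  \<open>finite_subgroup_reciprocal_sums\<close> becomes the Goss recursion in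
  \<open>tp z\<close>.\<close>

lemma trace_spec_exists:
  assumes "monic_prime p" shows "\<exists>c. trace_spec p c"
proof -
  note p = monic_primeD[OF assms]
  let ?L = "torsion p"
  note L = finite_subgroup_torsion[of p]
  obtain k where k1: "\<And>x. x \<notin> ?L \<Longrightarrow> poly (root_poly ?L) x * (\<Sum>l\<in>?L. 1 / (x - l)) = k"
    and kn: "\<And>x n. x \<notin> ?L \<Longrightarrow> 2 \<le> n \<Longrightarrow> poly (root_poly ?L) x * (\<Sum>l\<in>?L. 1 / (x - l) ^ n) =
       (\<Sum>j=1..<n. coeff (root_poly ?L) j * (\<Sum>l\<in>?L. 1 / (x - l) ^ (n - j)))"
    using finite_subgroup_reciprocal_sums[OF L] by blast
  define \<epsilon> where "\<epsilon> = coeff (root_poly ?L)"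
  have fin: "finite ?L" by (simp add: torsion_def)
  define c where "c i m = coeff (goss_rec \<epsilon> k i) m" for i m
  have "c i m = 0" if "m * qdeg p < i" for i m
    unfolding c_def by (rule coeff_goss_rec_low[of "qdeg p"])
      (use that p in \<open>auto simp: \<epsilon>_def coeff_eq_0 degree_root_poly card_torsion\<close>)
  moreover have "\<exists>B\<ge>1. \<forall>i m. av (c i m) \<le> B ^ Suc (i + m)"
  proof -
    define B where "B = Max (insert 1 (insert (av k) ((\<lambda>j. av (\<epsilon> j)) ` {..qdeg p})))"
    have fB: "finite (insert 1 (insert (av k) ((\<lambda>j. av (\<epsilon> j)) ` {..qdeg p})))" by simp
    have B: "1 \<le> B" "av k \<le> B" unfolding B_def by (rule Max_ge[OF fB], simp)+
    have "av (\<epsilon> j) \<le> B" for j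
    proof (cases "j \<le> qdeg p")
      case True thus ?thesis unfolding B_def by (intro Max_ge fB) auto
    next
      case False thus ?thesis using B p by (simp add: \<epsilon>_def coeff_eq_0 degree_root_poly card_torsion)
    qed
    hence "av (c i m) \<le> B ^ i" for i m unfolding c_def using B by (intro av_coeff_goss_rec)
    moreover have "B ^ i \<le> B ^ Suc (i + m)" for i m using B by (intro power_increasing) auto
    ultimately show ?thesis using B(1) order_trans by blast
  qed
  moreover have "(\<lambda>m. c i m * tp z ^ m) sums (\<Sum>\<beta>\<in>S (degree p). tp ((z + A \<beta>) / A p) ^ i)"
    if z: "im z > 0" for z i
  proof -
    define x where "x = ex (per * z / A p)"
    have Px: "poly (root_poly ?L) x = ex (per * z)" unfolding x_def by (rule root_poly_torsion[OF p(4)])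
    have xL: "x \<notin> ?L" using Px ex_nonzero[OF z] fin poly_root_poly_eq_0_iff by metis
    have sums: "(\<Sum>\<beta>\<in>S (degree p). tp ((z + A \<beta>) / A p) ^ i) = (\<Sum>l\<in>?L. 1 / (x - l) ^ i)" for i
    proof -
      have "(\<Sum>l\<in>?L. 1 / (x - l) ^ i) = (\<Sum>\<beta>\<in>S (degree p). 1 / (x - ex (per * A \<beta> / A p)) ^ i)"
        unfolding torsion_def by (subst sum.reindex[OF inj_torsion[OF p(1)]]) simp
      also have "\<dots> = (\<Sum>\<beta>\<in>S (degree p). tp ((z + A \<beta>) / A p) ^ i)"
      proof (rule sum.reindex_bij_witness[of _ uminus uminus])
        fix \<beta> assume "\<beta> \<in> S (degree p)"
        have "per * ((z + A (- \<beta>)) / A p) = per * z / A p - per * A \<beta> / A p"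
          using p(2) by (simp add: A_minus field_simps)
        thus "tp ((z + A (- \<beta>)) / A p) ^ i = 1 / (x - ex (per * A \<beta> / A p)) ^ i"
          by (simp add: tp_eq x_def ex_diff power_one_over)
      qed (auto simp: small_polys_def)
      finally show ?thesis by simp
    qed
    have "(\<Sum>\<beta>\<in>S (degree p). tp ((z + A \<beta>) / A p) ^ i) = poly (goss_rec \<epsilon> k i) (tp z)"
    proof (cases "i = 0")
      case True
      have "card (S (degree p)) = qdeg p" using card_small_polys[where 'a = 'a] by (simp add: qdeg_def)
      thus ?thesis using True p(6) by (simp add: goss_rec_0)
    next
      case False
      show ?thesis unfolding sums
      proof (rule poly_goss_rec_unique)
        show "(\<Sum>l\<in>?L. 1 / (x - l) ^ 1) = tp z * k"
          using k1[OF xL] ex_nonzero[OF z] by (simp add: Px tp_eq field_simps)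
        show "(\<Sum>l\<in>?L. 1 / (x - l) ^ n) = tp z * (\<Sum>j=1..<n. \<epsilon> j * (\<Sum>l\<in>?L. 1 / (x - l) ^ (n - j)))"
          if "2 \<le> n" for n
          using kn[OF xL that] ex_nonzero[OF z] by (simp add: Px tp_eq \<epsilon>_def nonzero_eq_divide_eq mult.commute)
      qed (use False in simp)
    qed
    thus ?thesis using sums_poly[of "goss_rec \<epsilon> k i" "tp z"] by (simp add: c_def)
  qed
  ultimately have "trace_spec p c" unfolding trace_spec_def by blast
  thus ?thesis by blast
qed

definition trace_coeffs :: "'a poly \<Rightarrow> nat \<Rightarrow> nat \<Rightarrow> 'c" where
  "trace_coeffs p = (SOME c. trace_spec p c)"

lemma trace_coeffs: "monic_prime p \<Longrightarrow> trace_spec p (trace_coeffs p)"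
  unfolding trace_coeffs_def by (rule someI_ex[OF trace_spec_exists])

text \<open>Because \<open>trace_coeffs p i m\<close> vanishes for \<open>i > m * qdeg p\<close>,
  the sum stops there, and the operator is defined on all formal power series, convergent or
  not.\<close>

definition trace_op :: "'a poly \<Rightarrow> 'c fps \<Rightarrow> 'c fps" where
  "trace_op p F = Abs_fps (\<lambda>m. \<Sum>i\<le>m * qdeg p. fps_nth F i * trace_coeffs p i m)"

definition scale_op :: "'a poly \<Rightarrow> 'c fps \<Rightarrow> 'c fps" where
  "scale_op p F = F oo tau p"

lemma hte_trace_op:
  assumes p: "monic_prime p" and f: "hte f F"
  shows "hte (\<lambda>z. \<Sum>\<beta>\<in>S (degree p). f ((z + A \<beta>) / A p)) (trace_op p F)"
proof -
  note ts = trace_coeffs[OF p, unfolded trace_spec_def]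
  obtain B where B: "B \<ge> 1" "\<And>i m. av (trace_coeffs p i m) \<le> B ^ Suc (i + m)" using ts by blast
  obtain R where R: "R > 0" "\<And>z. im z \<ge> R \<Longrightarrow> (\<lambda>i. fps_nth F i * tp z ^ i) sums f z"
    using hteE[OF f] by blast
  have Ap: "av (A p) > 0" using monic_primeD(2)[OF p] by simp
  show ?thesis unfolding trace_op_def
  \<comment> \<open>Division by \<open>A p\<close> shrinks \<open>im\<close> by the factor
    \<open>av (A p)\<close>, so the radius grows by that factor.\<close>
  proof (rule hte_double_series[OF f, where C = B and R = "R * av (A p)" and
      h = "\<lambda>i z. \<Sum>\<beta>\<in>S (degree p). tp ((z + A \<beta>) / A p) ^ i"])
    fix z assume z: "R * av (A p) \<le> im z"
    have "0 < R * av (A p)" using R Ap by simp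
    hence imz: "im z > 0" using z by linarith
    show "(\<lambda>m. trace_coeffs p i m * tp z ^ m) sums (\<Sum>\<beta>\<in>S (degree p). tp ((z + A \<beta>) / A p) ^ i)" for i
      using ts imz by blast
    have "R \<le> im ((z + A \<beta>) / A p)" for \<beta>
      using z Ap by (simp add: im_divide_A monic_primeD(1)[OF p] pos_le_divide_eq)
    hence "(\<lambda>i. fps_nth F i * tp ((z + A \<beta>) / A p) ^ i) sums f ((z + A \<beta>) / A p)" for \<beta>
      by (rule R(2))
    hence "(\<lambda>i. \<Sum>\<beta>\<in>S (degree p). fps_nth F i * tp ((z + A \<beta>) / A p) ^ i) sums
        (\<Sum>\<beta>\<in>S (degree p). f ((z + A \<beta>) / A p))" by (intro sums_sum_av)
    thus "(\<lambda>i. fps_nth F i * (\<Sum>\<beta>\<in>S (degree p). tp ((z + A \<beta>) / A p) ^ i)) sums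
        (\<Sum>\<beta>\<in>S (degree p). f ((z + A \<beta>) / A p))" by (simp only: sum_distrib_left)
  qed (use ts B in auto)
qed

lemma tau_nth_0: "lead_coeff a = 1 \<Longrightarrow> fps_nth (tau a) 0 = 0"
  by (rule tau[of a]) (auto simp: fps_X_power_mult_nth)

lemma hte_scale_op:
  assumes p: "lead_coeff p = 1" and f: "hte f F"
  shows "hte (\<lambda>z. f (A p * z)) (scale_op p F)"
proof -
  have p0: "p \<noteq> 0" using p by auto
  have tau0: "fps_nth (tau p) 0 = 0" using tau_nth_0[OF p] .
  have ht: "hte (\<lambda>z. tp (A p * z)) (tau p)" by (rule tau[OF p])
  obtain B where B: "B \<ge> 1" "\<And>i. av (fps_nth (tau p) i) \<le> B ^ Suc i"
    using hte_tame[OF ht] unfolding tame_def by blast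
  obtain R where R: "R > 0" "\<And>z. im z \<ge> R \<Longrightarrow> (\<lambda>i. fps_nth F i * tp z ^ i) sums f z"
    using hteE[OF f] by blast
  obtain R' where R': "\<And>z. im z \<ge> R' \<Longrightarrow> (\<lambda>i. fps_nth (tau p) i * tp z ^ i) sums tp (A p * z)"
    using hteE[OF ht] by blast
  have "1 / (2 * B ^ 2) > 0" using B by simp
  then obtain R2 where R2: "R2 > 0" "\<And>z. im z \<ge> R2 \<Longrightarrow> av (tp z) \<le> 1 / (2 * B ^ 2)"
    using av_tp_small by blast
  have "hte (\<lambda>z. f (A p * z)) (Abs_fps (\<lambda>m. \<Sum>i\<le>m * 1. fps_nth F i * fps_nth (tau p ^ i) m))"
  proof (rule hte_double_series[OF f, where C = B and R = "max R (max R' R2)" and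
      h = "\<lambda>i z. tp (A p * z) ^ i"])
    fix i m :: nat assume "m * 1 < i"
    thus "fps_nth (tau p ^ i) m = 0" using tau0 by (simp add: startsby_zero_power_prefix)
  next
    fix i m
    have "B ^ (i + m) \<le> B ^ Suc (i + m)" using B by (intro power_increasing) auto
    thus "av (fps_nth (tau p ^ i) m) \<le> B ^ Suc (i + m)" using av_coeff_fps_power[OF B, of i m] by linarith
  next
    fix z i assume z: "max R (max R' R2) \<le> im z"
    have "B ^ 2 * av (tp z) \<le> B ^ 2 * (1 / (2 * B ^ 2))" using z R2 B by (intro mult_left_mono) auto
    also have "\<dots> < 1" using B by simp
    finally show "(\<lambda>m. fps_nth (tau p ^ i) m * tp z ^ m) sums (tp (A p * z) ^ i)"
      using z by (intro sums_fps_power[OF B] R') auto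
  next
    fix z assume z: "max R (max R' R2) \<le> im z"
    have "1 * im z \<le> av (A p) * im z" using av_A_ge_1[OF p0] by (intro mult_right_mono) auto
    hence "R \<le> im (A p * z)" using z by (simp add: im_mult_A)
    thus "(\<lambda>i. fps_nth F i * tp (A p * z) ^ i) sums f (A p * z)" by (rule R(2))
  qed (use B in auto)
  moreover have "Abs_fps (\<lambda>m. \<Sum>i\<le>m * 1. fps_nth F i * fps_nth (tau p ^ i) m) = scale_op p F"
    by (rule fps_ext) (simp add: scale_op_def fps_compose_nth atMost_atLeast0)
  ultimately show ?thesis by simp
qed

lemma scale_op_eq_0_iff: "lead_coeff p = 1 \<Longrightarrow> scale_op p F = 0 \<longleftrightarrow> F = 0"
proof -
  assume p: "lead_coeff p = 1"
  obtain W where W: "tau p = fps_X ^ (CARD('a) ^ degree p) * W" "fps_nth W 0 = 1" using tau[OF p] by blast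
  hence "tau p \<noteq> 0" by auto
  thus ?thesis unfolding scale_op_def using tau_nth_0[OF p] by (simp add: fps_compose_eq_0_iff)
qed

end

section \<open>Expansions of the Goss functions under trace and scaling\<close>

locale A_expansions = carlitz \<iota> q per
  for \<iota> :: "'a::{field,finite} fls \<Rightarrow> 'c::{field,complete_space}" and q per +
  fixes n :: nat
  assumes n_pos: "n > 0"
begin

abbreviation G :: "'c poly" where "G \<equiv> goss_poly \<iota> per n"

definition goss_fun :: "'c \<Rightarrow> 'c" where "goss_fun z = poly G (tp z)"
definition goss_fps :: "'a poly \<Rightarrow> 'c fps" where "goss_fps a = poly (map_poly fps_const G) (tau a)"

lemma hte_goss_fps: "lead_coeff a = 1 \<Longrightarrow> hte (\<lambda>z. goss_fun (A a * z)) (goss_fps a)"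
  unfolding goss_fun_def goss_fps_def by (intro hte_poly) (rule tau)

text \<open>Goss polynomials have no constant term, so \<open>goss_fps a\<close> has at least the
  order of \<open>tau a\<close>.\<close>

lemma goss_fps_low: 
  assumes "lead_coeff a = 1" "m < qdeg a" shows "fps_nth (goss_fps a) m = 0"
proof -
  obtain W where W: "tau a = fps_X ^ qdeg a * W"
    using tau[OF assms(1)] unfolding qdeg_def by blast
  obtain G' where G': "G = pCons 0 G'"
    using goss_poly_coeff_0[OF n_pos] by (metis coeff_pCons_0 pCons_cases)
  have "goss_fps a = fps_X ^ qdeg a * (W * poly (map_poly fps_const G') (tau a))"
    unfolding goss_fps_def G' by (simp add: map_poly_pCons W mult.assoc)
  thus ?thesis using assms(2) by (simp add: fps_X_power_mult_nth)
qed

lemma goss_fps_1_nonzero: "goss_fps 1 \<noteq> 0"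
proof
  assume "goss_fps 1 = 0"
  hence "coeff G i = 0" for i using fps_nth_poly_fps_X[of G i] by (simp add: goss_fps_def tau_1)
  hence "G = 0" by (simp add: poly_eq_iff)
  thus False using goss_poly_nonzero[OF n_pos] by simp
qed

lemma goss_fun_add_A [simp]: "goss_fun (z + A b) = goss_fun z"
  by (simp add: goss_fun_def)

lemma goss_fun_limit: "im z > 0 \<Longrightarrow> (\<lambda>d. psum n d z) \<longlonglongrightarrow> goss_fun z"
  unfolding goss_fun_def by (rule goss_poly_limit[OF n_pos])

text \<open>As \<open>p\<close> does not divide \<open>a\<close>, the products
  \<open>a * \<beta>\<close> run through all residues modulo \<open>p\<close>. The bound on
  \<open>degree a\<close> keeps them inside \<open>S (degree p + d)\<close>, and equal cardinalities
  turn injectivity into bijectivity.\<close>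

lemma small_polys_decompose:
  assumes p: "monic_prime p" and a: "\<not> p dvd a" and d: "degree a \<le> d"
  shows "bij_betw (\<lambda>(\<beta>, b). a * \<beta> + p * b) (S (degree p) \<times> S d) (S (degree p + d))"
proof -
  note pp = monic_primeD[OF p]
  let ?f = "\<lambda>(\<beta>, b). a * \<beta> + p * b"
  have deg: "x * y \<in> S (i + j)" if "degree x \<le> i" "y \<in> S j" for x y :: "'a poly" and i j
  proof (cases "y = 0")
    case False
    hence "degree y < j" using that(2) unfolding small_polys_def
      by (metis (mono_tags) leading_coeff_0_iff mem_Collect_eq not_le)
    hence "degree (x * y) < i + j" using degree_mult_le[of x y] that(1) by linarith
    thus ?thesis by (auto simp: small_polys_def coeff_eq_0)
  qed simp
  have inj: "inj_on ?f (S (degree p) \<times> S d)"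
  proof (rule inj_onI, clarify)
    fix x b y c assume xy: "x \<in> S (degree p)" "y \<in> S (degree p)" and eq: "a * x + p * b = a * y + p * c"
    have eq': "a * (x - y) = p * (c - b)" using eq by (simp add: algebra_simps)
    hence "p dvd a * (x - y)" by simp
    hence dvd: "p dvd x - y" using pp(5) a by blast
    have mem: "x - y \<in> S (degree p)" using xy by (rule small_polys_diff)
    have "x = y"
    proof (rule ccontr)
      assume ne: "x \<noteq> y"
      hence "degree p \<le> degree (x - y)" using dvd by (intro dvd_imp_degree_le) auto
      hence "lead_coeff (x - y) = 0" using mem unfolding small_polys_def by blast
      thus False using ne by (metis leading_coeff_0_iff right_minus_eq)
    qed
    thus "x = y \<and> b = c" using eq' pp(1) by simp
  qed
  have sub: "?f ` (S (degree p) \<times> S d) \<subseteq> S (degree p + d)"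
  proof clarify
    fix x b assume "x \<in> S (degree p)" "b \<in> S d"
    hence "a * x \<in> S (d + degree p)" "p * b \<in> S (degree p + d)" using d by (auto intro: deg)
    thus "a * x + p * b \<in> S (degree p + d)" by (simp add: add.commute[of d] small_polys_add)
  qed
  have "card (?f ` (S (degree p) \<times> S d)) = card (S (degree p + d) :: 'a poly set)"
    unfolding card_image[OF inj] using card_small_polys[where 'a = 'a] by (simp add: card_cartesian_product power_add)
  hence "?f ` (S (degree p) \<times> S d) = S (degree p + d)" by (intro card_subset_eq sub) auto
  thus ?thesis using inj by (simp add: bij_betw_def)
qed

text \<open>If \<open>p\<close> divides \<open>a\<close>, the arguments differ by polynomials, under
  which \<open>goss_fun\<close> is periodic. Otherwise the pairs of a residue and an index in
  \<open>S d\<close> correspond to \<open>S (degree p + d)\<close>, so the rearrangement is finite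
  at each truncation and the limit is taken last; clearing the denominator \<open>A p\<close> gives
  the factor \<open>A p ^ n\<close>.\<close>

lemma sum_goss_fun:
  assumes p: "monic_prime p" and z: "im z > 0" and a0: "a \<noteq> 0"
  shows "(\<Sum>\<beta>\<in>S (degree p). goss_fun (A a * ((z + A \<beta>) / A p))) =
     (if p dvd a then 0 else A p ^ n * goss_fun (A a * z))"
proof (cases "p dvd a")
  case True
  then obtain a' where a': "a = p * a'" by blast
  have "goss_fun (A a * ((z + A \<beta>) / A p)) = goss_fun (A a' * z)" for \<beta>
  proof -
    have "A a * ((z + A \<beta>) / A p) = A a' * z + A (a' * \<beta>)"
      using monic_primeD(2)[OF p] by (simp add: a' A_mult field_simps)
    thus ?thesis by simp
  qed
  moreover have "card (S (degree p)) = qdeg p" using card_small_polys[where 'a = 'a] by (simp add: qdeg_def)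
  ultimately show ?thesis using True monic_primeD(6)[OF p] by simp
next
  case False
  note pp = monic_primeD[OF p]
  have im': "im (A a * ((z + A \<beta>) / A p)) > 0" for \<beta>
    using z pp a0 by (simp add: im_mult_A im_divide_A)
  have "(\<lambda>d. \<Sum>\<beta>\<in>S (degree p). psum n d (A a * ((z + A \<beta>) / A p))) \<longlonglongrightarrow>
      (\<Sum>\<beta>\<in>S (degree p). goss_fun (A a * ((z + A \<beta>) / A p)))"
    by (intro lim_sum goss_fun_limit im')
  moreover have "(\<lambda>d. A p ^ n * psum n (d + degree p) (A a * z)) \<longlonglongrightarrow> A p ^ n * goss_fun (A a * z)"
    using z a0 by (intro lim_mult tendsto_const LIMSEQ_ignore_initial_segment goss_fun_limit) (simp add: im_mult_A)
  moreover have "(\<Sum>\<beta>\<in>S (degree p). psum n d (A a * ((z + A \<beta>) / A p))) = A p ^ n * psum n (d + degree p) (A a * z)"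
    if d: "degree a \<le> d" for d
  proof -
    have summand: "1 / (per * (A a * ((z + A \<beta>) / A p)) + per * A b) ^ n =
        A p ^ n * (1 / (per * (A a * z) + per * A (a * \<beta> + p * b)) ^ n)" for \<beta> b
    proof -
      have "per * (A a * ((z + A \<beta>) / A p)) + per * A b = (per * (A a * z) + per * A (a * \<beta> + p * b)) / A p"
        using pp(2) by (simp add: A_add A_mult field_simps)
      thus ?thesis by (simp add: power_divide)
    qed
    have "(\<Sum>\<beta>\<in>S (degree p). psum n d (A a * ((z + A \<beta>) / A p))) =
        (\<Sum>(\<beta>, b)\<in>S (degree p) \<times> S d. A p ^ n * (1 / (per * (A a * z) + per * A (a * \<beta> + p * b)) ^ n))"
      unfolding psum_def summand by (rule sum.cartesian_product)
    also have "\<dots> = (\<Sum>x\<in>S (degree p + d). A p ^ n * (1 / (per * (A a * z) + per * A x) ^ n))"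
      using sum.reindex_bij_betw[OF small_polys_decompose[OF p False d],
        of "\<lambda>x. A p ^ n * (1 / (per * (A a * z) + per * A x) ^ n)"] by (simp add: case_prod_unfold)
    finally show ?thesis by (simp add: psum_def sum_distrib_left add.commute)
  qed
  hence "eventually (\<lambda>d. (\<Sum>\<beta>\<in>S (degree p). psum n d (A a * ((z + A \<beta>) / A p))) =
     A p ^ n * psum n (d + degree p) (A a * z)) sequentially"
    unfolding eventually_sequentially by blast
  ultimately show ?thesis using False by (auto intro: LIMSEQ_unique dest: Lim_transform_eventually)
qed

lemma trace_op_goss_fps:
  assumes p: "monic_prime p" and a: "lead_coeff a = 1"
  shows "trace_op p (goss_fps a) = (if p dvd a then 0 else fps_const (A p ^ n) * goss_fps a)"
proof -
  have a0: "a \<noteq> 0" using a by auto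
  have 1: "hte (\<lambda>z. \<Sum>\<beta>\<in>S (degree p). goss_fun (A a * ((z + A \<beta>) / A p))) (trace_op p (goss_fps a))"
    by (rule hte_trace_op[OF p hte_goss_fps[OF a]])
  have "hte (\<lambda>z. if p dvd a then 0 else A p ^ n * goss_fun (A a * z)) (trace_op p (goss_fps a))"
    by (rule hte_cong[OF 1, of 1]) (rule sum_goss_fun[OF p _ a0], simp)
  moreover have "hte (\<lambda>z. if p dvd a then 0 else A p ^ n * goss_fun (A a * z))
      (if p dvd a then 0 else fps_const (A p ^ n) * goss_fps a)"
    using hte_const[of 0] hte_cmult[OF hte_goss_fps[OF a]] by auto
  ultimately show ?thesis by (rule hte_unique)
qed

lemma scale_op_goss_fps:
  assumes p: "lead_coeff p = 1" and a: "lead_coeff a = 1"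
  shows "scale_op p (goss_fps a) = goss_fps (p * a)"
proof -
  have "hte (\<lambda>z. goss_fun (A a * (A p * z))) (scale_op p (goss_fps a))" by (rule hte_scale_op[OF p hte_goss_fps[OF a]])
  moreover have "hte (\<lambda>z. goss_fun (A (p * a) * z)) (goss_fps (p * a))"
    by (rule hte_goss_fps) (simp add: lead_coeff_mult p a)
  ultimately show ?thesis by (intro hte_unique[of "\<lambda>z. goss_fun (A a * (A p * z))"]) (simp_all add: A_mult mult_ac)
qed

end

section \<open>Uniqueness of A-expansions\<close>

context A_expansions
begin

definition monics :: "nat \<Rightarrow> 'a poly set" where "monics m = {a \<in> S m. lead_coeff a = 1}"

lemma finite_monics [simp]: "finite (monics m)"
  by (simp add: monics_def)

lemma mem_monics_iff: "a \<in> monics m \<longleftrightarrow> lead_coeff a = 1 \<and> degree a < m"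
proof -
  have "a \<in> S m \<longleftrightarrow> degree a < m" if "lead_coeff a = 1"
  proof
    assume "a \<in> S m"
    thus "degree a < m" using that unfolding small_polys_def by (metis (mono_tags) mem_Collect_eq not_le zero_neq_one)
  qed (auto simp: small_polys_def coeff_eq_0)
  thus ?thesis by (auto simp: monics_def)
qed

text \<open>\<open>goss_fps a\<close> has order at least \<open>qdeg a\<close>, which exceeds
  \<open>degree a\<close>. Hence coefficient \<open>m\<close> only involves \<open>monics m\<close>,
  and the sum makes sense for every family \<open>c\<close>.\<close>

definition A_sum :: "('a poly \<Rightarrow> 'c) \<Rightarrow> 'c fps" where
  "A_sum c = Abs_fps (\<lambda>m. \<Sum>a\<in>monics m. c a * fps_nth (goss_fps a) m)"

lemma goss_fps_low_degree: "lead_coeff a = 1 \<Longrightarrow> m \<le> degree a \<Longrightarrow> fps_nth (goss_fps a) m = 0"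
  using goss_fps_low[of a m] degree_less_qdeg[of a] by simp

lemma A_sum_eq:
  assumes "finite X" "monics m \<subseteq> X" "\<And>a. a \<in> X \<Longrightarrow> lead_coeff a = 1"
  shows "(\<Sum>a\<in>X. c a * fps_nth (goss_fps a) m) = fps_nth (A_sum c) m"
  unfolding A_sum_def fps_nth_Abs_fps
  by (rule sum.mono_neutral_right) (use assms in \<open>auto simp: mem_monics_iff goss_fps_low_degree\<close>)

lemma A_sum_nth: "m \<le> d \<Longrightarrow> fps_nth (A_sum c) m = (\<Sum>a\<in>monics d. c a * fps_nth (goss_fps a) m)"
  by (rule A_sum_eq[symmetric]) (auto simp: mem_monics_iff)

text \<open>Coefficients are discrete, so each coefficient of the finite partial sums is eventually
  constant; adding \<open>monics m\<close> to a large finite index set reaches the coefficient of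
  \<open>A_sum\<close>.\<close>

lemma has_sum_A_sum:
  assumes "((\<lambda>a. fps_const (c a) * goss_fps a) has_sum F) {a. lead_coeff a = 1}"
  shows "F = A_sum c"
proof (rule fps_ext)
  fix m
  let ?A = "{a :: 'a poly. lead_coeff a = 1}"
  have "eventually (\<lambda>X. fps_nth (\<Sum>a\<in>X. fps_const (c a) * goss_fps a) m = fps_nth F m) (finite_subsets_at_top ?A)"
    using assms unfolding has_sum_def tendsto_fps_iff by (rule spec)
  then obtain X0 where X0: "finite X0 \<and> X0 \<subseteq> ?A \<and>
    (\<forall>X. finite X \<and> X0 \<subseteq> X \<and> X \<subseteq> ?A \<longrightarrow> fps_nth (\<Sum>a\<in>X. fps_const (c a) * goss_fps a) m = fps_nth F m)"
    unfolding eventually_finite_subsets_at_top by (elim exE)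
  have "fps_nth F m = fps_nth (\<Sum>a\<in>X0 \<union> monics m. fps_const (c a) * goss_fps a) m"
    by (rule X0[THEN conjunct2, THEN conjunct2, rule_format, symmetric])
       (use X0 in \<open>auto simp: mem_monics_iff simp del: fps_sum_nth\<close>)
  also have "\<dots> = (\<Sum>a\<in>X0 \<union> monics m. c a * fps_nth (goss_fps a) m)"
    by (simp add: fps_sum_nth)
  also have "\<dots> = fps_nth (A_sum c) m"
    by (rule A_sum_eq) (use X0 in \<open>auto simp: mem_monics_iff\<close>)
  finally show "fps_nth F m = fps_nth (A_sum c) m" .
qed

lemma A_sum_add: "A_sum (\<lambda>a. c a + c' a) = A_sum c + A_sum c'"
  by (rule fps_ext) (simp add: A_sum_def distrib_right sum.distrib)

lemma A_sum_diff: "A_sum (\<lambda>a. c a - c' a) = A_sum c - A_sum c'"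
  by (rule fps_ext) (simp add: A_sum_def left_diff_distrib sum_subtractf)

lemma A_sum_cmult: "A_sum (\<lambda>a. x * c a) = fps_const x * A_sum c"
  by (rule fps_ext) (simp add: A_sum_def sum_distrib_left mult.assoc)

lemma A_sum_0: "(\<And>a. lead_coeff a = 1 \<Longrightarrow> c a = 0) \<Longrightarrow> A_sum c = 0"
  by (rule fps_ext) (simp add: A_sum_def mem_monics_iff)

lemma trace_op_A_sum:
  assumes p: "monic_prime p"
  shows "trace_op p (A_sum c) = A_sum (\<lambda>a. if p dvd a then 0 else A p ^ n * c a)"
proof (rule fps_ext)
  fix m
  \<comment> \<open>Coefficient \<open>m\<close> of the trace only sees coefficients up to this
    index, where \<open>A_sum c\<close> is the finite sum over \<open>monics d\<close>; so only
    finite sums are interchanged.\<close>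
  define d where "d = m * qdeg p"
  have md: "m \<le> d" unfolding d_def by (simp add: Suc_le_eq)
  have "fps_nth (trace_op p (A_sum c)) m = (\<Sum>i\<le>d. \<Sum>a\<in>monics d. c a * (fps_nth (goss_fps a) i * trace_coeffs p i m))"
    unfolding trace_op_def d_def[symmetric] fps_nth_Abs_fps
    by (intro sum.cong refl) (simp add: A_sum_nth[of _ d] sum_distrib_right mult.assoc)
  also have "\<dots> = (\<Sum>a\<in>monics d. c a * fps_nth (trace_op p (goss_fps a)) m)"
    by (subst sum.swap) (simp add: trace_op_def d_def sum_distrib_left)
  also have "\<dots> = (\<Sum>a\<in>monics d. (if p dvd a then 0 else A p ^ n * c a) * fps_nth (goss_fps a) m)"
    by (rule sum.cong) (auto simp: mem_monics_iff trace_op_goss_fps[OF p])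
  also have "\<dots> = fps_nth (A_sum (\<lambda>a. if p dvd a then 0 else A p ^ n * c a)) m"
    by (rule A_sum_nth[OF md, symmetric])
  finally show "fps_nth (trace_op p (A_sum c)) m = fps_nth (A_sum (\<lambda>a. if p dvd a then 0 else A p ^ n * c a)) m" .
qed

lemma scale_op_A_sum:
  assumes p: "lead_coeff p = 1"
  shows "scale_op p (A_sum c) = A_sum (\<lambda>a. if p dvd a then c (a div p) else 0)"
proof (rule fps_ext)
  fix m
  have p0: "p \<noteq> 0" using p by auto
  have "fps_nth (scale_op p (A_sum c)) m = (\<Sum>i=0..m. \<Sum>a\<in>monics m. c a * (fps_nth (goss_fps a) i * fps_nth (tau p ^ i) m))"
    unfolding scale_op_def fps_compose_nth
    by (intro sum.cong refl) (simp add: A_sum_nth[of _ m] sum_distrib_right mult.assoc)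
  also have "\<dots> = (\<Sum>a\<in>monics m. c a * fps_nth (scale_op p (goss_fps a)) m)"
    by (subst sum.swap) (simp add: scale_op_def fps_compose_nth sum_distrib_left)
  also have "\<dots> = (\<Sum>a\<in>monics m. c a * fps_nth (goss_fps (p * a)) m)"
    by (rule sum.cong) (auto simp: mem_monics_iff scale_op_goss_fps[OF p])
  also have "\<dots> = (\<Sum>b\<in>(\<lambda>a. p * a) ` monics m. c (b div p) * fps_nth (goss_fps b) m)"
    using p0 by (subst sum.reindex) (auto simp: inj_on_def)
  \<comment> \<open>The index set is enlarged to contain \<open>monics m\<close>. A new
    \<open>b\<close> cannot be a multiple of \<open>p\<close>, since its quotient by
    \<open>p\<close> would already lie in \<open>monics m\<close>.\<close>
  also have "\<dots> = (\<Sum>b\<in>(\<lambda>a. p * a) ` monics m \<union> monics m. (if p dvd b then c (b div p) else 0) * fps_nth (goss_fps b) m)"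
  proof (rule sum.mono_neutral_cong_left)
    show "\<forall>b\<in>(\<lambda>a. p * a) ` monics m \<union> monics m - (\<lambda>a. p * a) ` monics m.
        (if p dvd b then c (b div p) else 0) * fps_nth (goss_fps b) m = 0"
    proof
      fix b assume b: "b \<in> (\<lambda>a. p * a) ` monics m \<union> monics m - (\<lambda>a. p * a) ` monics m"
      have "\<not> p dvd b"
      proof
        assume "p dvd b"
        then obtain a where a: "b = p * a" by blast
        hence la: "lead_coeff a = 1" using b p by (auto simp: mem_monics_iff lead_coeff_mult)
        hence "a \<noteq> 0" by auto
        hence "degree a \<le> degree b" using p0 by (simp add: a degree_mult_eq)
        hence "a \<in> monics m" using b la by (auto simp: mem_monics_iff)
        thus False using b a by blast
      qed
      thus "(if p dvd b then c (b div p) else 0) * fps_nth (goss_fps b) m = 0" by simp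
    qed
  qed auto
  also have "\<dots> = fps_nth (A_sum (\<lambda>a. if p dvd a then c (a div p) else 0)) m"
    by (rule A_sum_eq) (use p in \<open>auto simp: mem_monics_iff lead_coeff_mult\<close>)
  finally show "fps_nth (scale_op p (A_sum c)) m = fps_nth (A_sum (\<lambda>a. if p dvd a then c (a div p) else 0)) m" .
qed

text \<open>A nonconstant divisor of least degree, made monic, is irreducible.\<close>

lemma prime_factor_exists:
  assumes "degree a > 0" shows "\<exists>p. monic_prime p \<and> p dvd a"
proof -
  define Q where "Q d \<longleftrightarrow> (\<exists>x. x dvd a \<and> degree x = d \<and> d > 0)" for d
  have "Q (degree a)" using assms dvd_refl[of a] unfolding Q_def by blast
  hence "Q (LEAST d. Q d)" by (rule LeastI)
  then obtain x where x: "x dvd a" "degree x > 0" and xl: "degree x = (LEAST d. Q d)" unfolding Q_def by metis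
  have least: "degree x \<le> degree y" if "y dvd a" "degree y > 0" for y
    unfolding xl by (rule Least_le) (use that in \<open>auto simp: Q_def\<close>)
  have x0: "x \<noteq> 0" using x by auto
  define p where "p = smult (inverse (lead_coeff x)) x"
  have lp: "lead_coeff p = 1" and dp: "degree p = degree x" using x0 by (simp_all add: p_def)
  have pa: "p dvd a" using x x0 by (simp add: p_def smult_dvd)
  have "irreducible p"
  proof (rule irreducibleI)
    show "p \<noteq> 0" using lp by auto
    show "\<not> is_unit p" using dp x by (auto simp: is_unit_iff_degree[OF \<open>p \<noteq> 0\<close>])
    fix y z assume yz: "p = y * z"
    hence nz: "y \<noteq> 0" "z \<noteq> 0" using \<open>p \<noteq> 0\<close> by auto
    have "degree p = degree y + degree z" using nz by (simp add: yz degree_mult_eq)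
    moreover have "degree y > 0 \<Longrightarrow> degree p \<le> degree y"
      using least[of y] pa yz dp by (metis dvd_mult_left)
    ultimately have "degree y = 0 \<or> degree z = 0" by (cases "degree y > 0") auto
    thus "y dvd 1 \<or> z dvd 1" using nz by (auto simp: is_unit_iff_degree)
  qed
  hence "prime_elem p" by (rule field_poly_irreducible_imp_prime)
  thus ?thesis using lp pa by (auto simp: monic_prime_def)
qed

text \<open>The trace kills the coefficients at multiples of \<open>p\<close> and scales the others
  by the nonzero constant \<open>A p ^ n\<close>.\<close>

lemma A_sum_sieve_prime:
  assumes p: "monic_prime p" and "A_sum c = 0"
  shows "A_sum (\<lambda>a. if p dvd a then 0 else c a) = 0"
proof -
  have "(\<lambda>a. if p dvd a then 0 else A p ^ n * c a) = (\<lambda>a. A p ^ n * (if p dvd a then 0 else c a))" by auto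
  hence "fps_const (A p ^ n) * A_sum (\<lambda>a. if p dvd a then 0 else c a) = trace_op p (A_sum c)"
    by (simp add: trace_op_A_sum[OF p] flip: A_sum_cmult)
  also have "\<dots> = 0" unfolding assms(2) by (rule fps_ext) (simp add: trace_op_def)
  finally show ?thesis using monic_primeD(2)[OF p] by simp
qed

lemma A_sum_sieve:
  assumes "finite X" "\<And>p. p \<in> X \<Longrightarrow> monic_prime p" "A_sum c = 0"
  shows "A_sum (\<lambda>a. if \<exists>p\<in>X. p dvd a then 0 else c a) = 0"
  using assms(1,2)
proof (induction X rule: finite_induct)
  case (insert p X)
  have "A_sum (\<lambda>a. if p dvd a then 0 else if \<exists>p\<in>X. p dvd a then 0 else c a) = 0"
    using insert by (intro A_sum_sieve_prime) auto
  moreover have "(\<lambda>a. if p dvd a then 0 else if \<exists>p\<in>X. p dvd a then 0 else c a) =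
      (\<lambda>a. if \<exists>p\<in>insert p X. p dvd a then 0 else c a)" by auto
  ultimately show ?case by simp
qed (use assms(3) in simp)

text \<open>A single index \<open>m\<close> at which \<open>goss_fps 1\<close> has a nonzero
  coefficient suffices: only the finitely many \<open>a\<close> in \<open>monics m\<close> reach it,
  and sieving by the primes of degree less than \<open>m\<close> leaves just
  \<open>a = 1\<close>.\<close>

lemma A_sum_eq_0_imp_1:
  assumes "A_sum c = 0" shows "c 1 = 0"
proof (rule ccontr)
  assume c1: "c 1 \<noteq> 0"
  obtain m where m: "fps_nth (goss_fps 1) m \<noteq> 0" using goss_fps_1_nonzero by (auto simp: fps_eq_iff)
  define X where "X = {p. monic_prime p \<and> p \<in> S m}"
  have X: "finite X" "\<And>p. p \<in> X \<Longrightarrow> monic_prime p" unfolding X_def by auto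
  define c' where "c' a = (if \<exists>p\<in>X. p dvd a then 0 else c a)" for a
  have "c' a = 0" if a: "a \<in> monics m - {1}" for a
  proof -
    have "degree a > 0"
    proof (rule ccontr)
      assume "\<not> degree a > 0"
      then obtain x where "a = [:x:]" by (metis degree_eq_zeroE gr0I)
      thus False using a by (auto simp: mem_monics_iff one_pCons)
    qed
    then obtain p where p: "monic_prime p" "p dvd a" using prime_factor_exists by blast
    have "a \<noteq> 0" using a by (auto simp: mem_monics_iff)
    hence "degree p < m" using dvd_imp_degree_le[OF p(2)] a by (auto simp: mem_monics_iff)
    hence "p \<in> X" using p by (auto simp: X_def small_polys_def coeff_eq_0)
    thus ?thesis using p by (auto simp: c'_def)
  qed
  moreover have "1 \<in> monics m"
    using m goss_fps_low_degree[of 1 m] by (auto simp: mem_monics_iff intro: gr0I)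
  ultimately have "fps_nth (A_sum c') m = c' 1 * fps_nth (goss_fps 1) m"
    unfolding A_sum_def fps_nth_Abs_fps by (subst sum.remove[of _ 1]) auto
  moreover have "\<not> p dvd 1" if "p \<in> X" for p
    using X(2)[OF that] by (auto simp: monic_prime_def prime_elem_def)
  hence "c' 1 = c 1" by (auto simp: c'_def)
  moreover have "A_sum c' = 0" unfolding c'_def by (rule A_sum_sieve[OF X assms])
  ultimately show False using c1 m by simp
qed

text \<open>Subtracting the sieved sum leaves the multiples of a prime factor \<open>p\<close> of
  \<open>b\<close>. This part is \<open>scale_op p\<close> of the sum with coefficients
  \<open>c (p * a)\<close>, which therefore vanishes too; the induction on \<open>degree b\<close>
  has to vary \<open>c\<close> for this reason.\<close>

lemma A_sum_eq_0_imp: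
  assumes "A_sum c = 0" "lead_coeff b = 1" shows "c b = 0"
  using assms
proof (induction "degree b" arbitrary: b c rule: less_induct)
  case less
  show ?case
  proof (cases "degree b = 0")
    case True
    then obtain x where "b = [:x:]" by (metis degree_eq_zeroE)
    hence "b = 1" using less.prems(2) by (simp add: one_pCons)
    thus ?thesis using A_sum_eq_0_imp_1 less.prems by simp
  next
    case False
    then obtain p where p: "monic_prime p" "p dvd b" using prime_factor_exists by blast
    note pp = monic_primeD[OF p(1)]
    obtain b' where b': "b = p * b'" using p by blast
    have lb': "lead_coeff b' = 1" using less.prems(2) pp(4) by (simp add: b' lead_coeff_mult)
    hence "b' \<noteq> 0" by auto
    hence deg: "degree b' < degree b" using pp by (simp add: b' degree_mult_eq)
    have "scale_op p (A_sum (\<lambda>a. c (p * a))) = A_sum (\<lambda>a. if p dvd a then c (p * (a div p)) else 0)"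
      by (rule scale_op_A_sum[OF pp(4)])
    also have "(\<lambda>a. if p dvd a then c (p * (a div p)) else 0) = (\<lambda>a. c a - (if p dvd a then 0 else c a))"
      by auto
    also have "A_sum \<dots> = 0"
      unfolding A_sum_diff less.prems(1) A_sum_sieve_prime[OF p(1) less.prems(1)] by simp
    finally have "A_sum (\<lambda>a. c (p * a)) = 0" by (simp add: scale_op_eq_0_iff[OF pp(4)])
    from less.hyps[OF deg this lb'] show ?thesis by (simp add: b')
  qed
qed

text \<open>At multiples of \<open>p\<close> the equation reads
  \<open>ev * c (p * a) = \<kappa> * c a\<close>, elsewhere \<open>ev * c a = A p ^ n * c a\<close>.
  Take \<open>a\<close> of least degree with \<open>c a \<noteq> 0\<close>. If \<open>p\<close>
  divided \<open>a\<close>, the first relation at \<open>a div p\<close> would give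
  \<open>ev = 0\<close>, and then at \<open>a\<close> itself
  \<open>\<kappa> * c a = 0\<close>.\<close>

lemma A_sum_eigenvalue:
  assumes p: "monic_prime p" and \<kappa>: "\<kappa> \<noteq> 0" and nz: "A_sum c \<noteq> 0"
    and eq: "fps_const ev * A_sum c = fps_const \<kappa> * scale_op p (A_sum c) + trace_op p (A_sum c)"
  shows "ev = A p ^ n \<and> A p ^ n * c p = \<kappa> * c 1"
proof -
  note pp = monic_primeD[OF p]
  define d where "d a = ev * c a - (\<kappa> * (if p dvd a then c (a div p) else 0) +
      (if p dvd a then 0 else A p ^ n * c a))" for a
  have "A_sum d = fps_const ev * A_sum c - (fps_const \<kappa> * scale_op p (A_sum c) + trace_op p (A_sum c))"
    unfolding d_def scale_op_A_sum[OF pp(4)] trace_op_A_sum[OF p] by (simp only: A_sum_diff A_sum_add A_sum_cmult)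
  hence "A_sum d = 0" by (simp add: eq)
  hence d0: "d a = 0" if "lead_coeff a = 1" for a using A_sum_eq_0_imp that by blast
  have mult: "ev * c (p * a) = \<kappa> * c a" if "lead_coeff a = 1" for a
    using d0[of "p * a"] that pp by (simp add: d_def lead_coeff_mult)
  define Q where "Q m \<longleftrightarrow> (\<exists>a. lead_coeff a = 1 \<and> c a \<noteq> 0 \<and> degree a = m)" for m
  have "\<exists>m. Q m" using nz A_sum_0[of c] unfolding Q_def by blast
  hence "Q (LEAST m. Q m)" by (rule LeastI_ex)
  then obtain a where a: "lead_coeff a = 1" "c a \<noteq> 0" and al: "degree a = (LEAST m. Q m)"
    unfolding Q_def by metis
  have least: "c b = 0" if "lead_coeff b = 1" "degree b < degree a" for b
    using not_less_Least[of "degree b" Q] that unfolding al Q_def by blast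
  have ev: "ev = A p ^ n"
  proof (cases "p dvd a")
    case False
    thus ?thesis using d0[OF a(1)] a(2) by (simp add: d_def)
  next
    case True
    then obtain a' where a': "a = p * a'" by blast
    have la': "lead_coeff a' = 1" using a(1) pp(4) by (simp add: a' lead_coeff_mult)
    hence "a' \<noteq> 0" by auto
    hence "degree a' < degree a" using pp by (simp add: a' degree_mult_eq)
    hence "ev * c a = 0" using mult[OF la'] least[OF la'] by (simp add: a')
    hence "ev = 0" using a by simp
    hence "\<kappa> * c a = 0" using mult[OF a(1)] by simp
    thus ?thesis using \<kappa> a by simp
  qed
  thus ?thesis using mult[of 1] by simp
qed

lemma hecke_expansion:
  assumes p: "monic_prime p" and f: "hte f F" and eig: "\<And>z. z \<in> Omega \<iota> \<Longrightarrow> hecke \<iota> k p f z = ev * f z"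
  shows "fps_const ev * F = fps_const (A p powi k) * scale_op p F + trace_op p F"
proof (rule hte_unique)
  have S: "{\<beta>. degree \<beta> < degree p} = S (degree p)"
    using monic_primeD(3)[OF p] by (simp add: small_polys_eq_degree)
  have "hte (\<lambda>z. A p powi k * f (A p * z) + (\<Sum>\<beta>\<in>S (degree p). f ((z + A \<beta>) / A p)))
     (fps_const (A p powi k) * scale_op p F + trace_op p F)"
    by (intro hte_add hte_cmult hte_scale_op hte_trace_op f p monic_primeD(4)[OF p])
  thus "hte (\<lambda>z. ev * f z) (fps_const (A p powi k) * scale_op p F + trace_op p F)"
    by (rule hte_cong[of _ _ 1]) (simp add: eig[symmetric] Omega_iff_im hecke_def S)
qed (intro hte_cmult f)

end

section \<open>Gauss norms of rational functions\<close>

context C_inf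
begin

text \<open>Dividing \<open>p - [:poly p y0:]\<close> by \<open>X - y0\<close> lowers the degree by
  one, keeps the polynomial monic and worsens the bound by \<open>1 / \<delta>\<close>; after
  \<open>degree p\<close> steps the constant 1 is left.\<close>

lemma separated_points_bound:
  fixes p :: "'c poly"
  assumes "finite Y" "card Y = Suc (degree p)" "lead_coeff p = 1" "\<delta> > 0" "0 \<le> e"
    "\<And>x y. x \<in> Y \<Longrightarrow> y \<in> Y \<Longrightarrow> x \<noteq> y \<Longrightarrow> av (x - y) \<ge> \<delta>" "\<And>y. y \<in> Y \<Longrightarrow> av (poly p y) \<le> e"
  shows "1 \<le> e / \<delta> ^ degree p"
  using assms
proof (induction "degree p" arbitrary: p Y e)
  case 0
  then obtain y where "y \<in> Y" by fastforce
  moreover obtain c where "p = [:c:]" using 0 by (metis degree_eq_zeroE)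
  ultimately show ?case using 0(8)[of y] 0(4) by simp
next
  case (Suc d)
  obtain y0 where y0: "y0 \<in> Y" using Suc.prems(2) by fastforce
  have "poly (p - [:poly p y0:]) y0 = 0" by simp
  then obtain p1 where p1: "p - [:poly p y0:] = [:-y0, 1:] * p1" by (metis poly_eq_0_iff_dvd dvdE)
  have degc: "degree [:poly p y0:] < degree p" using Suc.hyps(2) by simp
  have dp: "degree (p - [:poly p y0:]) = degree p" using degc
    by (metis degree_add_eq_left degree_minus diff_conv_add_uminus)
  have lp: "lead_coeff (p - [:poly p y0:]) = 1"
    unfolding dp using Suc.prems(3) degc by (simp add: coeff_eq_0)
  have p1nz: "p1 \<noteq> 0" using lp p1 by auto
  have d1: "d = degree p1"
    using dp p1nz Suc.hyps(2) unfolding p1 by (subst (asm) degree_mult_eq) auto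
  have l1: "lead_coeff p1 = 1" using lp unfolding p1 lead_coeff_mult by simp
  have "1 \<le> (e / \<delta>) / \<delta> ^ degree p1"
  proof (rule Suc.hyps(1)[of p1 "Y - {y0}"])
    show "card (Y - {y0}) = Suc (degree p1)" using Suc.prems(1,2) y0 Suc.hyps(2) d1 by simp
    fix y assume y: "y \<in> Y - {y0}"
    have "poly p y - poly p y0 = (y - y0) * poly p1 y"
      using arg_cong[OF p1, of "\<lambda>p. poly p y"] by (simp add: algebra_simps)
    hence "av (y - y0) * av (poly p1 y) \<le> e"
      using Suc.prems(7)[of y] Suc.prems(7)[OF y0] y av_diff_le[of "poly p y" e "poly p y0"] by (simp flip: av_mult)
    moreover have "\<delta> * av (poly p1 y) \<le> av (y - y0) * av (poly p1 y)"
      using Suc.prems(6)[of y y0] y y0 by (intro mult_right_mono) auto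
    ultimately show "av (poly p1 y) \<le> e / \<delta>" using Suc.prems(4) by (simp add: field_simps)
  qed (use Suc.prems d1 l1 in auto)
  thus ?case using d1 by (simp flip: Suc.hyps(2))
qed

lemma monic_roots_bounded:
  assumes "lead_coeff p = 1" "degree p > 0" "\<And>i. av (coeff p i) \<le> B" "1 \<le> B" "poly p y = 0"
  shows "av (y::'c) \<le> B"
proof (rule ccontr)
  assume "\<not> av y \<le> B"
  hence y: "B < av y" by simp
  let ?d = "degree p"
  have "poly p y = (\<Sum>i<?d. coeff p i * y ^ i) + y ^ ?d"
    using assms(1) by (simp add: poly_altdef lessThan_Suc_atMost[symmetric])
  hence "av (y ^ ?d) = av (\<Sum>i<?d. coeff p i * y ^ i)"
    using assms(5) by (metis add_eq_0_iff2 av_minus)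
  also have "\<dots> \<le> B * av y ^ (?d - 1)"
  proof (rule av_sum_le)
    fix i assume "i \<in> {..<?d}"
    hence "av y ^ i \<le> av y ^ (?d - 1)" using y assms by (intro power_increasing) auto
    thus "av (coeff p i * y ^ i) \<le> B * av y ^ (?d - 1)"
      unfolding av_mult av_power using assms by (intro mult_mono) auto
  qed (use assms in simp)
  also have "\<dots> < av y * av y ^ (?d - 1)" using y assms by (intro mult_strict_right_mono zero_less_power) auto
  also have "\<dots> = av (y ^ ?d)" using assms(2) by (simp flip: power_Suc)
  finally show False by simp
qed

lemma dense_algebraic_part: "e > 0 \<Longrightarrow> \<exists>a\<in>algebraic_part \<iota>. av (x - a) < e"
proof -
  assume e: "e > 0"
  have "closure (algebraic_part \<iota>) = UNIV" using C_infinity unfolding C_infinity_def by (elim conjE)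
  hence "x \<in> closure (algebraic_part \<iota>)" by simp
  thus ?thesis using e unfolding closure_approachable by (auto simp: dist_av av_minus_commute[of x])
qed

text \<open>Roots of polynomials with algebraic coefficients tending to \<open>p\<close> are approximate roots of \<open>p\<close>.
  At most \<open>degree p\<close> of them are pairwise separated, so they form a totally bounded set and
  accumulate at a root of \<open>p\<close>.\<close>

lemma approximate_roots:
  assumes p: "lead_coeff p = 1" "degree p > 0"
  obtains y :: "nat \<Rightarrow> 'c" where "(\<lambda>m. av (poly p (y m))) \<longlonglongrightarrow> 0"
proof -
  let ?d = "degree p"
  define B where "B = Max (insert 1 ((\<lambda>i. av (coeff p i)) ` {..?d}))"
  have B1: "1 \<le> B" unfolding B_def by (intro Max_ge) auto
  have Bp: "av (coeff p i) \<le> B" for i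
  proof (cases "i \<le> ?d")
    case True thus ?thesis unfolding B_def by (intro Max_ge) auto
  qed (use B1 in \<open>simp add: coeff_eq_0\<close>)
  have "\<exists>y. av (poly p y) \<le> inverse (real (Suc m)) * B ^ ?d" for m
  proof -
    let ?e = "inverse (real (Suc m))"
    have "\<forall>i. \<exists>a\<in>algebraic_part \<iota>. av (coeff p i - a) < ?e" by (intro allI dense_algebraic_part) simp
    then obtain a where a: "\<And>i. a i \<in> algebraic_part \<iota>" "\<And>i. av (coeff p i - a i) < ?e" by metis
    \<comment> \<open>The leading coefficient stays 1 and the lower ones become algebraic
      approximations, so \<open>alg_root_exists\<close> applies to \<open>Q\<close>.\<close>
    define Q where "Q = Poly (map a [0..<?d]) + monom 1 ?d"
    have cQ: "coeff Q i = (if i < ?d then a i else if i = ?d then 1 else 0)" for i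
      by (auto simp: Q_def coeff_Poly_eq nth_default_def)
    have dQ: "degree Q = ?d" 
      by (intro antisym degree_le le_degree) (auto simp: cQ)
    have "coeff Q i \<in> algebraic_part \<iota>" for i
      using a(1) algebraic_part_iota[of 0] algebraic_part_iota[of 1] by (auto simp: cQ)
    then obtain y where y: "poly Q y = 0" using alg_root_exists[of Q] p dQ by auto
    have e1: "?e \<le> 1" by (simp add: inverse_le_1_iff)
    have diff: "av (coeff p i - coeff Q i) \<le> ?e" for i
      using a(2)[of i] p by (auto simp: cQ coeff_eq_0 intro: less_imp_le)
    have lQ: "lead_coeff Q = 1" unfolding dQ cQ by simp
    have BQ: "av (coeff Q i) \<le> B" for i
      using av_diff_le[OF Bp[of i], of "coeff p i - coeff Q i"] diff[of i] e1 B1 by simp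
    have yB: "av y \<le> B" by (rule monic_roots_bounded[OF lQ _ BQ B1 y]) (simp only: dQ p(2))
    have "poly p y = poly (p - Q) y" using y by simp
    also have "\<dots> = (\<Sum>i\<le>?d. coeff (p - Q) i * y ^ i)"
      unfolding poly_altdef
    proof (rule sum.mono_neutral_left)
      show "{..degree (p - Q)} \<subseteq> {..?d}" using degree_diff_le[of p ?d Q] dQ by simp
      show "\<forall>i\<in>{..?d} - {..degree (p - Q)}. coeff (p - Q) i * y ^ i = 0"
        using coeff_eq_0[of "p - Q"] by (simp del: coeff_diff)
    qed simp
    also have "av \<dots> \<le> ?e * B ^ ?d"
    proof (rule av_sum_le)
      fix i assume i: "i \<in> {..?d}"
      have "av y ^ i \<le> B ^ i" using yB by (intro power_mono) auto
      also have "\<dots> \<le> B ^ ?d" using B1 i by (intro power_increasing) auto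
      finally show "av (coeff (p - Q) i * y ^ i) \<le> ?e * B ^ ?d"
        unfolding av_mult av_power using diff[of i] by (intro mult_mono) auto
    qed (use B1 in simp)
    finally show ?thesis by blast
  qed
  then obtain y where y: "\<And>m. av (poly p (y m)) \<le> inverse (real (Suc m)) * B ^ ?d" by metis
  have "(\<lambda>m. inverse (real (Suc m)) * B ^ ?d) \<longlonglongrightarrow> 0 * B ^ ?d"
    by (intro tendsto_intros LIMSEQ_inverse_real_of_nat)
  hence "(\<lambda>m. poly p (y m)) \<longlonglongrightarrow> 0"
    by (intro lim_av_le[of "\<lambda>m. inverse (real (Suc m)) * B ^ ?d"]) (use y in auto)
  thus ?thesis using that[of y] by (simp add: tendsto_av_iff)
qed

lemma alg_closed:
  assumes "degree p > 0" shows "\<exists>y::'c. poly p y = 0"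
proof -
  define p' where "p' = smult (inverse (lead_coeff p)) p"
  have p0: "lead_coeff p \<noteq> 0" using assms by auto
  have p': "lead_coeff p' = 1" "degree p' > 0" using p0 assms by (simp_all add: p'_def)
  let ?d = "degree p'"
  obtain y where y: "(\<lambda>m. av (poly p' (y m))) \<longlonglongrightarrow> 0" using approximate_roots[OF p'] by blast
  have tb: "\<exists>k. finite k \<and> range y \<subseteq> (\<Union>x\<in>k. ball x e)" if e: "e > 0" for e
  proof -
    \<comment> \<open>Values of \<open>p'\<close> below half of \<open>e ^ ?d\<close> contradict
      \<open>separated_points_bound\<close> on any \<open>?d + 1\<close> points with mutual
      distances at least \<open>e\<close>.\<close>
    have "e ^ ?d / 2 > 0" using e by simp
    then obtain N where N: "\<And>m. m \<ge> N \<Longrightarrow> av (poly p' (y m)) < e ^ ?d / 2"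
      using order_tendstoD(2)[OF y, of "e ^ ?d / 2"] by (auto simp: eventually_sequentially)
    define sep where "sep X \<longleftrightarrow> finite X \<and> X \<subseteq> y ` {N..} \<and> (\<forall>x\<in>X. \<forall>z\<in>X. x \<noteq> z \<longrightarrow> av (x - z) \<ge> e)" for X
    have card: "card X \<le> ?d" if X: "sep X" for X
    proof (rule ccontr)
      assume "\<not> card X \<le> ?d"
      hence "Suc ?d \<le> card X" by (simp only: not_le Suc_le_eq)
      then obtain Y where Y: "Y \<subseteq> X" "card Y = Suc ?d" by (rule obtain_subset_with_card_n)
      have finY: "finite Y" using Y X by (auto simp: sep_def intro: finite_subset)
      have "1 \<le> (e ^ ?d / 2) / e ^ ?d"
      proof (rule separated_points_bound[OF finY Y(2) p'(1) e])
        show "e \<le> av (x - z)" if "x \<in> Y" "z \<in> Y" "x \<noteq> z" for x z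
          using that X Y(1) unfolding sep_def by blast
        fix z assume "z \<in> Y"
        then obtain m where "m \<ge> N" "z = y m" using X Y(1) unfolding sep_def by blast
        thus "av (poly p' z) \<le> e ^ ?d / 2" using N[of m] by simp
      qed (use e in simp)
      thus False using e by simp
    qed
    have "sep {}" by (simp add: sep_def)
    \<comment> \<open>A separated set of greatest cardinality is an \<open>e\<close>-net for the
      points of index at least \<open>N\<close>; the finitely many earlier points are added to
      it.\<close>
    then obtain X where X: "sep X" and max: "\<And>X'. sep X' \<Longrightarrow> card X' \<le> card X"
      using ex_has_greatest_nat[of sep "{}" card "Suc ?d"] card by (auto simp: less_Suc_eq_le)
    have "\<exists>x\<in>X. av (x - y m) < e" if m: "m \<ge> N" for m
    proof (rule ccontr)
      assume neg: "\<not> (\<exists>x\<in>X. av (x - y m) < e)"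
      hence notin: "y m \<notin> X" using e by auto
      have "sep (insert (y m) X)" using X neg m by (auto simp: sep_def not_less av_minus_commute[of "y m"])
      from max[OF this] show False using X notin by (simp add: sep_def)
    qed
    hence cover: "\<exists>x\<in>X \<union> y ` {..<N}. dist x (y m) < e" for m
    proof (cases "m < N")
      case True
      thus ?thesis using e by (intro bexI[of _ "y m"]) auto
    qed (auto simp: dist_av not_less)
    have "range y \<subseteq> (\<Union>x\<in>X \<union> y ` {..<N}. ball x e)"
    proof
      fix z assume "z \<in> range y"
      then obtain m where "z = y m" by blast
      thus "z \<in> (\<Union>x\<in>X \<union> y ` {..<N}. ball x e)" using cover[of m] by (simp only: UN_iff mem_ball)
    qed
    thus ?thesis using X by (intro exI[of _ "X \<union> y ` {..<N}"]) (auto simp: sep_def)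
  qed
  have "compact (closure (range y))" unfolding compact_eq_totally_bounded
  proof (intro conjI allI impI)
    show "complete (closure (range y))" by (simp add: complete_eq_closed)
    fix e :: real assume e: "e > 0"
    then obtain k where k: "finite k" "range y \<subseteq> (\<Union>x\<in>k. ball x (e / 2))" using tb[of "e / 2"] by auto
    have "closure (range y) \<subseteq> (\<Union>x\<in>k. cball x (e / 2))"
    proof (rule closure_minimal)
      show "range y \<subseteq> (\<Union>x\<in>k. cball x (e / 2))"
        by (rule order_trans[OF k(2)]) (intro UN_mono order_refl ball_subset_cball)
      show "closed (\<Union>x\<in>k. cball x (e / 2))" using k(1) by (intro closed_UN ballI closed_cball)
    qed
    also have "\<dots> \<subseteq> (\<Union>x\<in>k. ball x e)" using e by (intro UN_mono order_refl subsetI) simp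
    finally show "\<exists>k. finite k \<and> closure (range y) \<subseteq> (\<Union>x\<in>k. ball x e)" using k by blast
  qed
  hence "seq_compact (closure (range y))" by (rule compact_imp_seq_compact)
  then obtain l r where r: "strict_mono (r :: nat \<Rightarrow> nat)" "(y \<circ> r) \<longlonglongrightarrow> l"
    using closure_subset[of "range y"] by (elim seq_compactE[where f = y]) auto
  have "(\<lambda>m. av (poly p' ((y \<circ> r) m))) \<longlonglongrightarrow> av (poly p' l)" by (intro tendsto_av lim_poly r)
  moreover have "(\<lambda>m. av (poly p' ((y \<circ> r) m))) \<longlonglongrightarrow> 0"
    using LIMSEQ_subseq_LIMSEQ[OF y r(1)] by (simp add: o_def)
  ultimately have "av (poly p' l) = 0" using LIMSEQ_unique by blast
  thus ?thesis using p0 by (auto simp: p'_def)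
qed

lemma poly_splits:
  "p \<noteq> 0 \<Longrightarrow> \<exists>as. \<forall>z::'c. poly p z = lead_coeff p * prod_list (map (\<lambda>\<alpha>. z - \<alpha>) as)"
proof (induction "degree p" arbitrary: p)
  case 0
  then obtain c where "p = [:c:]" by (metis degree_eq_zeroE)
  thus ?case by (intro exI[of _ "[]"]) simp
next
  case (Suc d)
  then obtain y where "poly p y = 0" using alg_closed[of p] by auto
  then obtain p1 where p1: "p = [:-y, 1:] * p1" by (metis poly_eq_0_iff_dvd dvdE)
  hence nz: "p1 \<noteq> 0" using Suc.prems by auto
  have "degree p = 1 + degree p1" unfolding p1 using nz by (subst degree_mult_eq) auto
  then obtain as where as: "\<And>z. poly p1 z = lead_coeff p1 * prod_list (map (\<lambda>\<alpha>. z - \<alpha>) as)"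
    using Suc.hyps(1)[of p1] Suc.hyps(2) nz by auto
  have lp: "lead_coeff p = lead_coeff p1" unfolding p1 lead_coeff_mult by simp
  have "poly p z = (z - y) * poly p1 z" for z by (simp add: p1 algebra_simps)
  thus ?case unfolding lp as by (intro exI[of _ "y # as"]) simp
qed

section \<open>Rational functions through their zeros and poles\<close>

definition rat_fun :: "'c \<Rightarrow> 'c list \<Rightarrow> 'c list \<Rightarrow> 'c \<Rightarrow> 'c" where
  "rat_fun \<kappa> as bs w = \<kappa> * prod_list (map (\<lambda>\<alpha>. w - \<alpha>) as) / prod_list (map (\<lambda>\<beta>. w - \<beta>) bs)"

text \<open>The Gauss norm of \<open>rat_fun \<kappa> as bs\<close> on the circle of radius \<open>r\<close> around \<open>0\<close>.\<close>

definition gauss :: "'c \<Rightarrow> 'c list \<Rightarrow> 'c list \<Rightarrow> real \<Rightarrow> real" where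
  "gauss \<kappa> as bs r = av \<kappa> * prod_list (map (\<lambda>\<alpha>. max r (av \<alpha>)) as) / prod_list (map (\<lambda>\<beta>. max r (av \<beta>)) bs)"

text \<open>Zeros and poles are taken relative to \<open>x\<close>, so that circles around
  \<open>x\<close> become circles around 0. The zero polynomial \<open>P\<close> is covered by
  \<open>\<kappa> = 0\<close>.\<close>

lemma quotient_eq_rat_fun:
  assumes "Q \<noteq> 0"
  shows "\<exists>\<kappa> as bs. (\<forall>w. poly P (x + w) / poly Q (x + w) = rat_fun \<kappa> as bs w) \<and> (\<forall>\<beta>\<in>set bs. poly Q (x + \<beta>) = 0)"
proof -
  obtain bs where bs: "\<And>z. poly Q z = lead_coeff Q * prod_list (map (\<lambda>\<alpha>. z - \<alpha>) bs)"
    using poly_splits[OF assms] by blast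
  obtain \<kappa> as where as: "\<And>z. poly P z = \<kappa> * prod_list (map (\<lambda>\<alpha>. z - \<alpha>) as)"
  proof (cases "P = 0")
    case True thus ?thesis using that[of 0 "[]"] by simp
  qed (use poly_splits that in blast)
  have shift: "map (\<lambda>\<alpha>. x + w - \<alpha>) as = map (\<lambda>\<alpha>. w - \<alpha>) (map (\<lambda>\<alpha>. \<alpha> - x) as)" for w as
    by (simp add: algebra_simps)
  have "poly P (x + w) / poly Q (x + w) =
      rat_fun (\<kappa> / lead_coeff Q) (map (\<lambda>\<alpha>. \<alpha> - x) as) (map (\<lambda>\<alpha>. \<alpha> - x) bs) w" for w
    unfolding as bs rat_fun_def shift using assms by simp
  moreover have "poly Q (x + \<beta>) = 0" if "\<beta> \<in> set (map (\<lambda>\<alpha>. \<alpha> - x) bs)" for \<beta>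
    using that by (auto simp: bs prod_list_zero_iff)
  ultimately show ?thesis by blast
qed

lemma av_rat_fun: "av (rat_fun \<kappa> as bs w) = av \<kappa> * prod_list (map (\<lambda>\<alpha>. av (w - \<alpha>)) as) / prod_list (map (\<lambda>\<beta>. av (w - \<beta>)) bs)"
  by (simp add: rat_fun_def av_divide av_mult av_prod_list o_def)

lemma av_rat_fun_generic:
  assumes "\<And>\<alpha>. \<alpha> \<in> set as \<union> set bs \<Longrightarrow> av \<alpha> \<noteq> av w"
  shows "av (rat_fun \<kappa> as bs w) = gauss \<kappa> as bs (av w)"
proof -
  have *: "map (\<lambda>\<alpha>. av (w - \<alpha>)) l = map (\<lambda>\<alpha>. max (av w) (av \<alpha>)) l" if "set l \<subseteq> set as \<union> set bs" for l
    using assms that by (intro map_cong refl av_diff_neq) force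
  show ?thesis unfolding av_rat_fun gauss_def *[OF Un_upper1] *[OF Un_upper2] ..
qed

lemma prod_list_mono_nonneg:
  "(\<And>x. x \<in> set l \<Longrightarrow> 0 \<le> f x \<and> f x \<le> (g x::real)) \<Longrightarrow> prod_list (map f l) \<le> prod_list (map g l) \<and> 0 \<le> prod_list (map f l)"
  by (induction l) (auto intro!: mult_mono mult_nonneg_nonneg intro: order_trans)

lemma prod_list_max_pos: "r > 0 \<Longrightarrow> prod_list (map (\<lambda>\<beta>. max r (av \<beta>)) bs) > 0"
  by (induction bs) (auto simp: less_max_iff_disj)

lemma gauss_nonneg: "r > 0 \<Longrightarrow> gauss \<kappa> as bs r \<ge> 0"
  unfolding gauss_def using prod_list_max_pos[of r as] prod_list_max_pos[of r bs]
  by (simp add: divide_nonneg_nonneg)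

text \<open>The assumption says that no pole is nearer to \<open>w\<close> than \<open>av w\<close>.
  Each denominator factor is then at least its value in the Gauss norm, while numerator factors
  never exceed theirs.\<close>

lemma av_rat_fun_le:
  assumes "w \<noteq> 0" "\<And>\<beta>. \<beta> \<in> set bs \<Longrightarrow> av w \<le> av (w - \<beta>)"
  shows "av (rat_fun \<kappa> as bs w) \<le> gauss \<kappa> as bs (av w)"
proof -
  have "max (av w) (av \<beta>) \<le> av (w - \<beta>)" if "\<beta> \<in> set bs" for \<beta>
    using assms(2)[OF that] av_diff_eq'[of w \<beta>] by (cases "av \<beta> \<le> av w") auto
  hence "prod_list (map (\<lambda>\<beta>. max (av w) (av \<beta>)) bs) \<le> prod_list (map (\<lambda>\<beta>. av (w - \<beta>)) bs)"
    by (intro prod_list_mono_nonneg[THEN conjunct1]) (auto simp: le_max_iff_disj)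
  moreover have "prod_list (map (\<lambda>\<alpha>. av (w - \<alpha>)) as) \<le> prod_list (map (\<lambda>\<alpha>. max (av w) (av \<alpha>)) as)"
    by (intro prod_list_mono_nonneg[THEN conjunct1]) (auto simp: av_diff)
  ultimately show ?thesis unfolding av_rat_fun gauss_def
    using prod_list_max_pos[of "av w" bs] assms(1) prod_list_max_pos[of "av w" as]
    by (intro frac_le mult_left_mono mult_nonneg_nonneg) auto
qed

lemma isCont_gauss: "r > 0 \<Longrightarrow> isCont (gauss \<kappa> as bs) r"
proof -
  assume r: "r > 0"
  have *: "isCont (\<lambda>r. prod_list (map (\<lambda>\<alpha>. max r (av \<alpha>)) l)) r" for l
    by (induction l) (auto intro!: continuous_intros)
  show ?thesis unfolding gauss_def[abs_def] using prod_list_max_pos[OF r, of bs]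
    by (intro continuous_intros *) auto
qed

lemma powr_split: "x > 0 \<Longrightarrow> x powr (1 - \<theta>) * x powr \<theta> = (x::real)"
  by (simp flip: powr_add)

lemma max_log_convex:
  assumes "0 < a" "0 < b" "0 \<le> \<theta>" "\<theta> \<le> 1" "0 \<le> x"
  shows "max (a powr (1 - \<theta>) * b powr \<theta>) x \<le> max a x powr (1 - \<theta>) * max b x powr (\<theta>::real)"
proof (rule max.boundedI)
  show "a powr (1 - \<theta>) * b powr \<theta> \<le> max a x powr (1 - \<theta>) * max b x powr \<theta>"
    using assms by (intro mult_mono powr_mono2) auto
  show "x \<le> max a x powr (1 - \<theta>) * max b x powr \<theta>"
  proof (cases "x = 0")
    case False
    have "x powr (1 - \<theta>) * x powr \<theta> \<le> max a x powr (1 - \<theta>) * max b x powr \<theta>"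
      using assms by (intro mult_mono powr_mono2) auto
    thus ?thesis using False assms by (simp add: powr_split)
  qed simp
qed

text \<open>The logarithm of \<open>max r (av \<alpha>)\<close> is convex in \<open>ln r\<close>,
  which is the right direction for the numerator only. In the denominator equality is needed; it
  holds because no pole has its absolute value strictly between \<open>a\<close> and
  \<open>b\<close>, so each factor is either constant or equal to \<open>r\<close> there.\<close>

lemma gauss_log_convex:
  assumes ab: "0 < a" "a \<le> b" and \<theta>: "0 \<le> \<theta>" "\<theta> \<le> 1"
    and bs: "\<And>\<beta>. \<beta> \<in> set bs \<Longrightarrow> av \<beta> \<le> a \<or> b \<le> av \<beta>"
  shows "gauss \<kappa> as bs (a powr (1 - \<theta>) * b powr \<theta>) \<le> gauss \<kappa> as bs a powr (1 - \<theta>) * gauss \<kappa> as bs b powr \<theta>"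
proof -
  let ?r = "a powr (1 - \<theta>) * b powr \<theta>"
  define N where "N l r = prod_list (map (\<lambda>\<alpha>. max r (av \<alpha>)) l)" for l :: "'c list" and r :: real
  have b: "0 < b" using ab by simp
  have r: "0 < ?r" using ab b by simp
  have Npos: "N l s > 0" if "s > 0" for l s unfolding N_def using that by (rule prod_list_max_pos)
  have up: "N l ?r \<le> N l a powr (1 - \<theta>) * N l b powr \<theta>" for l
  proof (induction l)
    case (Cons \<alpha> l)
    have "N (\<alpha> # l) ?r = max ?r (av \<alpha>) * N l ?r" by (simp add: N_def)
    also have "\<dots> \<le> (max a (av \<alpha>) powr (1 - \<theta>) * max b (av \<alpha>) powr \<theta>) * (N l a powr (1 - \<theta>) * N l b powr \<theta>)"
      using Cons Npos[OF r, of l] ab b \<theta> by (intro mult_mono max_log_convex) auto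
    also have "\<dots> = N (\<alpha> # l) a powr (1 - \<theta>) * N (\<alpha> # l) b powr \<theta>"
      using Npos[OF ab(1), of l] Npos[OF b, of l] ab b
      by (simp add: N_def powr_mult le_max_iff_disj)
    finally show ?case .
  qed (simp add: N_def)
  have "set l \<subseteq> set bs \<Longrightarrow> N l ?r = N l a powr (1 - \<theta>) * N l b powr \<theta>" for l
  proof (induction l)
    case (Cons \<beta> l)
    have ra: "a \<le> ?r"
    proof -
      have "a powr (1 - \<theta>) * a powr \<theta> \<le> ?r" using ab \<theta> by (intro mult_left_mono powr_mono2) auto
      thus ?thesis using ab by (simp add: powr_split)
    qed
    have rb: "?r \<le> b"
    proof -
      have "?r \<le> b powr (1 - \<theta>) * b powr \<theta>" using ab \<theta> by (intro mult_right_mono powr_mono2) auto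
      thus ?thesis using b by (simp add: powr_split)
    qed
    have "max ?r (av \<beta>) = max a (av \<beta>) powr (1 - \<theta>) * max b (av \<beta>) powr \<theta>"
    proof (cases "av \<beta> \<le> a")
      case True thus ?thesis using ra ab by (simp add: max_absorb1)
    next
      case False
      hence "b \<le> av \<beta>" using bs Cons.prems by auto
      moreover from this have "0 < av \<beta>" using b by linarith
      ultimately show ?thesis using rb ab by (simp add: max_absorb2 powr_split del: av_pos_iff)
    qed
    moreover have "N l ?r = N l a powr (1 - \<theta>) * N l b powr \<theta>" using Cons by simp
    ultimately have "N (\<beta> # l) ?r = (max a (av \<beta>) powr (1 - \<theta>) * max b (av \<beta>) powr \<theta>) * (N l a powr (1 - \<theta>) * N l b powr \<theta>)"
      by (simp add: N_def)
    also have "\<dots> = N (\<beta> # l) a powr (1 - \<theta>) * N (\<beta> # l) b powr \<theta>"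
      using Npos[OF ab(1), of l] Npos[OF b, of l] ab b
      by (simp add: N_def powr_mult le_max_iff_disj)
    finally show ?case .
  qed (simp add: N_def)
  hence low: "N bs ?r = N bs a powr (1 - \<theta>) * N bs b powr \<theta>" by simp
  have "gauss \<kappa> as bs ?r = av \<kappa> * N as ?r / N bs ?r" by (simp add: gauss_def N_def)
  also have "\<dots> \<le> av \<kappa> * (N as a powr (1 - \<theta>) * N as b powr \<theta>) / N bs ?r"
    using up[of as] Npos[OF r, of bs] by (intro divide_right_mono mult_left_mono) auto
  also have "\<dots> = (av \<kappa> * N as a / N bs a) powr (1 - \<theta>) * (av \<kappa> * N as b / N bs b) powr \<theta>"
  proof (cases "\<kappa> = 0")
    case False
    have "av \<kappa> powr (1 - \<theta>) * av \<kappa> powr \<theta> = av \<kappa>" using False by (intro powr_split) simp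
    thus ?thesis unfolding low
      using Npos[OF ab(1), of as] Npos[OF b, of as] Npos[OF ab(1), of bs] Npos[OF b, of bs]
      by (simp add: powr_mult powr_divide field_simps)
  qed simp
  finally show ?thesis by (simp add: gauss_def N_def)
qed

text \<open>Roots of powers of \<open>T\<close> have absolute values \<open>q^\<rho>\<close> with
  \<open>\<rho>\<close> any rational number, and these are dense.\<close>

lemma value_group_dense:
  assumes "0 < u" "u < v" "finite X"
  shows "\<exists>w::'c. u < av w \<and> av w < v \<and> av w \<notin> X"
proof -
  \<comment> \<open>The minimum \<open>v'\<close> is the least element of \<open>X\<close> above
    \<open>u\<close>, capped by \<open>v\<close>; the open interval from \<open>u\<close> to
    \<open>v'\<close> avoids \<open>X\<close>.\<close>
  define X' where "X' = insert v {x \<in> X. u < x}"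
  have X': "finite X'" "X' \<noteq> {}" using assms by (auto simp: X'_def)
  define v' where "v' = Min X'"
  have v': "u < v'" "v' \<le> v" using X' assms by (auto simp: v'_def X'_def)
  have avoid: "x \<notin> X" if "u < x" "x < v'" for x
    using that X' Min_le[of X' x] unfolding v'_def X'_def by fastforce
  have "log q u < log q v'" using v' assms q_gt_1 by simp
  then obtain \<rho> where \<rho>: "\<rho> \<in> \<rat>" "log q u < \<rho>" "\<rho> < log q v'" using Rats_dense_in_real by blast
  from \<rho>(1) obtain i :: int and N :: nat where iN: "N > 0" "\<rho> = of_int i / real N"
    by (elim Rats_cases') (metis of_int_of_nat_eq of_nat_0_less_iff zero_less_imp_eq_int of_nat_less_0_iff)
  define j where "j = - i"
  obtain w where w: "w ^ N = \<iota> (fls_X_intpow j)" using nth_root_exists[OF iN(1)] by blast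
  have pw: "av w ^ N = q powi i"
    using arg_cong[OF w, of av] by (simp add: av_iota j_def[symmetric]) (simp add: j_def)
  have w0: "av w > 0"
  proof (rule ccontr)
    assume "\<not> av w > 0"
    hence "w = 0" by simp
    thus False using pw iN by (simp add: power_0_left)
  qed
  have "real N * log q (av w) = log q (av w ^ N)" using w0 by (simp add: log_nat_power)
  also have "\<dots> = log q (q powr of_int i)" unfolding pw by (subst powr_real_of_int') auto
  also have "\<dots> = of_int i" using q_gt_1 by (simp add: log_powr_cancel)
  finally have "real N * log q (av w) = of_int i" .
  hence "log q (av w) = \<rho>" using iN by (metis nonzero_mult_div_cancel_left of_nat_0_less_iff less_irrefl)
  hence "u < av w" "av w < v'" using \<rho> w0 q_gt_1 assms v' by (auto simp: log_less_cancel_iff)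
  thus ?thesis using v' avoid by (intro exI[of _ w]) auto
qed

end

section \<open>An identity theorem for rigid analytic functions\<close>

context C_inf
begin

lemma Omega_aff_iff: "z \<in> Omega_aff \<iota> n \<longleftrightarrow> av z \<le> q ^ n \<and> 1 / q ^ n \<le> im z"
  by (simp add: Omega_aff_def im_def av_def q_eq)

text \<open>\<open>av w\<close> lies strictly between two consecutive absolute values of the image
  of \<open>\<iota>\<close>, so \<open>w\<close> never cancels against an element of it.\<close>

lemma im_eq_av:
  assumes "q powi j < av w" "av w < q powi (j + 1)" shows "im (\<iota> x + w) = av w"
proof -
  have "av w \<le> av (w - \<iota> y)" for y
  proof -
    have "av w \<noteq> av (\<iota> y)"
    proof
      assume eq: "av w = av (\<iota> y)"
      have "0 < q powi j" by simp
      hence "0 < av (\<iota> y)" using assms(1) eq by linarith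
      hence "y \<noteq> 0" by simp
      define i where "i = - fls_subdegree y"
      have i: "av w = q powi i" using eq \<open>y \<noteq> 0\<close> by (simp add: av_iota i_def)
      show False
      proof (cases "i \<le> j")
        case True
        hence "q powi i \<le> q powi j" using q_gt_1 by (intro power_int_increasing) auto
        thus False using assms(1) i by simp
      next
        case False
        hence "q powi (j + 1) \<le> q powi i" using q_gt_1 by (intro power_int_increasing) auto
        thus False using assms(2) i by simp
      qed
    qed
    hence "av (w - \<iota> y) = max (av w) (av (\<iota> y))" by (rule av_diff_neq)
    thus ?thesis by simp
  qed
  hence "av w \<le> im w" by (simp add: le_im_iff)
  hence "im w = av w" using im_le_av[of w] by simp
  thus ?thesis using im_add_iota[of w x] by (simp add: add.commute)
qed

text \<open>At a pole \<open>rat_fun\<close> takes the value 0 by the convention for division, so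
  the estimate alone would not keep poles off the affinoid; their exclusion is recorded
  separately.\<close>

definition approximant :: "nat \<Rightarrow> 'a fls \<Rightarrow> ('c \<Rightarrow> 'c) \<Rightarrow> real \<Rightarrow> 'c \<Rightarrow> 'c list \<Rightarrow> 'c list \<Rightarrow> bool" where
  "approximant n x f \<epsilon> \<kappa> as bs \<longleftrightarrow> (\<forall>\<beta>\<in>set bs. \<iota> x + \<beta> \<notin> Omega_aff \<iota> n) \<and>
     (\<forall>w. \<iota> x + w \<in> Omega_aff \<iota> n \<longrightarrow> av (f (\<iota> x + w) - rat_fun \<kappa> as bs w) < \<epsilon>)"

lemma approximant_exists:
  assumes "rigid_analytic \<iota> f" "\<epsilon> > 0" "z0 \<in> Omega_aff \<iota> n"
  shows "\<exists>\<kappa> as bs. approximant n x f \<epsilon> \<kappa> as bs"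
proof -
  obtain P Q where PQ: "\<And>z. z \<in> Omega_aff \<iota> n \<Longrightarrow> poly Q z \<noteq> 0 \<and> dist (f z) (poly P z / poly Q z) < \<epsilon>"
    using assms unfolding rigid_analytic_def by metis
  have "Q \<noteq> 0" using PQ[OF assms(3)] by auto
  then obtain \<kappa> as bs where r: "\<And>w. poly P (\<iota> x + w) / poly Q (\<iota> x + w) = rat_fun \<kappa> as bs w"
    "\<And>\<beta>. \<beta> \<in> set bs \<Longrightarrow> poly Q (\<iota> x + \<beta>) = 0" using quotient_eq_rat_fun by metis
  have "approximant n x f \<epsilon> \<kappa> as bs"
    unfolding approximant_def
  proof (intro conjI ballI allI impI)
    fix \<beta> assume "\<beta> \<in> set bs"
    thus "\<iota> x + \<beta> \<notin> Omega_aff \<iota> n" using r(2) PQ by blast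
  next
    fix w assume "\<iota> x + w \<in> Omega_aff \<iota> n"
    from PQ[OF this] show "av (f (\<iota> x + w) - rat_fun \<kappa> as bs w) < \<epsilon>" by (simp add: r(1) dist_av)
  qed
  thus ?thesis by blast
qed

text \<open>\<open>vanishes n x f r\<close> says that the Gauss norm of \<open>f\<close> on the circle of radius \<open>r\<close>
  around \<open>\<iota> x\<close> is zero.\<close>

definition vanishes :: "nat \<Rightarrow> 'a fls \<Rightarrow> ('c \<Rightarrow> 'c) \<Rightarrow> real \<Rightarrow> bool" where
  "vanishes n x f r \<longleftrightarrow> (\<forall>\<epsilon> \<kappa> as bs. approximant n x f \<epsilon> \<kappa> as bs \<longrightarrow> gauss \<kappa> as bs r \<le> \<epsilon>)"

lemma annulus_in_Omega_aff:
  assumes "av (\<iota> x) \<le> q ^ n" "- int n \<le> j" "j < int n" "q powi j < av w" "av w < q powi (j + 1)"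
  shows "\<iota> x + w \<in> Omega_aff \<iota> n"
proof -
  have "q powi (j + 1) \<le> q powi int n" using assms q_gt_1 by (intro power_int_increasing) auto
  hence "av (\<iota> x + w) \<le> q ^ n" using assms by (intro av_add_le) auto
  moreover have "q powi (- int n) \<le> q powi j" using assms q_gt_1 by (intro power_int_increasing) auto
  hence "1 / q ^ n \<le> av w" using assms by (simp add: power_int_minus inverse_eq_divide)
  ultimately show ?thesis using im_eq_av[OF assms(4,5), of x] by (simp add: Omega_aff_iff)
qed

text \<open>A radius near \<open>r\<close> that avoids all zeros and poles in \<open>zs\<close>, so
  that Gauss norms there are absolute values at an actual point. \<open>h\<close> encodes a strict
  inequality between norms, which survives by continuity.\<close>

lemma generic_radius:
  fixes h :: "real \<Rightarrow> real"
  assumes "0 < u" "u < v" "u \<le> r" "r \<le> v" "isCont h r" "0 < h r"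
  obtains w :: 'c where "u < av w" "av w < v" "0 < h (av w)"
    "\<And>\<kappa> as bs. set as \<union> set bs \<subseteq> set zs \<Longrightarrow> av (rat_fun \<kappa> as bs w) = gauss \<kappa> as bs (av w)"
proof -
  have "eventually (\<lambda>s. h s > 0) (at r)"
    using assms(5,6) unfolding isCont_def by (rule order_tendstoD(1))
  then obtain \<delta> where \<delta>: "\<delta> > 0" "\<And>s. s \<noteq> r \<Longrightarrow> dist s r < \<delta> \<Longrightarrow> h s > 0"
    unfolding eventually_at by blast
  have "\<exists>w::'c. max u (r - \<delta>) < av w \<and> av w < min v (r + \<delta>) \<and> av w \<notin> insert r (av ` set zs)"
    by (rule value_group_dense) (use assms \<delta>(1) in \<open>auto simp: less_max_iff_disj\<close>)
  then obtain w :: 'c where w: "max u (r - \<delta>) < av w" "av w < min v (r + \<delta>)" "av w \<notin> insert r (av ` set zs)"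
    by blast
  show ?thesis
  proof (rule that[of w])
    show "0 < h (av w)" using w by (intro \<delta>(2)) (auto simp: dist_real_def)
    fix \<kappa> as bs assume sub: "set as \<union> set bs \<subseteq> set zs"
    show "av (rat_fun \<kappa> as bs w) = gauss \<kappa> as bs (av w)"
    proof (rule av_rat_fun_generic)
      fix \<alpha> assume "\<alpha> \<in> set as \<union> set bs"
      hence "av \<alpha> \<in> av ` set zs" using sub by blast
      thus "av \<alpha> \<noteq> av w" using w(3) by (metis insertI2)
    qed
  qed (use w in auto)
qed

text \<open>Gauss norms are continuous in the radius, so smallness on the open annulus extends to
  its bounding circles. In the application these have powers of \<open>q\<close> as radii, where
  points of the circle may leave the affinoid; hence norms, not values, are passed from one annulus
  to the next.\<close>

lemma vanishes_closed_annulus: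
  assumes "0 < u" "u < v" "u \<le> r" "r \<le> v"
    and zero: "\<And>w. u < av w \<Longrightarrow> av w < v \<Longrightarrow> \<iota> x + w \<in> Omega_aff \<iota> n \<and> f (\<iota> x + w) = 0"
  shows "vanishes n x f r"
  unfolding vanishes_def
proof (intro allI impI, rule ccontr)
  fix \<epsilon> \<kappa> as bs assume app: "approximant n x f \<epsilon> \<kappa> as bs" and "\<not> gauss \<kappa> as bs r \<le> \<epsilon>"
  hence gt: "\<epsilon> < gauss \<kappa> as bs r" by simp
  have r0: "0 < r" using assms by linarith
  have "isCont (\<lambda>s. gauss \<kappa> as bs s - \<epsilon>) r" by (intro continuous_intros isCont_gauss[OF r0])
  then obtain w :: 'c where w: "u < av w" "av w < v" "0 < gauss \<kappa> as bs (av w) - \<epsilon>"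
    "av (rat_fun \<kappa> as bs w) = gauss \<kappa> as bs (av w)"
    using gt by (elim generic_radius[OF assms(1-4), where zs = "as @ bs"]) auto
  have "av (rat_fun \<kappa> as bs w) < \<epsilon>"
    using app zero[OF w(1,2)] unfolding approximant_def by force
  thus False using w by simp
qed

text \<open>A three circles argument: an approximant has norm at most \<open>\<epsilon>\<close> at
  the outer radius and a bound \<open>M\<close> independent of \<open>\<epsilon>\<close> at the
  inner one, so by log-convexity it is at most \<open>M^(1 - \<theta>) * \<epsilon>^\<theta>\<close>
  at \<open>w\<close>, which tends to 0 with \<open>\<epsilon>\<close>.\<close>

lemma vanishes_inward:
  assumes rig: "rigid_analytic \<iota> f" and x: "av (\<iota> x) \<le> q ^ n" and j: "- int n \<le> j" "j < int n"
    and van: "vanishes n x f (q powi (j + 1))" and w: "q powi j < av w" "av w < q powi (j + 1)"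
  shows "f (\<iota> x + w) = 0"
proof (rule ccontr)
  assume "f (\<iota> x + w) \<noteq> 0"
  hence fw: "av (f (\<iota> x + w)) > 0" by simp
  define a where "a = q powi j"
  define b where "b = q powi (j + 1)"
  have a0: "0 < a" and b0: "0 < b" by (simp_all add: a_def b_def)
  have ab: "a < b" unfolding a_def b_def using q_gt_1 by (intro power_int_strict_increasing) auto
  have mem: "\<iota> x + w' \<in> Omega_aff \<iota> n" if "a < av w'" "av w' < b" for w'
    using annulus_in_Omega_aff[OF x j] that by (simp add: a_def b_def)
  have wab: "a < av w" "av w < b" using w by (simp_all add: a_def b_def)
  define \<theta> where "\<theta> = (ln (av w) - ln a) / (ln b - ln a)"
  have lnab: "ln a < ln b" using ab a0 by simp
  have "ln a < ln (av w)" "ln (av w) < ln b" using wab a0 by (auto simp del: av_pos_iff)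
  hence \<theta>: "0 < \<theta>" "\<theta> < 1" using lnab by (simp_all add: \<theta>_def field_simps)
  have r: "a powr (1 - \<theta>) * b powr \<theta> = av w"
  proof -
    have "\<theta> * (ln b - ln a) = ln (av w) - ln a" using lnab by (simp add: \<theta>_def)
    hence "(1 - \<theta>) * ln a + \<theta> * ln b = ln (av w)" by (simp add: algebra_simps)
    moreover have "av w > 0" using wab a0 by linarith
    ultimately show ?thesis using a0 b0 by (simp add: powr_def flip: exp_add)
  qed
  \<comment> \<open>One fixed approximant with error 1 provides the bound at the inner radius for
    all finer ones.\<close>
  obtain \<kappa>1 as1 bs1 where app1: "approximant n x f 1 \<kappa>1 as1 bs1"
    using approximant_exists[OF rig _ mem[OF wab]] zero_less_one by blast
  define M where "M = max 1 (gauss \<kappa>1 as1 bs1 a)"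
  have M1: "1 \<le> M" by (simp add: M_def)
  define M' where "M' = M powr (1 - \<theta>)"
  have M'0: "M' > 0" using M1 by (simp add: M'_def)
  define D where "D = av (f (\<iota> x + w))"
  \<comment> \<open>The last entry solves \<open>M' * \<epsilon>^\<theta> \<le> D / 2\<close>; the
    others make the approximation error at most \<open>D / 2\<close> and at most 1.\<close>
  define \<epsilon> where "\<epsilon> = min (min 1 (D / 2)) ((D / (2 * M')) powr (1 / \<theta>))"
  have D0: "D > 0" using fw by (simp add: D_def)
  have e0: "\<epsilon> > 0" using D0 M'0 by (simp add: \<epsilon>_def)
  obtain \<kappa> as bs where app: "approximant n x f \<epsilon> \<kappa> as bs"
    using approximant_exists[OF rig e0 mem[OF wab]] by blast
  have poles: "av \<beta> \<le> a \<or> b \<le> av \<beta>" if "\<beta> \<in> set bs" for \<beta>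
    using app mem[of \<beta>] that unfolding approximant_def by force
  have close: "av (rat_fun \<kappa> as bs w' - rat_fun \<kappa>1 as1 bs1 w') < 1" if "a < av w'" "av w' < b" for w'
  proof -
    have "av (f (\<iota> x + w') - rat_fun \<kappa> as bs w') < 1"
      using app mem[OF that] unfolding approximant_def by (force simp: \<epsilon>_def)
    moreover have "av (f (\<iota> x + w') - rat_fun \<kappa>1 as1 bs1 w') < 1"
      using app1 mem[OF that] unfolding approximant_def by force
    ultimately show ?thesis using av_diff_lt[of "f (\<iota> x + w') - rat_fun \<kappa>1 as1 bs1 w'" 1 "f (\<iota> x + w') - rat_fun \<kappa> as bs w'"]
      by simp
  qed
  \<comment> \<open>Near \<open>a\<close> there is a radius where both Gauss norms are values at one
    point; a norm above \<open>M\<close> would make the difference of the approximants there larger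
    than 1, against \<open>close\<close>.\<close>
  have ga: "gauss \<kappa> as bs a \<le> M"
  proof (rule ccontr)
    assume "\<not> gauss \<kappa> as bs a \<le> M"
    hence g: "1 < gauss \<kappa> as bs a" "gauss \<kappa>1 as1 bs1 a < gauss \<kappa> as bs a" by (auto simp: M_def)
    have "isCont (\<lambda>s. min (gauss \<kappa> as bs s - 1) (gauss \<kappa> as bs s - gauss \<kappa>1 as1 bs1 s)) a"
      by (intro continuous_intros isCont_gauss[OF a0])
    then obtain w' where w': "a < av w'" "av w' < b" "gauss \<kappa> as bs (av w') > 1"
      "gauss \<kappa>1 as1 bs1 (av w') < gauss \<kappa> as bs (av w')" "av (rat_fun \<kappa> as bs w') = gauss \<kappa> as bs (av w')"
      "av (rat_fun \<kappa>1 as1 bs1 w') = gauss \<kappa>1 as1 bs1 (av w')"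
      using g ab by (elim generic_radius[OF a0 ab order_refl less_imp_le[OF ab], where zs = "as @ bs @ as1 @ bs1"]) auto
    note w'(3)
    moreover have "av (rat_fun \<kappa> as bs w' - rat_fun \<kappa>1 as1 bs1 w') = av (rat_fun \<kappa> as bs w')"
      using w' by (intro av_diff_eq) simp
    ultimately show False using close[of w'] w' by simp
  qed
  have gb: "gauss \<kappa> as bs b \<le> \<epsilon>" using van app unfolding vanishes_def b_def by blast
  have "w \<noteq> 0" using wab a0 by auto
  hence "av (rat_fun \<kappa> as bs w) \<le> gauss \<kappa> as bs (av w)"
  proof (rule av_rat_fun_le)
    fix \<beta> assume "\<beta> \<in> set bs"
    hence "av w \<noteq> av \<beta>" using poles wab by force
    thus "av w \<le> av (w - \<beta>)" by (simp add: av_diff_neq)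
  qed
  also have "\<dots> \<le> gauss \<kappa> as bs a powr (1 - \<theta>) * gauss \<kappa> as bs b powr \<theta>"
    using gauss_log_convex[OF a0 _ _ _ poles, where \<theta> = \<theta> and \<kappa> = \<kappa> and as = as] ab \<theta> r by simp
  also have "\<dots> \<le> M' * \<epsilon> powr \<theta>"
    unfolding M'_def using ga gb gauss_nonneg[OF a0] gauss_nonneg[OF b0] \<theta>
    by (intro mult_mono powr_mono2) auto
  also have "\<dots> \<le> M' * ((D / (2 * M')) powr (1 / \<theta>)) powr \<theta>"
    using M'0 e0 \<theta> by (intro mult_left_mono powr_mono2) (auto simp: \<epsilon>_def)
  also have "\<dots> = D / 2" using \<theta> M'0 D0 by (simp add: powr_powr)
  finally have 1: "av (rat_fun \<kappa> as bs w) \<le> D / 2" .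
  have "av (f (\<iota> x + w) - rat_fun \<kappa> as bs w) < \<epsilon>"
    using app mem[OF wab] unfolding approximant_def by blast
  also have "\<epsilon> \<le> D / 2" by (simp add: \<epsilon>_def)
  finally have "av (f (\<iota> x + w) - rat_fun \<kappa> as bs w) \<le> D / 2" by simp
  from av_add_le[OF this 1] have "D \<le> D / 2" by (simp add: D_def)
  thus False using D0 by simp
qed

text \<open>The circles around a closest point \<open>\<iota> x\<close> to \<open>z0\<close> lead from infinity to \<open>z0\<close>.\<close>

theorem rigid_analytic_identity:
  assumes rig: "rigid_analytic \<iota> f" and far: "\<And>z. im z \<ge> R \<Longrightarrow> f z = 0" and z0: "z0 \<in> Omega \<iota>"
  shows "f z0 = 0"
proof -
  have im0: "im z0 > 0" using z0 by (simp add: Omega_iff_im)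
  obtain x where x: "av (z0 - \<iota> x) = im z0" using closest_range[OF im0] by blast
  define w0 where "w0 = z0 - \<iota> x"
  obtain n1 where n1: "max (max (av (\<iota> x)) (av z0)) (max R (max (im z0) (1 / im z0))) < q ^ n1"
    using real_arch_pow[OF q_gt_1] by blast
  \<comment> \<open>The outermost annulus, from \<open>q ^ n1\<close> to \<open>q ^ n\<close>, then
    lies in the affinoid and beyond \<open>R\<close>, so \<open>f\<close> vanishes on it.\<close>
  define n where "n = Suc n1"
  have qn: "q ^ n1 \<le> q ^ n" using q_gt_1 by (auto simp: n_def intro!: power_increasing)
  have xn: "av (\<iota> x) \<le> q ^ n" using n1 qn by simp
  have inv: "1 / q ^ n \<le> im z0"
  proof -
    have "1 / im z0 \<le> q ^ n" using n1 qn by simp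
    thus ?thesis using im0 by (simp add: field_simps)
  qed
  have start: "vanishes n x f r" if "q powi (int n - 1) \<le> r" "r \<le> q powi (int n - 1)" for r
  proof (rule vanishes_closed_annulus[of "q powi (int n - 1)" "q powi (int n - 1 + 1)"])
    show "0 < q powi (int n - 1)" by simp
    show "q powi (int n - 1) < q powi (int n - 1 + 1)"
      using q_gt_1 by (intro power_int_strict_increasing) auto
    thus "r \<le> q powi (int n - 1 + 1)" using that by simp
    fix w :: 'c assume w: "q powi (int n - 1) < av w" "av w < q powi (int n - 1 + 1)"
    have "q powi (int n - 1) = q ^ n1" by (simp add: n_def)
    hence "R \<le> im (\<iota> x + w)" using im_eq_av[OF w, of x] w n1 by simp
    thus "\<iota> x + w \<in> Omega_aff \<iota> n \<and> f (\<iota> x + w) = 0"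
      using annulus_in_Omega_aff[OF xn _ _ w] far by (simp add: n_def)
  qed (rule that(1))
  \<comment> \<open>Descent by one annulus at a time from exponent \<open>n - 1\<close> to
    \<open>- n\<close>, the lowest one inside the affinoid; this explains the bound
    \<open>2 * n - 1\<close> on \<open>k\<close>.\<close>
  have all: "vanishes n x f r" if "k \<le> 2 * n - 1" "q powi (int n - 1 - int k) \<le> r" "r \<le> q powi (int n - 1)" for k r
    using that
  proof (induction k arbitrary: r)
    case 0 thus ?case using start by simp
  next
    case (Suc k)
    define j where "j = int n - 1 - int (Suc k)"
    have j1: "j + 1 = int n - 1 - int k" by (simp add: j_def)
    show ?case
    proof (cases "q powi (j + 1) \<le> r")
      case True
      thus ?thesis using Suc j1 by simp
    next
      case False
      have jn: "- int n \<le> j" "j < int n" using Suc.prems(1) by (auto simp: j_def)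
      have "q powi (j + 1) \<le> q powi (int n - 1)" using q_gt_1 by (intro power_int_increasing) (auto simp: j1)
      hence van: "vanishes n x f (q powi (j + 1))" using Suc by (simp add: j1)
      show ?thesis
      proof (rule vanishes_closed_annulus[of "q powi j" "q powi (j + 1)"])
        show "q powi j < q powi (j + 1)" using q_gt_1 by (intro power_int_strict_increasing) auto
        fix w :: 'c assume w: "q powi j < av w" "av w < q powi (j + 1)"
        show "\<iota> x + w \<in> Omega_aff \<iota> n \<and> f (\<iota> x + w) = 0"
          using annulus_in_Omega_aff[OF xn jn w] vanishes_inward[OF rig xn jn van w] by blast
      qed (use False Suc.prems in \<open>auto simp: j_def\<close>)
    qed
  qed
  have "vanishes n x f (im z0)"
  proof (rule all[of "2 * n - 1"])
    have "int n - 1 - int (2 * n - 1) = - int n" by (simp add: n_def)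
    thus "q powi (int n - 1 - int (2 * n - 1)) \<le> im z0"
      using inv by (simp add: power_int_minus inverse_eq_divide)
    show "im z0 \<le> q powi (int n - 1)" using n1 by (simp add: n_def)
  qed simp
  hence van: "gauss \<kappa> as bs (im z0) \<le> \<epsilon>" if "approximant n x f \<epsilon> \<kappa> as bs" for \<epsilon> \<kappa> as bs
    using that unfolding vanishes_def by blast
  have z0n: "z0 \<in> Omega_aff \<iota> n" using n1 qn inv by (simp add: Omega_aff_iff)
  have zw: "z0 = \<iota> x + w0" by (simp add: w0_def)
  have avw: "av w0 = im z0" using x by (simp add: w0_def)
  have "av (f z0) \<le> \<epsilon>" if e: "\<epsilon> > 0" for \<epsilon>
  proof -
    obtain \<kappa> as bs where app: "approximant n x f \<epsilon> \<kappa> as bs" using approximant_exists[OF rig e z0n] by blast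
    have "av (rat_fun \<kappa> as bs w0) \<le> gauss \<kappa> as bs (av w0)"
    proof (rule av_rat_fun_le)
      show "w0 \<noteq> 0" using avw im0 by auto
      fix \<beta> assume \<beta>: "\<beta> \<in> set bs"
      show "av w0 \<le> av (w0 - \<beta>)"
      \<comment> \<open>A pole nearer to \<open>z0\<close> than \<open>im z0\<close> would have
        imaginary part at least \<open>im z0\<close> and absolute value at most
        \<open>q ^ n\<close>, hence lie in the affinoid, where the approximant has none.\<close>
      proof (rule ccontr)
        assume "\<not> av w0 \<le> av (w0 - \<beta>)"
        hence less: "av (w0 - \<beta>) < im z0" using avw by simp
        have eq: "\<iota> x + \<beta> = z0 - (w0 - \<beta>)" by (simp add: w0_def)
        have "im z0 \<le> av (\<iota> x + \<beta> - \<iota> y)" for y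
        proof -
          have "av (w0 - \<beta>) < av (z0 - \<iota> y)" using less im_le[of z0 y] by linarith
          from av_diff_eq[OF this] show ?thesis using im_le[of z0 y] by (simp add: w0_def algebra_simps)
        qed
        hence "im z0 \<le> im (\<iota> x + \<beta>)" by (simp add: le_im_iff)
        moreover have "av (\<iota> x + \<beta>) \<le> q ^ n"
          unfolding eq by (rule av_diff_le) (use less n1 qn in auto)
        ultimately have "\<iota> x + \<beta> \<in> Omega_aff \<iota> n" using inv by (simp add: Omega_aff_iff)
        thus False using app \<beta> unfolding approximant_def by blast
      qed
    qed
    hence 1: "av (rat_fun \<kappa> as bs w0) \<le> \<epsilon>" using van[OF app] avw by simp
    have "av (f z0 - rat_fun \<kappa> as bs w0) \<le> \<epsilon>"
      using app z0n zw unfolding approximant_def by force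
    from av_add_le[OF this 1] show ?thesis by simp
  qed
  hence "av (f z0) \<le> 0" by (rule field_le_epsilon[where y = 0, simplified])
  hence "av (f z0) = 0" by (intro order_antisym av_nonneg)
  thus ?thesis by simp
qed

end

theorem theorem2p3:
  fixes \<iota> :: "'a::{field,finite} fls \<Rightarrow> 'c::{field,complete_space}"
    and per :: 'c
    and k m :: int
    and n :: nat
    and f :: "'c \<Rightarrow> 'c"
    and c0 :: 'c
    and c :: "'a poly \<Rightarrow> 'c"
    and wp :: "'a poly"
    and ev :: 'c
  assumes "C_infinity \<iota>"
    and "carlitz_period \<iota> per"
    and "f \<in> cusp_forms \<iota> per k m"
    and "has_A_expansion \<iota> per f n c0 c"
    and "prime_elem wp" and "lead_coeff wp = 1"
    and "hecke_eigenform \<iota> k wp f ev"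
  shows "ev = emb_A \<iota> wp ^ n \<and> c wp = emb_A \<iota> wp powi (k - int n) * c 1"
proof -
  interpret A_expansions \<iota> "real CARD('a)" per n
    using assms by unfold_locales (auto simp: has_A_expansion_def)
  have p: "monic_prime wp" using assms by (simp add: monic_prime_def)
  note Awp = monic_primeD(2)[OF p]
  obtain F where F: "hte f F" using assms(3) by (auto simp: cusp_forms_def modular_forms_def)
  have Fexp: "t_expansion \<iota> per f = F" by (rule t_expansion_eqI[OF F])
  have F0: "fps_nth F 0 = 0" using assms(3) Fexp by (simp add: cusp_forms_def)
  obtain Sm where Sm: "((\<lambda>a. fps_const (c a) * goss_fps a) has_sum Sm) {a. lead_coeff a = 1}"
    and FS: "F = fps_const c0 + Sm"
    using assms(4) unfolding has_A_expansion_def Fexp goss_fps_def tau_def by blast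
  have "Sm = A_sum c" by (rule has_sum_A_sum[OF Sm])
  \<comment> \<open>There is no monic polynomial in \<open>monics 0\<close>, so
    \<open>A_sum c\<close> has no constant term and the cusp condition gives
    \<open>c0 = 0\<close>.\<close>
  moreover have "fps_nth (A_sum c) 0 = 0" 
    unfolding A_sum_def fps_nth_Abs_fps by (rule sum.neutral) (auto simp: mem_monics_iff)
  ultimately have FAS: "F = A_sum c" using FS F0 by simp
  have "F \<noteq> 0"
  proof
    assume "F = 0"
    then obtain R where "\<And>z. im z \<ge> R \<Longrightarrow> (\<lambda>i. fps_nth 0 i * tp z ^ i) sums f z"
      using F unfolding has_t_expansion_iff by blast
    moreover have "(\<lambda>i. fps_nth 0 i * tp z ^ i) sums 0" for z by simp
    ultimately have far: "f z = 0" if "im z \<ge> R" for z using that sums_unique2 by blast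
    have "f z = 0" if "z \<in> Omega \<iota>" for z
      by (rule rigid_analytic_identity[OF _ far that])
         (use assms(3) in \<open>auto simp: cusp_forms_def modular_forms_def\<close>)
    thus False using assms(7) by (auto simp: hecke_eigenform_def)
  qed
  moreover have "fps_const ev * F = fps_const (A wp powi k) * scale_op wp F + trace_op wp F"
    by (rule hecke_expansion[OF p F]) (use assms(7) in \<open>auto simp: hecke_eigenform_def\<close>)
  ultimately have *: "ev = A wp ^ n \<and> A wp ^ n * c wp = A wp powi k * c 1"
    using A_sum_eigenvalue[OF p, of "A wp powi k" c ev] Awp unfolding FAS by simp
  have "A wp powi k = A wp ^ n * A wp powi (k - int n)"
    using Awp by (simp add: power_int_diff)
  with * have "A wp ^ n * c wp = A wp ^ n * (A wp powi (k - int n) * c 1)" by (simp only: mult.assoc)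
  hence "c wp = A wp powi (k - int n) * c 1" using Awp by (simp only: mult_cancel_left) simp
  thus ?thesis using * by simp
qed

end
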